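(* For $n\ge 4$, let $T^n=\{3^{n-1}\}$ be the $n$-simplex, $B^n=\{4,3^{n-2}\}$ the $n$-cube and $C^n=\{3^{n-2},4\}$ the $n$-cross-polytope. Then the mixes $T^n\diamond B^n$, $T^n\diamond C^n$ and $T^n\diamond B^n\diamond C^n$ are all polytopal, and $B^n\diamond C^n$ is not polytopal.
   Context: Polytopes. An (abstract) $n$-polytope is a ranked poset with ranks $-1,\dots,n$ such that: there are a unique least face (rank $-1$) and a unique greatest face (rank $n$); every flag (maximal chain) has $n+2$ faces; it is strongly flag-connected (any two flags $\Phi,\Psi$ are joined by a sequence of flags, consecutive ones differing in exactly one face, all containing $\Phi\cap\Psi$); and whenever $F<G$ have ranks $j-1$ and $j+1$ there are exactly two $j$-faces strictly between them. $T^n,B^n,C^n$ are the face lattices of the regular convex $n$-polytopes of Schläfli types $\{3,\dots,3\}$, $\{4,3,\dots,3\}$, $\{3,\dots,3,4\}$ ($n-1$ entries each). For such a polytope $\mathcal P$ with a fixed base flag $\Phi$, its automorphism group is $\langle\rho_0,\dots,\rho_{n-1}\rangle$, where $\rho_i$ maps $\Phi$ to the unique flag differing from $\Phi$ exactly in its $i$-face. Put $\sigma_i=\rho_{i-1}\rho_i$ for $1\le i\le n-1$; the rotation group is $\Gamma^+(\mathcal P)=\langle\sigma_1,\dots,\sigma_{n-1}\rangle$. Mix. For such polytopes $\mathcal P_1,\dots,\mathcal P_m$ of rank $n$ with rotation-group generators $\sigma_i^{(r)}$, let $\beta_i=(\sigma_i^{(1)},\dots,\sigma_i^{(m)})$ for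 $1\le i\le n-1$ and let $\Gamma^+=\Gamma^+(\mathcal P_1\diamond\cdots\diamond\mathcal P_m)=\langle\beta_1,\dots,\beta_{n-1}\rangle\le\Gamma^+(\mathcal P_1)\times\cdots\times\Gamma^+(\mathcal P_m)$. For $I\subseteq\{0,\dots,n-1\}$ put $\Gamma^+_I=\langle\beta_i\beta_{i+1}\cdots\beta_j\mid 1\le i\le j\le n-1,\ i-1\in I,\ j\in I\rangle$. The mix $\mathcal P_1\diamond\cdots\diamond\mathcal P_m$ is the poset whose $j$-faces ($0\le j\le n-1$) are the right cosets of $\Gamma^+_{\{0,\dots,n-1\}\setminus\{j\}}$ in $\Gamma^+$, together with a least face of rank $-1$ and a greatest face of rank $n$, where a $j$-face is below a $k$-face ($j<k$) if and only if the two cosets intersect. The mix is called polytopal if it is a polytope; equivalently, $\Gamma^+$ satisfies the intersection property $\Gamma^+_I\cap\Gamma^+_J=\Gamma^+_{I\cap J}$ for all $I,J\subseteq\{0,\dots,n-1\}$. *)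

theory Defs
  imports "HOL-Analysis.Analysis" "HOL-Algebra.Bij" "HOL-Algebra.Product_Groups"
begin

section \<open>Abstract polytopes\<close>

record 'a ranked_poset =
  faces :: "'a set"
  face_le :: "'a \<Rightarrow> 'a \<Rightarrow> bool"
  face_rank :: "'a \<Rightarrow> int"

definition face_less :: "('a, 'm) ranked_poset_scheme \<Rightarrow> 'a \<Rightarrow> 'a \<Rightarrow> bool" where
  "face_less P F G \<longleftrightarrow> face_le P F G \<and> F \<noteq> G"

definition flags :: "('a, 'm) ranked_poset_scheme \<Rightarrow> 'a set set" where
  "flags P = {\<Phi>. pred_on.maxchain (faces P) (face_le P) \<Phi>}"

definition ranked_partial_order :: "nat \<Rightarrow> ('a, 'm) ranked_poset_scheme \<Rightarrow> bool" where
  "ranked_partial_order n P \<longleftrightarrow>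
     partial_order_on (faces P) {(F, G). F \<in> faces P \<and> G \<in> faces P \<and> face_le P F G} \<and>
     (\<forall>F\<in>faces P. -1 \<le> face_rank P F \<and> face_rank P F \<le> int n) \<and>
     (\<forall>F\<in>faces P. \<forall>G\<in>faces P. face_less P F G \<longrightarrow> face_rank P F < face_rank P G)"

definition differ_in_one_face :: "'a set \<Rightarrow> 'a set \<Rightarrow> bool" where
  "differ_in_one_face \<Phi> \<Psi> \<longleftrightarrow> (\<exists>F G. \<Phi> - \<Psi> = {F} \<and> \<Psi> - \<Phi> = {G})"

definition strongly_flag_connected :: "('a, 'm) ranked_poset_scheme \<Rightarrow> bool" where
  "strongly_flag_connected P \<longleftrightarrow>
     (\<forall>\<Phi>\<in>flags P. \<forall>\<Psi>\<in>flags P.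
        (\<Phi>, \<Psi>) \<in> {(X, Y). X \<in> flags P \<and> Y \<in> flags P \<and>
                          \<Phi> \<inter> \<Psi> \<subseteq> X \<and> \<Phi> \<inter> \<Psi> \<subseteq> Y \<and> differ_in_one_face X Y}\<^sup>*)"

definition abstract_polytope :: "nat \<Rightarrow> ('a, 'm) ranked_poset_scheme \<Rightarrow> bool" where
  "abstract_polytope n P \<longleftrightarrow>
     ranked_partial_order n P \<and>
     (\<exists>!F. F \<in> faces P \<and> (\<forall>G\<in>faces P. face_le P F G)) \<and>
     (\<forall>F\<in>faces P. (\<forall>G\<in>faces P. face_le P F G) \<longrightarrow> face_rank P F = -1) \<and>
     (\<exists>!F. F \<in> faces P \<and> (\<forall>G\<in>faces P. face_le P G F)) \<and>
     (\<forall>F\<in>faces P. (\<forall>G\<in>faces P. face_le P G F) \<longrightarrow> face_rank P F = int n) \<and>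
     (\<forall>\<Phi>\<in>flags P. card \<Phi> = n + 2) \<and>
     strongly_flag_connected P \<and>
     (\<forall>j. \<forall>F\<in>faces P. \<forall>G\<in>faces P.
        face_less P F G \<and> face_rank P F = j - 1 \<and> face_rank P G = j + 1 \<longrightarrow>
        card {H \<in> faces P. face_rank P H = j \<and> face_less P F H \<and> face_less P H G} = 2)"


section \<open>The simplex, the cube and the cross-polytope\<close>

text \<open>
  The library convention \<open>aff_dim {} = -1\<close> gives the empty face, which is a face of every convex
  set, the rank required of the least face.
\<close>

definition face_lattice :: "'a::euclidean_space set \<Rightarrow> 'a set ranked_poset" where
  "face_lattice S = \<lparr>faces = {F. F face_of S}, face_le = (\<subseteq>), face_rank = aff_dim\<rparr>"

text \<open>
  The standard basis of \<open>\<real>\<^sup>n\<close> has mutual distances \<open>sqrt 2\<close>. The point whose coordinates all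
  equal \<open>c = (1 + sqrt (n + 1)) / n\<close> has the same distance from each basis vector, because
  \<open>n c\<^sup>2 - 2 c - 1 = 0\<close>, so that adding it gives the vertices of a regular \<open>n\<close>-simplex.
\<close>

definition regular_simplex :: "(real ^ 'n) set" where
  "regular_simplex =
     convex hull (insert (\<chi> i. (1 + sqrt (real CARD('n) + 1)) / real CARD('n))
                         (range (\<lambda>i. axis i 1)))"

definition hypercube :: "(real ^ 'n) set" where
  "hypercube = convex hull {x. \<forall>i. x $ i \<in> {-1, 1}}"

definition cross_polytope :: "(real ^ 'n) set" where
  "cross_polytope = convex hull {x. \<exists>i. x = axis i 1 \<or> x = axis i (-1)}"

definition simplex_T :: "(real ^ 'n) set ranked_poset" where
  "simplex_T = face_lattice regular_simplex"

definition cube_B :: "(real ^ 'n) set ranked_poset" where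
  "cube_B = face_lattice hypercube"

definition cross_C :: "(real ^ 'n) set ranked_poset" where
  "cross_C = face_lattice cross_polytope"


section \<open>Automorphisms and rotations\<close>

text \<open>
  Products of automorphisms are compositions of functions, so that the right factor acts first.
  The opposite convention replaces each group by its opposite, and inversion then identifies the
  posets of cosets that the two conventions give for the mix.
\<close>

definition aut_group :: "('a, 'm) ranked_poset_scheme \<Rightarrow> ('a \<Rightarrow> 'a) monoid" where
  "aut_group P = (BijGroup (faces P))
     \<lparr>carrier := {\<phi> \<in> Bij (faces P).
        \<forall>F\<in>faces P. \<forall>G\<in>faces P. face_le P (\<phi> F) (\<phi> G) \<longleftrightarrow> face_le P F G}\<rparr>"

definition flag_adjacent ::
    "('a, 'm) ranked_poset_scheme \<Rightarrow> nat \<Rightarrow> 'a set \<Rightarrow> 'a set \<Rightarrow> bool" where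
  "flag_adjacent P i \<Phi> \<Psi> \<longleftrightarrow> \<Phi> \<in> flags P \<and> \<Psi> \<in> flags P \<and>
     (\<exists>F G. \<Phi> - \<Psi> = {F} \<and> \<Psi> - \<Phi> = {G} \<and> face_rank P F = int i \<and> face_rank P G = int i)"

text \<open>
  For the polytopes considered here the automorphism below exists; it is unique because
  an automorphism of a polytope is determined by the image of one flag.
\<close>

definition reflection_gen :: "('a, 'm) ranked_poset_scheme \<Rightarrow> 'a set \<Rightarrow> nat \<Rightarrow> 'a \<Rightarrow> 'a" where
  "reflection_gen P \<Phi> i = (THE \<phi>. \<phi> \<in> carrier (aut_group P) \<and> flag_adjacent P i \<Phi> (\<phi> ` \<Phi>))"

definition rotation_gen :: "('a, 'm) ranked_poset_scheme \<Rightarrow> 'a set \<Rightarrow> nat \<Rightarrow> 'a \<Rightarrow> 'a" where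
  "rotation_gen P \<Phi> i = reflection_gen P \<Phi> (i - 1) \<otimes>\<^bsub>aut_group P\<^esub> reflection_gen P \<Phi> i"

definition rotation_group ::
    "nat \<Rightarrow> ('a, 'm) ranked_poset_scheme \<Rightarrow> 'a set \<Rightarrow> ('a \<Rightarrow> 'a) monoid" where
  "rotation_group n P \<Phi> = (aut_group P)\<lparr>carrier := generate (aut_group P) (rotation_gen P \<Phi> ` {1..n-1})\<rparr>"


section \<open>The mix\<close>

text \<open>
  In the following, \<open>Ps\<close> is the list of the polytopes to be mixed, all of rank \<open>n\<close>, each paired
  with its base flag.
\<close>

definition rotation_product ::
    "nat \<Rightarrow> ('a ranked_poset \<times> 'a set) list \<Rightarrow> (nat \<Rightarrow> 'a \<Rightarrow> 'a) monoid" where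
  "rotation_product n Ps =
     product_group {..<length Ps} (\<lambda>r. rotation_group n (fst (Ps ! r)) (snd (Ps ! r)))"

definition mix_gen :: "('a ranked_poset \<times> 'a set) list \<Rightarrow> nat \<Rightarrow> nat \<Rightarrow> 'a \<Rightarrow> 'a" where
  "mix_gen Ps i = (\<lambda>r\<in>{..<length Ps}. rotation_gen (fst (Ps ! r)) (snd (Ps ! r)) i)"

definition mix_group :: "nat \<Rightarrow> ('a ranked_poset \<times> 'a set) list \<Rightarrow> (nat \<Rightarrow> 'a \<Rightarrow> 'a) set" where
  "mix_group n Ps = generate (rotation_product n Ps) (mix_gen Ps ` {1..n-1})"

definition mix_gen_prod ::
    "nat \<Rightarrow> ('a ranked_poset \<times> 'a set) list \<Rightarrow> nat \<Rightarrow> nat \<Rightarrow> nat \<Rightarrow> 'a \<Rightarrow> 'a" where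
  "mix_gen_prod n Ps i j =
     foldr (mult (rotation_product n Ps)) (map (mix_gen Ps) [i..<Suc j]) \<one>\<^bsub>rotation_product n Ps\<^esub>"

text \<open>
  The subgroup denoted \<open>\<Gamma>\<^sup>+\<^sub>I\<close> in the literature; the full group \<open>\<Gamma>\<^sup>+\<close> is \<open>mix_group\<close>.
\<close>

definition mix_subgroup ::
    "nat \<Rightarrow> ('a ranked_poset \<times> 'a set) list \<Rightarrow> nat set \<Rightarrow> (nat \<Rightarrow> 'a \<Rightarrow> 'a) set" where
  "mix_subgroup n Ps I = generate (rotation_product n Ps)
     {mix_gen_prod n Ps i j | i j. 1 \<le> i \<and> i \<le> j \<and> j \<le> n - 1 \<and> i - 1 \<in> I \<and> j \<in> I}"

text \<open>
  A proper face carries its rank, since cosets of the subgroups for different ranks may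
  coincide as sets.
\<close>

datatype 'g mix_face = Least_Face | Proper_Face nat "'g set" | Greatest_Face

fun mix_le :: "'g mix_face \<Rightarrow> 'g mix_face \<Rightarrow> bool" where
  "mix_le Least_Face _ = True"
| "mix_le _ Greatest_Face = True"
| "mix_le (Proper_Face j X) (Proper_Face k Y) \<longleftrightarrow>
     j < k \<and> X \<inter> Y \<noteq> {} \<or> j = k \<and> X = Y"
| "mix_le (Proper_Face _ _) Least_Face = False"
| "mix_le Greatest_Face Least_Face = False"
| "mix_le Greatest_Face (Proper_Face _ _) = False"

definition mix ::
    "nat \<Rightarrow> ('a ranked_poset \<times> 'a set) list \<Rightarrow> (nat \<Rightarrow> 'a \<Rightarrow> 'a) mix_face ranked_poset" where
  "mix n Ps =
     \<lparr>faces = {Least_Face, Greatest_Face} \<union>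
        {Proper_Face j (mix_subgroup n Ps ({..<n} - {j}) #>\<^bsub>rotation_product n Ps\<^esub> x) | j x.
           j < n \<and> x \<in> mix_group n Ps},
      face_le = mix_le,
      face_rank = (\<lambda>F. case F of Least_Face \<Rightarrow> -1 | Proper_Face j _ \<Rightarrow> int j | Greatest_Face \<Rightarrow> int n)\<rparr>"

abbreviation polytopal :: "nat \<Rightarrow> ('a, 'm) ranked_poset_scheme \<Rightarrow> bool" where
  "polytopal n M \<equiv> abstract_polytope n M"

end

theory Submission
  imports Defs
begin

text \<open>
  Let \<open>\<alpha> i\<close> be the tuple of the \<open>i\<close>-th reflections of the factors, so that the rotations of the mix are
  \<open>\<beta> i = \<alpha> (i - 1) \<otimes> \<alpha> i\<close>. As reflections are involutions, \<open>\<beta> i \<otimes> \<dots> \<otimes> \<beta> j\<close> telescopes to \<open>\<alpha> (i - 1) \<otimes> \<alpha> j\<close>, and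
  the rotation subgroup for an index set \<open>I\<close> is the even part of the group \<open>G I\<close> generated by the
  \<open>\<alpha> i\<close> with \<open>i \<in> I\<close>. Hence the mix is the poset of cosets of the groups \<open>G (- {j})\<close>, in which \<open>\<alpha> j\<close> is omitted
  (\<open>mix_eq_coset_poset\<close>).

  Generators that are not neighbours commute, and therefore \<open>G (- {j})\<close> is the product of two commuting
  groups below and above \<open>j\<close>. This alone makes incidence transitive and places every chain in a flag
  of the form \<open>{G (- {j}) x | j}\<close>. If the groups \<open>G (- {j})\<close> with \<open>j \<in> J\<close> always intersect in \<open>G (- J)\<close>, then
  the diamond condition and strong flag-connectedness hold
  (\<open>intersection_property_imp_polytope\<close>). Conversely, if only the identity fixes the base flag, a
  polytope needs the special case of the vertex and the facet
  (\<open>polytope_imp_vertex_facet_intersection\<close>).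

  For the simplex the group is the symmetric group on \<open>n + 1\<close> letters with the adjacent transpositions,
  and bubble sort proves the intersection property (\<open>sorting\<close>). The property passes from some factors
  of a mix to further factors if, after omission of the first or of the last generator, the former
  determine the latter (\<open>intersection_property_refine\<close>). The generators of the cube other than the
  first, and those of the cross-polytope other than the last, just permute the coordinates by adjacent
  transpositions, as the corresponding generators of the simplex do with its vertices
  (\<open>simplex_determines_cross\<close>). This settles the three mixes with the simplex.

  In the mix of cube and cross-polytope, the fourth powers of \<open>\<alpha> 0 \<otimes> \<alpha> 1\<close> and of \<open>\<alpha> (n - 2) \<otimes> \<alpha> (n - 1)\<close> are
  3-cycles in one factor and trivial in the other. Their conjugates produce an element that
  lies in both \<open>G (- {0})\<close> and \<open>G (- {n - 1})\<close> and is trivial in the cube only, although \<open>G (- {0, n - 1})\<close> acts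
  in the same way on both factors (\<open>vertex_facet_intersection_fails\<close>).

  It remains to find the reflections of the three convex polytopes. Their face lattices come from
  simplicial complexes, up to reversal of the order for the cube, and automorphisms of such a lattice
  are the permutations of vertices that preserve the complex; the three cases are \<open>simplex_model\<close>,
  \<open>cross_model\<close> and \<open>cube_model\<close>.
\<close>

section \<open>Groups generated by a string of involutions\<close>

text \<open>
  Adjacent generators are unrestricted, so that the product of two neighbours may have any order.
\<close>

locale string_group = group M for M (structure) +
  fixes n :: nat and \<alpha> :: "nat \<Rightarrow> 'a"
  assumes gen_closed [simp]: "i < n \<Longrightarrow> \<alpha> i \<in> carrier M"
    and gen_invol: "i < n \<Longrightarrow> \<alpha> i \<otimes> \<alpha> i = \<one>"
    and gen_comm_less: "j < n \<Longrightarrow> i + 1 < j \<Longrightarrow> \<alpha> i \<otimes> \<alpha> j = \<alpha> j \<otimes> \<alpha> i"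
begin

text \<open>
  Indices from \<open>n\<close> on are ignored, so that \<open>G (- J)\<close> is the group that omits the generators in \<open>J\<close>.
\<close>

definition G :: "nat set \<Rightarrow> 'a set" where
  "G I = generate M (\<alpha> ` (I \<inter> {..<n}))"

lemma gens_closed: "\<alpha> ` (I \<inter> {..<n}) \<subseteq> carrier M"
  by auto

lemma G_subgroup: "subgroup (G I) M"
  unfolding G_def by (rule generate_is_subgroup[OF gens_closed])

lemma G_carrier: "x \<in> G I \<Longrightarrow> x \<in> carrier M"
  by (rule subgroup.mem_carrier[OF G_subgroup])

lemma G_mult: "x \<in> G I \<Longrightarrow> y \<in> G I \<Longrightarrow> x \<otimes> y \<in> G I"
  by (rule subgroup.m_closed[OF G_subgroup])

lemma G_inv: "x \<in> G I \<Longrightarrow> inv x \<in> G I"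
  by (rule subgroup.m_inv_closed[OF G_subgroup])

lemma G_one [simp]: "\<one> \<in> G I"
  by (rule subgroup.one_closed[OF G_subgroup])

lemma G_gen: "i \<in> I \<Longrightarrow> i < n \<Longrightarrow> \<alpha> i \<in> G I"
  unfolding G_def by (rule generate.incl) auto

lemma G_mono: "I \<subseteq> J \<Longrightarrow> G I \<subseteq> G J"
  unfolding G_def by (rule mono_generate) auto

lemma G_into_UNIV: "x \<in> G I \<Longrightarrow> x \<in> G UNIV"
  using subsetD[OF G_mono[of I UNIV]] by simp

lemma gen_inv: "i < n \<Longrightarrow> inv (\<alpha> i) = \<alpha> i"
  by (simp add: gen_invol inv_equality)

lemma gen_comm: "i < n \<Longrightarrow> j < n \<Longrightarrow> i + 1 < j \<or> j + 1 < i \<Longrightarrow> \<alpha> i \<otimes> \<alpha> j = \<alpha> j \<otimes> \<alpha> i"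
  using gen_comm_less by metis

lemma gen_cancel: "i < n \<Longrightarrow> x \<in> carrier M \<Longrightarrow> \<alpha> i \<otimes> (\<alpha> i \<otimes> x) = x"
  by (metis gen_closed gen_invol l_one m_assoc)

text \<open>
  The generators are involutions, so that a group element is a word in them and a property that
  survives left multiplication by a generator holds throughout the group.
\<close>

lemma G_induct [consumes 1, case_names one step]:
  assumes x: "x \<in> G I" and one: "P \<one>"
    and step: "\<And>i x. i \<in> I \<Longrightarrow> i < n \<Longrightarrow> x \<in> G I \<Longrightarrow> P x \<Longrightarrow> P (\<alpha> i \<otimes> x)"
  shows "P x"
proof -
  have "P (x \<otimes> y)" if "y \<in> G I" "P y" for y
    using x[unfolded G_def] that
  proof (induction x arbitrary: y rule: generate.induct)
    case one
    then show ?case using G_carrier by simp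
  next
    case (incl h)
    then show ?case using step by auto
  next
    case (inv h)
    then show ?case using step gen_inv by auto
  next
    case (eng h1 h2)
    have c: "h1 \<in> carrier M" "h2 \<in> carrier M" "h2 \<in> G I"
      using eng generate_in_carrier[OF gens_closed] by (auto simp: G_def)
    have "P (h1 \<otimes> (h2 \<otimes> y))"
      using eng c G_mult by blast
    then show ?case using c G_carrier[OF eng.prems(1)] m_assoc by simp
  qed
  from this[of \<one>] show ?thesis using one G_carrier[OF x] by simp
qed

lemma G_comm:
  assumes "x \<in> G I" "y \<in> G J" and far: "\<And>i j. i \<in> I \<Longrightarrow> j \<in> J \<Longrightarrow> i + 1 < j \<or> j + 1 < i"
  shows "x \<otimes> y = y \<otimes> x"
  using assms(1)
proof (induction rule: G_induct)
  case one
  then show ?case using G_carrier assms(2) by simp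
next
  case (step i x)
  have "\<alpha> i \<otimes> y = y \<otimes> \<alpha> i" using assms(2)
  proof (induction rule: G_induct)
    case one
    then show ?case using step by simp
  next
    case (step j z)
    then show ?case using \<open>i \<in> I\<close> \<open>i < n\<close> far gen_comm G_carrier m_assoc gen_closed by metis
  qed
  then show ?case using step G_carrier assms(2) m_assoc gen_closed by metis
qed

text \<open>
  Omitting the generator \<open>k\<close> from a string leaves two commuting strings.
\<close>

lemma G_split:
  assumes "x \<in> G I" "k \<notin> I"
  obtains a b where "a \<in> G (I \<inter> {..<k})" "b \<in> G (I \<inter> {k<..})" "x = a \<otimes> b" "x = b \<otimes> a"
proof -
  have comm: "a \<otimes> b = b \<otimes> a" if "a \<in> G (I \<inter> {..<k})" "b \<in> G (I \<inter> {k<..})" for a b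
    by (rule G_comm[OF that]) auto
  have "\<exists>a\<in>G (I \<inter> {..<k}). \<exists>b\<in>G (I \<inter> {k<..}). x = a \<otimes> b" using assms(1)
  proof (induction rule: G_induct)
    case one
    then show ?case by (intro bexI[of _ \<one>]) auto
  next
    case (step i x)
    then obtain a b where ab: "a \<in> G (I \<inter> {..<k})" "b \<in> G (I \<inter> {k<..})" "x = a \<otimes> b" by blast
    show ?case
    proof (cases "i < k")
      case True
      then have "\<alpha> i \<otimes> a \<in> G (I \<inter> {..<k})" using step ab by (intro G_mult G_gen) auto
      then show ?thesis using ab step G_carrier m_assoc by (metis gen_closed)
    next
      case False
      with step assms(2) have "k < i" by (metis nat_neq_iff)
      then have i: "\<alpha> i \<in> G (I \<inter> {k<..})" using step by (intro G_gen) auto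
      then have "\<alpha> i \<otimes> x = a \<otimes> (\<alpha> i \<otimes> b)"
        using ab comm[OF ab(1) i] step G_carrier m_assoc by metis
      then show ?thesis using ab G_mult[OF i ab(2)] by blast
    qed
  qed
  then show thesis using that comm by blast
qed

lemma mult_inv_cancel:
  "x \<in> carrier M \<Longrightarrow> y \<in> carrier M \<Longrightarrow> z \<in> carrier M \<Longrightarrow> (x \<otimes> inv y) \<otimes> (y \<otimes> inv z) = x \<otimes> inv z"
  by (metis inv_closed inv_solve_left m_assoc m_closed)

lemma gen_mult_inv: "i < n \<Longrightarrow> x \<in> carrier M \<Longrightarrow> (\<alpha> i \<otimes> x) \<otimes> inv x = \<alpha> i"
  by (simp add: m_assoc)

text \<open>
  With right cosets, \<open>x\<close> and \<open>y\<close> have the same \<open>j\<close>-face if they differ by a left factor that omits the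
  generator \<open>j\<close>.
\<close>

definition same :: "nat \<Rightarrow> 'a \<Rightarrow> 'a \<Rightarrow> bool" where
  "same j x y \<longleftrightarrow> y \<otimes> inv x \<in> G (- {j})"

lemma same_refl [simp]: "x \<in> carrier M \<Longrightarrow> same j x x"
  by (simp add: same_def)

lemma same_sym: "same j x y \<Longrightarrow> x \<in> carrier M \<Longrightarrow> y \<in> carrier M \<Longrightarrow> same j y x"
  unfolding same_def using G_inv[of "y \<otimes> inv x" "- {j}"] by (simp add: inv_mult_group)

lemma same_trans: "same j x y \<Longrightarrow> same j y z \<Longrightarrow> x \<in> carrier M \<Longrightarrow> y \<in> carrier M \<Longrightarrow> z \<in> carrier M
    \<Longrightarrow> same j x z"
  unfolding same_def using G_mult[of "z \<otimes> inv y" "- {j}" "y \<otimes> inv x"] mult_inv_cancel by simp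

lemma same_mult: "w \<in> G I \<Longrightarrow> j \<notin> I \<Longrightarrow> x \<in> carrier M \<Longrightarrow> same j x (w \<otimes> x)"
  unfolding same_def using G_mono[of I "- {j}"] G_carrier[of w I] by (auto simp: m_assoc)

text \<open>
  The quotient of \<open>z\<close> and \<open>x\<close> splits into a part below \<open>k\<close>, which does not affect the levels from \<open>k\<close> on,
  and a part above \<open>k\<close>, which does not affect the levels up to \<open>k\<close>. The second part applied to \<open>x\<close> is \<open>y\<close>.
\<close>

lemma same_interpolate:
  assumes "same k x z" "x \<in> G UNIV" "z \<in> G UNIV"
  obtains y where "y \<in> G UNIV" "\<And>j. j \<le> k \<Longrightarrow> same j x y" "\<And>j. k \<le> j \<Longrightarrow> same j y z"
proof -
  have c: "x \<in> carrier M" "z \<in> carrier M" using assms G_carrier by auto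
  have "z \<otimes> inv x \<in> G (- {k})" using assms by (simp add: same_def)
  then obtain a b where ab: "a \<in> G (- {k} \<inter> {..<k})" "b \<in> G (- {k} \<inter> {k<..})" "z \<otimes> inv x = a \<otimes> b"
    by (rule G_split) auto
  have cab: "a \<in> carrier M" "b \<in> carrier M" using ab G_carrier by auto
  have z: "z = a \<otimes> (b \<otimes> x)"
    using ab(3) c cab by (metis inv_solve_right m_assoc m_closed)
  show thesis
  proof
    show "b \<otimes> x \<in> G UNIV" using G_mult[OF G_into_UNIV[OF ab(2)] assms(2)] .
    show "same j x (b \<otimes> x)" if "j \<le> k" for j
      using that ab c by (intro same_mult) auto
    show "same j (b \<otimes> x) z" if "k \<le> j" for j
      using that ab c cab unfolding z by (intro same_mult) auto
  qed
qed

end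

text \<open>
  The sign separates words of even length from words of odd length. The last assumption says that
  the generator \<open>j\<close> moves the \<open>j\<close>-face of the base flag.
\<close>

locale signed_string_group = string_group +
  fixes sgn :: "'a \<Rightarrow> int"
  assumes sgn_mult: "x \<in> carrier M \<Longrightarrow> y \<in> carrier M \<Longrightarrow> sgn (x \<otimes> y) = sgn x * sgn y"
    and sgn_gen: "i < n \<Longrightarrow> sgn (\<alpha> i) = -1"
    and rank_ge: "3 \<le> n"
    and gen_escapes: "j < n \<Longrightarrow> \<alpha> j \<notin> G (- {j})"
begin

text \<open>
  The rotation subgroup: its generators are the partial products of consecutive rotations.
\<close>

definition Gp :: "nat set \<Rightarrow> 'a set" where
  "Gp I = generate M {\<alpha> i \<otimes> \<alpha> j | i j. i < j \<and> j < n \<and> i \<in> I \<and> j \<in> I}"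

lemma sgn_one: "sgn \<one> = 1"
proof -
  have "sgn (\<alpha> 0 \<otimes> \<alpha> 0) = 1" using sgn_mult[of "\<alpha> 0" "\<alpha> 0"] sgn_gen[of 0] rank_ge by simp
  then show ?thesis using gen_invol[of 0] rank_ge by simp
qed

lemma sgn_G: "x \<in> G I \<Longrightarrow> sgn x = 1 \<or> sgn x = -1"
proof (induction rule: G_induct)
  case (step i x)
  then show ?case using sgn_mult sgn_gen G_carrier by auto
qed (simp add: sgn_one)

lemma sgn_gen_mult: "i < n \<Longrightarrow> x \<in> carrier M \<Longrightarrow> sgn (\<alpha> i \<otimes> x) = - sgn x"
  by (simp add: sgn_mult sgn_gen)

lemma Gp_gens: "{\<alpha> i \<otimes> \<alpha> j | i j. i < j \<and> j < n \<and> i \<in> I \<and> j \<in> I} \<subseteq> carrier M"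
  by auto

lemma Gp_subgroup: "subgroup (Gp I) M"
  unfolding Gp_def by (rule generate_is_subgroup[OF Gp_gens])

text \<open>
  If \<open>x\<close> is odd, each \<open>\<alpha> i \<otimes> x\<close> with \<open>i \<in> I\<close> is a product of pairs of generators; induction over words
  carries this along with the even case.
\<close>

lemma Gp_eq: "Gp I = {x \<in> G I. sgn x = 1}"
proof
  have "subgroup {x \<in> G I. sgn x = 1} M"
  proof
    show "{x \<in> G I. sgn x = 1} \<subseteq> carrier M" using G_carrier by auto
    show "\<one> \<in> {x \<in> G I. sgn x = 1}" by (simp add: sgn_one)
  next
    fix x y assume "x \<in> {x \<in> G I. sgn x = 1}" "y \<in> {x \<in> G I. sgn x = 1}"
    then show "x \<otimes> y \<in> {x \<in> G I. sgn x = 1}" using G_mult sgn_mult G_carrier by auto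
  next
    fix x assume x: "x \<in> {x \<in> G I. sgn x = 1}"
    then have "sgn (inv x) * sgn x = 1" using sgn_mult[of "inv x" x] G_carrier sgn_one by auto
    then show "inv x \<in> {x \<in> G I. sgn x = 1}" using x G_inv by auto
  qed
  moreover have "{\<alpha> i \<otimes> \<alpha> j | i j. i < j \<and> j < n \<and> i \<in> I \<and> j \<in> I} \<subseteq> {x \<in> G I. sgn x = 1}"
    using G_mult G_gen sgn_mult sgn_gen by auto
  ultimately show "Gp I \<subseteq> {x \<in> G I. sgn x = 1}"
    unfolding Gp_def by (rule generate_subgroup_incl[rotated])
next
  have pair: "\<alpha> i \<otimes> \<alpha> j \<in> Gp I" if "i \<in> I" "j \<in> I" "i < n" "j < n" for i j
  proof -
    consider "i < j" | "i = j" | "j < i" by linarith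
    then show ?thesis
    proof cases
      case 1
      then show ?thesis unfolding Gp_def using that by (intro generate.incl) auto
    next
      case 2
      then show ?thesis using that gen_invol subgroup.one_closed[OF Gp_subgroup] by simp
    next
      case 3
      then have "\<alpha> j \<otimes> \<alpha> i \<in> Gp I" unfolding Gp_def using that by (intro generate.incl) auto
      then have "inv (\<alpha> j \<otimes> \<alpha> i) \<in> Gp I" using subgroup.m_inv_closed[OF Gp_subgroup] by simp
      then show ?thesis using that by (simp add: inv_mult_group gen_inv)
    qed
  qed
  have "sgn x = 1 \<and> x \<in> Gp I \<or> sgn x = -1 \<and> (\<forall>i\<in>I. i < n \<longrightarrow> \<alpha> i \<otimes> x \<in> Gp I)" if "x \<in> G I" for x
    using that
  proof (induction rule: G_induct)
    case one
    then show ?case using sgn_one subgroup.one_closed[OF Gp_subgroup] by simp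
  next
    case (step j x)
    note c = G_carrier[OF step(3)]
    from step.IH show ?case
    proof
      assume x: "sgn x = 1 \<and> x \<in> Gp I"
      have "\<alpha> i \<otimes> (\<alpha> j \<otimes> x) \<in> Gp I" if "i \<in> I" "i < n" for i
        using pair[OF that(1) step(1) that(2) step(2)] x subgroup.m_closed[OF Gp_subgroup] c that step
        by (metis gen_closed m_assoc)
      then show ?thesis using x step c by (simp add: sgn_gen_mult)
    next
      assume x: "sgn x = -1 \<and> (\<forall>i\<in>I. i < n \<longrightarrow> \<alpha> i \<otimes> x \<in> Gp I)"
      then show ?thesis using step c by (simp add: sgn_gen_mult)
    qed
  qed
  then show "{x \<in> G I. sgn x = 1} \<subseteq> Gp I" by fastforce
qed

text \<open>
  Only even elements are collected, because the mix consists of cosets in the rotation group; the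
  representative \<open>x\<close> may nevertheless be odd, which lets single generators act on faces.
\<close>

definition coset :: "nat \<Rightarrow> 'a \<Rightarrow> 'a set" where
  "coset j x = {y \<in> G UNIV. sgn y = 1 \<and> same j x y}"

lemma G_UNIV_carrier [simp]: "x \<in> G UNIV \<Longrightarrow> x \<in> carrier M"
  by (rule G_carrier)

lemma G_UNIV_gen [simp]: "x \<in> G UNIV \<Longrightarrow> i < n \<Longrightarrow> \<alpha> i \<otimes> x \<in> G UNIV"
  using G_mult G_gen by auto

text \<open>
  Rank at least 3 leaves a generator different from two given ones. Multiplication by it
  corrects the sign of an element within the intersection of two cosets.
\<close>

lemma even_representative:
  assumes "x \<in> G UNIV"
  obtains y where "y \<in> G UNIV" "sgn y = 1" "same j x y" "same k x y"
proof (cases "sgn x = 1")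
  case True
  then show ?thesis using assms by (intro that) auto
next
  case False
  obtain i :: nat where i: "i < 3" "i \<noteq> j" "i \<noteq> k"
  proof (cases "0 \<in> {j, k}")
    case True
    then show ?thesis using that[of 1] that[of 2] by (cases "1 \<in> {j, k}") auto
  qed (use that[of 0] in auto)
  then have "i < n" using rank_ge by simp
  moreover have "\<alpha> i \<in> G {i}" by (rule G_gen) (use \<open>i < n\<close> in auto)
  ultimately show ?thesis
    using i assms False sgn_G[OF assms]
    by (intro that[of "\<alpha> i \<otimes> x"]) (auto simp: sgn_gen_mult intro: same_mult[of _ "{i}"])
qed

lemma coset_inter_iff:
  assumes "x \<in> G UNIV" "y \<in> G UNIV"
  shows "coset j x \<inter> coset k y \<noteq> {} \<longleftrightarrow> (\<exists>z\<in>G UNIV. same j x z \<and> same k y z)"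
proof
  assume "\<exists>z\<in>G UNIV. same j x z \<and> same k y z"
  then obtain z where z: "z \<in> G UNIV" "same j x z" "same k y z" by blast
  obtain u where "u \<in> G UNIV" "sgn u = 1" "same j z u" "same k z u"
    using even_representative[OF z(1)] by blast
  then have "u \<in> coset j x \<inter> coset k y"
    using z assms same_trans by (auto simp: coset_def)
  then show "coset j x \<inter> coset k y \<noteq> {}" by blast
qed (auto simp: coset_def)

lemma coset_eq_iff:
  assumes "x \<in> G UNIV" "y \<in> G UNIV"
  shows "coset j x = coset j y \<longleftrightarrow> same j x y"
proof
  assume "coset j x = coset j y"
  moreover have "coset j x \<inter> coset j x \<noteq> {}" using coset_inter_iff[of x x j j] assms same_refl[of x j] G_UNIV_carrier by blast
  ultimately have "coset j x \<inter> coset j y \<noteq> {}" by simp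
  then show "same j x y" using coset_inter_iff[OF assms] same_trans same_sym assms
    by (meson G_UNIV_carrier)
next
  assume "same j x y"
  then have "same j x z \<longleftrightarrow> same j y z" if "z \<in> G UNIV" for z
    using same_trans same_sym assms that by (meson G_UNIV_carrier)
  then show "coset j x = coset j y" by (auto simp: coset_def)
qed

lemma coset_eq_right_coset:
  assumes "x \<in> G UNIV" "sgn x = 1"
  shows "Gp (- {j}) #> x = coset j x"
proof
  show "Gp (- {j}) #> x \<subseteq> coset j x"
  proof
    fix y assume "y \<in> Gp (- {j}) #> x"
    then obtain h where h: "h \<in> G (- {j})" "sgn h = 1" "y = h \<otimes> x" unfolding r_coset_def Gp_eq by auto
    then show "y \<in> coset j x"
      using assms G_into_UNIV[OF h(1)] G_mult same_mult[OF h(1)] sgn_mult G_carrier[OF h(1)]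
      by (auto simp: coset_def)
  qed
  show "coset j x \<subseteq> Gp (- {j}) #> x"
  proof
    fix y assume y: "y \<in> coset j x"
    then have c: "y \<in> carrier M" "x \<in> carrier M" using assms by (auto simp: coset_def)
    have "sgn (y \<otimes> inv x) * sgn x = sgn y"
      using sgn_mult[of "y \<otimes> inv x" x] c by (simp add: m_assoc)
    then have "y \<otimes> inv x \<in> Gp (- {j})" using y assms by (auto simp: coset_def same_def Gp_eq)
    moreover have "y = (y \<otimes> inv x) \<otimes> x" using c by (simp add: m_assoc)
    ultimately show "y \<in> Gp (- {j}) #> x" unfolding r_coset_def by blast
  qed
qed

lemma proper_faces_eq:
  assumes "j < n"
  shows "{Gp (- {j}) #> x | x. x \<in> Gp UNIV} = coset j ` G UNIV"
proof
  show "{Gp (- {j}) #> x | x. x \<in> Gp UNIV} \<subseteq> coset j ` G UNIV"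
    using coset_eq_right_coset by (auto simp: Gp_eq)
  show "coset j ` G UNIV \<subseteq> {Gp (- {j}) #> x | x. x \<in> Gp UNIV}"
  proof
    fix X assume "X \<in> coset j ` G UNIV"
    then obtain x where x: "x \<in> G UNIV" "X = coset j x" by blast
    obtain y where y: "y \<in> G UNIV" "sgn y = 1" "same j x y" using even_representative[OF x(1)] by metis
    then have "X = Gp (- {j}) #> y" using x coset_eq_iff coset_eq_right_coset by metis
    then show "X \<in> {Gp (- {j}) #> x | x. x \<in> Gp UNIV}" using y by (auto simp: Gp_eq)
  qed
qed

end

section \<open>The coset poset\<close>

context signed_string_group
begin

definition coset_poset :: "'a mix_face ranked_poset" where
  "coset_poset =
     \<lparr>faces = {Least_Face, Greatest_Face} \<union> {Proper_Face j (coset j x) | j x. j < n \<and> x \<in> G UNIV},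
      face_le = mix_le,
      face_rank = (\<lambda>F. case F of Least_Face \<Rightarrow> -1 | Proper_Face j _ \<Rightarrow> int j | Greatest_Face \<Rightarrow> int n)\<rparr>"

text \<open>
  Integer indices from \<open>-1\<close> to \<open>n\<close> include the two improper faces, on which every element agrees.
\<close>

definition face :: "int \<Rightarrow> 'a \<Rightarrow> 'a mix_face" where
  "face k x = (if k < 0 then Least_Face else if int n \<le> k then Greatest_Face
               else Proper_Face (nat k) (coset (nat k) x))"

definition agree :: "int \<Rightarrow> 'a \<Rightarrow> 'a \<Rightarrow> bool" where
  "agree k x y \<longleftrightarrow> 0 \<le> k \<and> k < int n \<longrightarrow> same (nat k) x y"

definition flag_of :: "'a \<Rightarrow> 'a mix_face set" where
  "flag_of x = (\<lambda>k. face k x) ` {-1..int n}"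

lemma agree_refl [simp]: "x \<in> G UNIV \<Longrightarrow> agree k x x"
  by (simp add: agree_def)

lemma agree_sym: "agree k x y \<Longrightarrow> x \<in> G UNIV \<Longrightarrow> y \<in> G UNIV \<Longrightarrow> agree k y x"
  unfolding agree_def using same_sym by simp

lemma agree_trans: "agree k x y \<Longrightarrow> agree k y z \<Longrightarrow> x \<in> G UNIV \<Longrightarrow> y \<in> G UNIV \<Longrightarrow> z \<in> G UNIV
    \<Longrightarrow> agree k x z"
  unfolding agree_def by (metis G_UNIV_carrier same_trans)

lemma agree_interpolate:
  assumes "agree k x z" "x \<in> G UNIV" "z \<in> G UNIV"
  obtains y where "y \<in> G UNIV" "\<And>j. j \<le> k \<Longrightarrow> agree j x y" "\<And>j. k \<le> j \<Longrightarrow> agree j y z"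
proof (cases "0 \<le> k \<and> k < int n")
  case True
  then have "same (nat k) x z" using assms by (simp add: agree_def)
  then obtain y where "y \<in> G UNIV" "\<And>j. j \<le> nat k \<Longrightarrow> same j x y" "\<And>j. nat k \<le> j \<Longrightarrow> same j y z"
    using same_interpolate[OF _ assms(2,3)] by blast
  then show ?thesis using True by (intro that[of y]) (auto simp: agree_def nat_le_eq_zle)
next
  case False
  then show ?thesis
    using that[of x] that[of z] assms by (cases "k < 0") (auto simp: agree_def)
qed

lemma faces_coset_poset: "faces coset_poset = {face k x | k x. -1 \<le> k \<and> k \<le> int n \<and> x \<in> G UNIV}"
proof
  show "faces coset_poset \<subseteq> {face k x | k x. -1 \<le> k \<and> k \<le> int n \<and> x \<in> G UNIV}"
  proof
    fix F assume "F \<in> faces coset_poset"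
    then consider "F = Least_Face" | "F = Greatest_Face"
      | j x where "j < n" "x \<in> G UNIV" "F = Proper_Face j (coset j x)"
      by (auto simp: coset_poset_def)
    then have "\<exists>k x. F = face k x \<and> -1 \<le> k \<and> k \<le> int n \<and> x \<in> G UNIV"
    proof cases
      case 1
      then show ?thesis by (intro exI[of _ "-1"] exI[of _ \<one>]) (simp add: face_def)
    next
      case 2
      then show ?thesis by (intro exI[of _ "int n"] exI[of _ \<one>]) (simp add: face_def)
    next
      case 3
      then show ?thesis by (intro exI[of _ "int j"] exI[of _ x]) (simp add: face_def)
    qed
    then show "F \<in> {face k x | k x. -1 \<le> k \<and> k \<le> int n \<and> x \<in> G UNIV}" by blast
  qed
  have "nat k < n" if "0 \<le> k" "k < int n" for k
    using that by linarith
  then show "{face k x | k x. -1 \<le> k \<and> k \<le> int n \<and> x \<in> G UNIV} \<subseteq> faces coset_poset"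
    unfolding coset_poset_def face_def by fastforce
qed

lemma face_in [simp]: "-1 \<le> k \<Longrightarrow> k \<le> int n \<Longrightarrow> x \<in> G UNIV \<Longrightarrow> face k x \<in> faces coset_poset"
  by (auto simp: faces_coset_poset)

lemma face_cases:
  assumes "F \<in> faces coset_poset"
  obtains k x where "F = face k x" "-1 \<le> k" "k \<le> int n" "x \<in> G UNIV"
  using assms by (auto simp: faces_coset_poset)

lemma face_rank_face [simp]: "-1 \<le> k \<Longrightarrow> k \<le> int n \<Longrightarrow> face_rank coset_poset (face k x) = k"
  by (auto simp: face_def coset_poset_def)

lemma face_eq_iff:
  assumes "-1 \<le> j" "j \<le> int n" "-1 \<le> k" "k \<le> int n" "x \<in> G UNIV" "y \<in> G UNIV"
  shows "face j x = face k y \<longleftrightarrow> j = k \<and> agree j x y"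
proof -
  have "face j x = face k y \<Longrightarrow> j = k" using face_rank_face assms by metis
  moreover have "face j x = face j y \<longleftrightarrow> agree j x y"
    using assms by (auto simp: face_def agree_def coset_eq_iff)
  ultimately show ?thesis by blast
qed

lemma face_le_iff:
  assumes "-1 \<le> j" "j \<le> int n" "-1 \<le> k" "k \<le> int n" "x \<in> G UNIV" "y \<in> G UNIV"
  shows "face_le coset_poset (face j x) (face k y) \<longleftrightarrow>
    (j < k \<and> (\<exists>z\<in>G UNIV. agree j x z \<and> agree k y z)) \<or> (j = k \<and> agree j x y)"
proof -
  have jk: "nat j < nat k \<longleftrightarrow> j < k" "nat j = nat k \<longleftrightarrow> j = k" if "0 \<le> j" "0 \<le> k" using that by auto
  have ex: "\<exists>z\<in>G UNIV. same i x z" "\<exists>z\<in>G UNIV. same i y z" "\<exists>z. z \<in> G UNIV" for i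
    using assms same_refl G_UNIV_carrier by blast+
  have meet: "coset i x \<inter> coset l y = {} \<longleftrightarrow> \<not> (\<exists>z\<in>G UNIV. same i x z \<and> same l y z)"
    and eq: "coset i x = coset i y \<longleftrightarrow> same i x y" for i l
    using coset_inter_iff coset_eq_iff assms by blast+
  consider "j < 0" | "j = int n" | "k < 0" "0 \<le> j" | "k = int n" "0 \<le> j" "j < int n"
    | "0 \<le> j" "j < int n" "0 \<le> k" "k < int n"
    using assms by linarith
  then show ?thesis
  proof cases
    case 5
    show ?thesis
    proof (cases "j = k")
      case True
      with 5 show ?thesis by (simp add: face_def agree_def coset_poset_def eq)
    next
      case False
      with 5 jk show ?thesis by (auto simp: face_def agree_def coset_poset_def meet)
    qed
  qed (use assms ex in \<open>auto simp: face_def agree_def coset_poset_def\<close>)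
qed

lemma face_le_same [simp]:
  "-1 \<le> j \<Longrightarrow> j \<le> k \<Longrightarrow> k \<le> int n \<Longrightarrow> x \<in> G UNIV \<Longrightarrow> face_le coset_poset (face j x) (face k x)"
  by (subst face_le_iff) (auto intro: agree_refl)

lemma face_le_rank:
  assumes "face_le coset_poset F H" "F \<in> faces coset_poset" "H \<in> faces coset_poset"
  shows "face_rank coset_poset F \<le> face_rank coset_poset H"
    and "face_rank coset_poset F = face_rank coset_poset H \<Longrightarrow> F = H"
proof -
  obtain j x where F: "F = face j x" "-1 \<le> j" "j \<le> int n" "x \<in> G UNIV" using assms face_cases by metis
  obtain k y where H: "H = face k y" "-1 \<le> k" "k \<le> int n" "y \<in> G UNIV" using assms face_cases by metis
  have "(j < k) \<or> (j = k \<and> agree j x y)" using assms(1) F H by (auto simp: face_le_iff)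
  then show "face_rank coset_poset F \<le> face_rank coset_poset H"
    and "face_rank coset_poset F = face_rank coset_poset H \<Longrightarrow> F = H"
    using F H by (auto simp: face_eq_iff)
qed

text \<open>
  If \<open>E\<close> and \<open>F\<close> share \<open>z\<close>, and \<open>F\<close> and \<open>H\<close> share \<open>w\<close>, then \<open>z\<close> and \<open>w\<close> agree at the rank of \<open>F\<close>, and an element
  interpolated between them there is common to \<open>E\<close> and \<open>H\<close>.
\<close>

lemma face_le_trans:
  assumes "face_le coset_poset E F" "face_le coset_poset F H"
    "E \<in> faces coset_poset" "F \<in> faces coset_poset" "H \<in> faces coset_poset"
  shows "face_le coset_poset E H"
proof (cases "E = F \<or> F = H")
  case True
  then show ?thesis using assms by auto
next
  case False
  obtain i u where E: "E = face i u" "-1 \<le> i" "i \<le> int n" "u \<in> G UNIV" using assms face_cases by metis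
  obtain j x where F: "F = face j x" "-1 \<le> j" "j \<le> int n" "x \<in> G UNIV" using assms face_cases by metis
  obtain k y where H: "H = face k y" "-1 \<le> k" "k \<le> int n" "y \<in> G UNIV" using assms face_cases by metis
  have "i < j" using False assms(1) E F by (auto simp: face_le_iff face_eq_iff)
  moreover have "j < k" using False assms(2) F H by (auto simp: face_le_iff face_eq_iff)
  ultimately obtain z w where zw: "z \<in> G UNIV" "agree i u z" "agree j x z"
      "w \<in> G UNIV" "agree j x w" "agree k y w"
    using assms(1,2) E F H by (auto simp: face_le_iff)
  have "agree j z w" using zw agree_trans[OF agree_sym[of j x z]] F by blast
  then obtain v where v: "v \<in> G UNIV" "\<And>l. l \<le> j \<Longrightarrow> agree l z v" "\<And>l. j \<le> l \<Longrightarrow> agree l v w"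
    using agree_interpolate zw by metis
  have "agree i u v" using agree_trans[OF zw(2) v(2)[of i]] \<open>i < j\<close> E zw v by simp
  moreover have "agree k y v"
    using agree_trans[OF zw(6) agree_sym[OF v(3)[of k]]] \<open>j < k\<close> H zw v by simp
  ultimately show ?thesis using E H v \<open>i < j\<close> \<open>j < k\<close> by (auto simp: face_le_iff)
qed

lemma flag_of_chain: "x \<in> G UNIV \<Longrightarrow> pred_on.chain (faces coset_poset) (face_le coset_poset) (flag_of x)"
  unfolding pred_on.chain_def flag_of_def by auto (metis face_le_same linear)

text \<open>
  By induction on the rank: if \<open>x\<close> represents the members of the chain up to rank \<open>j\<close>, and the
  next member meets the one of rank \<open>j\<close> in \<open>z\<close>, then an element interpolated between \<open>x\<close> and \<open>z\<close> at \<open>j\<close>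
  represents the next member as well.
\<close>

lemma chain_subset_flag:
  assumes "pred_on.chain (faces coset_poset) (face_le coset_poset) C"
  obtains x where "x \<in> G UNIV" "C \<subseteq> flag_of x"
proof -
  have CF: "C \<subseteq> faces coset_poset" and comp: "\<And>F H. F \<in> C \<Longrightarrow> H \<in> C \<Longrightarrow>
      F = H \<or> face_le coset_poset F H \<or> face_le coset_poset H F"
    using assms by (auto simp: pred_on.chain_def)
  have "\<exists>x\<in>G UNIV. \<forall>F\<in>C. face_rank coset_poset F < int m - 1 \<longrightarrow> F = face (face_rank coset_poset F) x" for m
  proof (induction m)
    case 0
    have "\<not> face_rank coset_poset F < -1" if "F \<in> C" for F
    proof -
      obtain k x where "F = face k x" "-1 \<le> k" "k \<le> int n" using \<open>F \<in> C\<close> CF face_cases by blast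
      then show ?thesis by simp
    qed
    then show ?case by (intro bexI[of _ \<one>]) auto
  next
    case (Suc m)
    then obtain x where x: "x \<in> G UNIV"
      "\<And>F. F \<in> C \<Longrightarrow> face_rank coset_poset F < int m - 1 \<Longrightarrow> F = face (face_rank coset_poset F) x" by blast
    show ?case
    proof (cases "\<exists>F\<in>C. face_rank coset_poset F = int m - 1")
      case False
      then have "face_rank coset_poset F < int m - 1"
        if "F \<in> C" "face_rank coset_poset F < int (Suc m) - 1" for F
        using that by (metis add_diff_cancel_left' diff_add_cancel of_nat_Suc order_le_less zle_add1_eq_le)
      then show ?thesis using x by blast
    next
      case True
      then obtain F where F: "F \<in> C" "face_rank coset_poset F = int m - 1" by blast
      obtain k y where "F = face k y" "-1 \<le> k" "k \<le> int n" and y: "y \<in> G UNIV"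
        using F CF face_cases by blast
      with F have Fy: "F = face (int m - 1) y" "int m - 1 \<le> int n" by auto
      define S where "S = face_rank coset_poset ` {H \<in> C. face_rank coset_poset H < int m - 1}"
      have S_ge: "-1 \<le> s \<and> s \<le> int n" if "s \<in> S" for s
        using that CF face_cases unfolding S_def by (smt (verit, ccfv_SIG) face_rank_face imageE mem_Collect_eq subset_iff)
      then have fin: "finite S" by (intro finite_subset[of S "{-1..int n}"]) auto
      obtain x' where x': "x' \<in> G UNIV" "F = face (int m - 1) x'" "\<And>s. s \<in> S \<Longrightarrow> face s x = face s x'"
      proof (cases "S = {}")
        case True
        then show ?thesis using that[of y] y Fy by simp
      next
        case False
        define j where "j = Max S"
        have j: "j \<in> S" "\<And>s. s \<in> S \<Longrightarrow> s \<le> j" using fin False by (auto simp: j_def)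
        then obtain H where H: "H \<in> C" "face_rank coset_poset H = j" "j < int m - 1" by (auto simp: S_def)
        then have Hx: "H = face j x" using x(2) by auto
        have "face_le coset_poset H F"
          using comp[OF H(1) F(1)] face_le_rank(1)[of F H] F H CF by fastforce
        then obtain z where z: "z \<in> G UNIV" "agree j x z" "agree (int m - 1) y z"
          using Hx Fy S_ge[OF j(1)] x y H(3) by (auto simp: face_le_iff)
        obtain v where v: "v \<in> G UNIV" "\<And>l. l \<le> j \<Longrightarrow> agree l x v" "\<And>l. j \<le> l \<Longrightarrow> agree l v z"
          using agree_interpolate[OF z(2) x(1) z(1)] by blast
        have "agree (int m - 1) y v" using agree_trans[OF z(3) agree_sym[OF v(3)]] H(3) z v y by simp
        then have "F = face (int m - 1) v" using Fy v y F(2) by (subst Fy(1), subst face_eq_iff) auto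
        moreover have "face s x = face s v" if "s \<in> S" for s
          using that S_ge[OF that] v(2)[OF j(2)[OF that]] x v(1) by (simp add: face_eq_iff)
        ultimately show ?thesis using that v(1) by blast
      qed
      have "H = face (face_rank coset_poset H) x'"
        if H: "H \<in> C" "face_rank coset_poset H < int (Suc m) - 1" for H
      proof (cases "face_rank coset_poset H = int m - 1")
        case True
        then have "H = F" using comp[OF H(1) F(1)] face_le_rank(2)[of F H] face_le_rank(2)[of H F] F H(1) CF
          by auto
        then show ?thesis using x' F by simp
      next
        case False
        then have less: "face_rank coset_poset H < int m - 1" using H(2) by simp
        then have "face_rank coset_poset H \<in> S" using H by (auto simp: S_def)
        then show ?thesis using x(2)[OF H(1) less] x'(3) by metis
      qed
      then show ?thesis using x'(1) by blast
    qed
  qed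
  from this[of "n + 3"] obtain x where x: "x \<in> G UNIV"
    "\<And>F. F \<in> C \<Longrightarrow> face_rank coset_poset F < int n + 2 \<Longrightarrow> F = face (face_rank coset_poset F) x"
    by auto
  have "F \<in> flag_of x" if "F \<in> C" for F
  proof -
    obtain k y where k: "F = face k y" "-1 \<le> k" "k \<le> int n"
      using \<open>F \<in> C\<close> CF face_cases by blast
    then have "F = face k x" using x(2)[OF \<open>F \<in> C\<close>] by simp
    then show ?thesis using k by (auto simp: flag_of_def)
  qed
  then show thesis using that x(1) by blast
qed

lemma face_mem_flag_iff:
  "-1 \<le> k \<Longrightarrow> k \<le> int n \<Longrightarrow> x \<in> G UNIV \<Longrightarrow> y \<in> G UNIV \<Longrightarrow> face k x \<in> flag_of y \<longleftrightarrow> agree k x y"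
  unfolding flag_of_def by (auto simp: face_eq_iff image_iff)

lemma flag_of_subset_iff:
  assumes "x \<in> G UNIV" "y \<in> G UNIV"
  shows "flag_of x \<subseteq> flag_of y \<longleftrightarrow> (\<forall>k. agree k x y)"
proof
  assume L: "flag_of x \<subseteq> flag_of y"
  show "\<forall>k. agree k x y"
  proof
    fix k show "agree k x y"
    proof (cases "0 \<le> k \<and> k < int n")
      case True
      then have "face k x \<in> flag_of y" using L by (auto simp: flag_of_def)
      then show ?thesis using True assms by (auto simp: flag_of_def face_eq_iff)
    qed (auto simp: agree_def)
  qed
next
  assume "\<forall>k. agree k x y"
  then have "face k x = face k y" if "k \<in> {-1..int n}" for k
    using that assms by (simp add: face_eq_iff)
  then show "flag_of x \<subseteq> flag_of y" by (auto simp: flag_of_def)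
qed

lemma flag_of_eq_iff:
  assumes "x \<in> G UNIV" "y \<in> G UNIV"
  shows "flag_of x = flag_of y \<longleftrightarrow> (\<forall>k. agree k x y)"
  using flag_of_subset_iff[OF assms] flag_of_subset_iff[OF assms(2,1)] agree_sym assms by blast

lemma flags_coset_poset: "flags coset_poset = flag_of ` G UNIV"
proof
  show "flags coset_poset \<subseteq> flag_of ` G UNIV"
  proof
    fix \<Phi> assume "\<Phi> \<in> flags coset_poset"
    then have \<Phi>: "pred_on.chain (faces coset_poset) (face_le coset_poset) \<Phi>"
      "\<And>S. pred_on.chain (faces coset_poset) (face_le coset_poset) S \<Longrightarrow> \<not> \<Phi> \<subset> S"
      by (auto simp: flags_def pred_on.maxchain_def)
    obtain x where x: "x \<in> G UNIV" "\<Phi> \<subseteq> flag_of x" using chain_subset_flag[OF \<Phi>(1)] by blast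
    then have "\<Phi> = flag_of x" using \<Phi>(2) flag_of_chain by blast
    then show "\<Phi> \<in> flag_of ` G UNIV" using x by blast
  qed
  show "flag_of ` G UNIV \<subseteq> flags coset_poset"
  proof
    fix \<Phi> assume "\<Phi> \<in> flag_of ` G UNIV"
    then obtain x where x: "x \<in> G UNIV" "\<Phi> = flag_of x" by blast
    have "S = \<Phi>" if S: "pred_on.chain (faces coset_poset) (face_le coset_poset) S" "\<Phi> \<subseteq> S" for S
    proof -
      obtain y where y: "y \<in> G UNIV" "S \<subseteq> flag_of y" using chain_subset_flag[OF S(1)] by blast
      then have "flag_of x = flag_of y"
        using x S flag_of_subset_iff[of x y] flag_of_eq_iff[of x y] by blast
      then show ?thesis using x S y by blast
    qed
    then show "\<Phi> \<in> flags coset_poset"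
      using flag_of_chain[OF x(1)] x(2) unfolding flags_def pred_on.maxchain_def by blast
  qed
qed

lemma agree_gen_iff:
  assumes "j < n" "x \<in> G UNIV"
  shows "agree k x (\<alpha> j \<otimes> x) \<longleftrightarrow> k \<noteq> int j"
proof -
  have "agree (int j) x (\<alpha> j \<otimes> x) \<longleftrightarrow> False"
    using assms gen_escapes by (simp add: agree_def same_def gen_mult_inv)
  moreover have "same (nat k) x (\<alpha> j \<otimes> x)" if "k \<noteq> int j" "0 \<le> k"
    using assms that by (intro same_mult[of _ "{j}"] G_gen) auto
  ultimately show ?thesis by (auto simp: agree_def)
qed


lemma flag_of_diff_gen:
  assumes "j < n" "x \<in> G UNIV"
  shows "flag_of x - flag_of (\<alpha> j \<otimes> x) = {face (int j) x}"
proof -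
  have "face k x \<in> flag_of (\<alpha> j \<otimes> x) \<longleftrightarrow> k \<noteq> int j" if "k \<in> {-1..int n}" for k
  proof
    assume "face k x \<in> flag_of (\<alpha> j \<otimes> x)"
    then show "k \<noteq> int j" using that assms by (auto simp: flag_of_def face_eq_iff agree_gen_iff)
  next
    assume "k \<noteq> int j"
    then have "face k x = face k (\<alpha> j \<otimes> x)" using that assms by (simp add: face_eq_iff agree_gen_iff)
    then show "face k x \<in> flag_of (\<alpha> j \<otimes> x)" using that by (auto simp: flag_of_def)
  qed
  then show ?thesis using assms unfolding flag_of_def[of x] by auto
qed

lemma differ_gen:
  assumes "j < n" "x \<in> G UNIV"
  shows "differ_in_one_face (flag_of x) (flag_of (\<alpha> j \<otimes> x))"
proof -
  have "flag_of (\<alpha> j \<otimes> x) - flag_of x = {face (int j) (\<alpha> j \<otimes> x)}"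
    using flag_of_diff_gen[of j "\<alpha> j \<otimes> x"] assms gen_cancel by simp
  then show ?thesis using flag_of_diff_gen[OF assms] unfolding differ_in_one_face_def by blast
qed

text \<open>
  For the identity this says that an intersection of groups \<open>G (- {j})\<close> with \<open>j \<in> J\<close> is \<open>G (- J)\<close>.
  A general \<open>\<pi>\<close> compares elements only by what \<open>\<pi>\<close> retains of them, for example by their components in
  some factors of a mix.
\<close>

definition intersection_property :: "('a \<Rightarrow> 'c) \<Rightarrow> bool" where
  "intersection_property \<pi> \<longleftrightarrow>
     (\<forall>J\<subseteq>{..<n}. \<forall>x\<in>G UNIV. (\<forall>j\<in>J. \<pi> x \<in> \<pi> ` G (- {j})) \<longrightarrow> \<pi> x \<in> \<pi> ` G (- J))"

text \<open>
  If \<open>\<pi>\<close> satisfies the intersection property, so does a finer \<open>\<pi>'\<close> that \<open>\<pi>\<close> determines on the group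
  omitting an end \<open>e\<close> of the string. Cut the string at the element \<open>k\<close> of \<open>J\<close> nearest to \<open>e\<close>: one factor
  of an element of \<open>G (- {k})\<close> lies in \<open>G (- J)\<close>, and the other omits \<open>e\<close>, so that \<open>\<pi>\<close> controls it.
\<close>

lemma intersection_property_refine:
  assumes ip: "intersection_property \<pi>"
    and e: "e = 0 \<or> e = n - 1"
    and coarser: "\<And>x y. x \<in> G UNIV \<Longrightarrow> y \<in> G UNIV \<Longrightarrow> \<pi>' x = \<pi>' y \<Longrightarrow> \<pi> x = \<pi> y"
    and cong: "\<And>a x y. a \<in> G UNIV \<Longrightarrow> x \<in> G UNIV \<Longrightarrow> y \<in> G UNIV \<Longrightarrow> \<pi>' x = \<pi>' y \<Longrightarrow>
      \<pi>' (a \<otimes> x) = \<pi>' (a \<otimes> y)"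
    and inj: "\<And>x y. x \<in> G (- {e}) \<Longrightarrow> y \<in> G (- {e}) \<Longrightarrow> \<pi> x = \<pi> y \<Longrightarrow> \<pi>' x = \<pi>' y"
  shows "intersection_property \<pi>'"
  unfolding intersection_property_def
proof (intro allI impI ballI)
  fix J x assume J: "J \<subseteq> {..<n}" and x: "x \<in> G UNIV" and xJ: "\<forall>j\<in>J. \<pi>' x \<in> \<pi>' ` G (- {j})"
  show "\<pi>' x \<in> \<pi>' ` G (- J)"
  proof (cases "J = {}")
    case True
    then show ?thesis using x by simp
  next
    case False
    have fin: "finite J" using J finite_subset by blast
    define k where "k = (if e = 0 then Min J else Max J)"
    have k: "k \<in> J" using fin False by (simp add: k_def)
    have below: "{..<k} \<subseteq> - J" if "e = 0"
    proof -
      have "k \<le> j" if "j \<in> J" for j using Min_le[OF fin that] \<open>e = 0\<close> by (simp add: k_def)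
      then show ?thesis by (auto simp: not_le[symmetric])
    qed
    have above: "{k<..} \<subseteq> - J" if "e \<noteq> 0"
    proof -
      have "j \<le> k" if "j \<in> J" for j using Max_ge[OF fin that] \<open>e \<noteq> 0\<close> by (simp add: k_def)
      then show ?thesis by (auto simp: not_le[symmetric])
    qed
    obtain xk where xk: "xk \<in> G (- {k})" "\<pi>' x = \<pi>' xk" using xJ k by blast
    obtain a b where ab: "a \<in> G (- J)" "b \<in> G (- {e})" "xk = a \<otimes> b"
    proof -
      obtain c d where cd: "c \<in> G (- {k} \<inter> {..<k})" "d \<in> G (- {k} \<inter> {k<..})" "xk = c \<otimes> d" "xk = d \<otimes> c"
        using G_split[OF xk(1)] by blast
      show thesis
      proof (cases "e = 0")
        case True
        have "c \<in> G (- J)" by (rule subsetD[OF G_mono cd(1)]) (use below[OF True] in auto)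
        moreover have "d \<in> G (- {e})" by (rule subsetD[OF G_mono cd(2)]) (use True in auto)
        ultimately show thesis using that cd by blast
      next
        case False
        have "d \<in> G (- J)" by (rule subsetD[OF G_mono cd(2)]) (use above[OF False] in auto)
        moreover have "c \<in> G (- {e})"
          by (rule subsetD[OF G_mono cd(1)]) (use False e k J in auto)
        ultimately show thesis using that cd by blast
      qed
    qed
    have aG: "a \<in> G UNIV" and bG: "b \<in> G UNIV" using ab G_into_UNIV by blast+
    have "\<pi> b \<in> \<pi> ` G (- {j})" if "j \<in> insert e J" for j
    proof (cases "j = e")
      case True
      then show ?thesis using ab by blast
    next
      case False
      then have j: "j \<in> J" using that by simp
      then obtain xj where xj: "xj \<in> G (- {j})" "\<pi>' x = \<pi>' xj" using xJ by blast
      have aj: "a \<in> G (- {j})" by (rule subsetD[OF G_mono ab(1)]) (use j in auto)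
      have xjG: "xj \<in> G UNIV" using xj G_into_UNIV by blast
      have "\<pi>' (inv a \<otimes> xk) = \<pi>' (inv a \<otimes> xj)"
        using cong[OF G_inv[OF aG] G_into_UNIV[OF xk(1)] xjG] xk xj by simp
      moreover have "inv a \<otimes> xk = b" using ab(3) aG bG by (simp add: m_assoc[symmetric])
      ultimately have "\<pi> b = \<pi> (inv a \<otimes> xj)"
        using coarser[OF bG G_mult[OF G_inv[OF aG] xjG]] by simp
      then show ?thesis using G_mult[OF G_inv[OF aj] xj(1)] by blast
    qed
    moreover have "insert e J \<subseteq> {..<n}" using J e rank_ge by auto
    ultimately have "\<pi> b \<in> \<pi> ` G (- insert e J)"
      using ip bG unfolding intersection_property_def by blast
    then obtain y where y: "y \<in> G (- insert e J)" "\<pi> b = \<pi> y" by blast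
    have "y \<in> G (- {e})" by (rule subsetD[OF G_mono y(1)]) auto
    then have "\<pi>' b = \<pi>' y" using inj ab(2) y(2) by blast
    then have "\<pi>' xk = \<pi>' (a \<otimes> y)" using cong[OF aG bG G_into_UNIV[OF y(1)]] ab(3) by simp
    moreover have "y \<in> G (- J)" by (rule subsetD[OF G_mono y(1)]) auto
    ultimately show ?thesis using xk(2) G_mult[OF ab(1)] by (metis image_eqI)
  qed
qed

lemma coset_poset_order:
  "ranked_partial_order n coset_poset"
proof -
  have "partial_order_on (faces coset_poset)
      {(F, H). F \<in> faces coset_poset \<and> H \<in> faces coset_poset \<and> face_le coset_poset F H}"
    unfolding partial_order_on_def preorder_on_def
  proof (intro conjI)
    show "refl_on (faces coset_poset)
        {(F, H). F \<in> faces coset_poset \<and> H \<in> faces coset_poset \<and> face_le coset_poset F H}"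
      unfolding refl_on_def by (auto elim!: face_cases)
    show "trans {(F, H). F \<in> faces coset_poset \<and> H \<in> faces coset_poset \<and> face_le coset_poset F H}"
      unfolding trans_def using face_le_trans by blast
    show "antisym {(F, H). F \<in> faces coset_poset \<and> H \<in> faces coset_poset \<and> face_le coset_poset F H}"
      unfolding antisym_def using face_le_rank by (metis (no_types, lifting) case_prodD mem_Collect_eq order_antisym)
  qed auto
  moreover have "-1 \<le> face_rank coset_poset F \<and> face_rank coset_poset F \<le> int n"
    if "F \<in> faces coset_poset" for F
    using that by (auto elim!: face_cases)
  moreover have "face_rank coset_poset F < face_rank coset_poset H"
    if "F \<in> faces coset_poset" "H \<in> faces coset_poset" "face_less coset_poset F H" for F H
    using that face_le_rank unfolding face_less_def by (metis order_le_less)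
  ultimately show ?thesis unfolding ranked_partial_order_def by blast
qed

lemma coset_poset_between:
  assumes "0 \<le> j" "j < int n" "x \<in> G UNIV"
    and H: "H \<in> faces coset_poset" "face_rank coset_poset H = j"
      "face_le coset_poset (face (j - 1) x) H" "face_le coset_poset H (face (j + 1) x)"
  obtains z where "z \<in> G UNIV" "H = face j z" "agree (j - 1) x z" "agree (j + 1) x z"
proof -
  obtain y where y: "H = face j y" "y \<in> G UNIV" using H face_cases face_rank_face by metis
  obtain z1 where z1: "z1 \<in> G UNIV" "agree (j - 1) x z1" "agree j y z1"
    using H(3) assms y by (auto simp: face_le_iff)
  obtain z2 where z2: "z2 \<in> G UNIV" "agree j y z2" "agree (j + 1) x z2"
    using H(4) assms y by (auto simp: face_le_iff)
  have "agree j z1 z2" using agree_trans[OF agree_sym[OF z1(3)] z2(2)] z1 z2 y by simp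
  then obtain z where z: "z \<in> G UNIV" "\<And>i. i \<le> j \<Longrightarrow> agree i z1 z" "\<And>i. j \<le> i \<Longrightarrow> agree i z z2"
    using agree_interpolate z1(1) z2(1) by metis
  show thesis
  proof
    show "z \<in> G UNIV" by fact
    show "H = face j z"
      using y agree_trans[OF z1(3) z(2)[of j]] z1 z assms by (simp add: face_eq_iff)
    show "agree (j - 1) x z" using agree_trans[OF z1(2) z(2)] z1 z assms by simp
    show "agree (j + 1) x z" using agree_trans[OF z2(3) agree_sym[OF z(3)]] z2 z assms by simp
  qed
qed

text \<open>
  An element that fixes the faces of ranks \<open>j - 1\<close> and \<open>j + 1\<close> is a word in \<open>\<alpha> j\<close> and generators that commute
  with \<open>\<alpha> j\<close> and fix the \<open>j\<close>-face; only the parity of the number of letters \<open>\<alpha> j\<close> matters.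
\<close>

lemma coset_poset_diamond:
  assumes ip: "intersection_property (\<lambda>x. x)" and j: "0 \<le> j" "j < int n" and x: "x \<in> G UNIV"
  shows "{H \<in> faces coset_poset. face_rank coset_poset H = j \<and>
      face_less coset_poset (face (j - 1) x) H \<and> face_less coset_poset H (face (j + 1) x)} =
      {face j x, face j (\<alpha> (nat j) \<otimes> x)}" (is "?L = ?R")
proof
  have nj: "nat j < n" using j by linarith
  have less: "face_less coset_poset (face (j - 1) x) (face j y) \<longleftrightarrow>
        face_le coset_poset (face (j - 1) x) (face j y)"
    "face_less coset_poset (face j y) (face (j + 1) x) \<longleftrightarrow>
        face_le coset_poset (face j y) (face (j + 1) x)" if "y \<in> G UNIV" for y
    using that x j by (auto simp: face_less_def face_eq_iff)
  show "?R \<subseteq> ?L"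
  proof -
    have "face (j - 1) x = face (j - 1) (\<alpha> (nat j) \<otimes> x)" "face (j + 1) x = face (j + 1) (\<alpha> (nat j) \<otimes> x)"
      using x j nj by (auto simp: face_eq_iff agree_gen_iff)
    then have "face_le coset_poset (face (j - 1) x) (face j (\<alpha> (nat j) \<otimes> x))"
      "face_le coset_poset (face j (\<alpha> (nat j) \<otimes> x)) (face (j + 1) x)"
      using x j nj by simp_all
    then show ?thesis using less x j nj by simp
  qed
  show "?L \<subseteq> ?R"
  proof
    fix H assume H: "H \<in> ?L"
    then obtain z where z: "z \<in> G UNIV" "H = face j z" "agree (j - 1) x z" "agree (j + 1) x z"
      using coset_poset_between[OF j x, of H] by (auto simp: face_less_def)
    define J where "J = {i. i < n \<and> (int i = j - 1 \<or> int i = j + 1)}"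
    have "z \<otimes> inv x \<in> G (- {i})" if "i \<in> J" for i
    proof -
      have "agree (int i) x z" "i < n" using that z unfolding J_def by auto
      then show ?thesis by (simp add: agree_def same_def)
    qed
    moreover have "J \<subseteq> {..<n}" by (auto simp: J_def)
    ultimately have w: "z \<otimes> inv x \<in> G (- J)"
      using ip G_mult[OF z(1) G_inv[OF x]] unfolding intersection_property_def image_ident by blast
    have "\<alpha> (nat j) \<otimes> v = v \<otimes> \<alpha> (nat j) \<and> (v \<in> G (- {nat j}) \<or> \<alpha> (nat j) \<otimes> v \<in> G (- {nat j}))"
      if "v \<in> G (- J)" for v
      using that
    proof (induction rule: G_induct)
      case one
      then show ?case using nj by simp
    next
      case (step i v)
      note c = gen_closed[OF nj] gen_closed[OF step(2)] G_carrier[OF step(3)]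
      show ?case
      proof (cases "i = nat j")
        case True
        have "\<alpha> i \<otimes> (\<alpha> i \<otimes> v) = \<alpha> i \<otimes> (v \<otimes> \<alpha> i)" using step.IH True by simp
        also have "\<dots> = (\<alpha> i \<otimes> v) \<otimes> \<alpha> i" using m_assoc c by simp
        finally have "\<alpha> i \<otimes> (\<alpha> i \<otimes> v) = (\<alpha> i \<otimes> v) \<otimes> \<alpha> i" .
        moreover have "\<alpha> i \<otimes> (\<alpha> i \<otimes> v) = v" using gen_cancel step(2) c by simp
        ultimately show ?thesis using step.IH True by metis
      next
        case False
        then have far: "i + 1 < nat j \<or> nat j + 1 < i" using step(1,2) j unfolding J_def by auto
        have i: "\<alpha> i \<in> G (- {nat j})" using step False by (intro G_gen) auto
        have "\<alpha> (nat j) \<otimes> (\<alpha> i \<otimes> v) = (\<alpha> i \<otimes> \<alpha> (nat j)) \<otimes> v"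
          using gen_comm[OF step(2) nj far] m_assoc c by simp
        then have *: "\<alpha> (nat j) \<otimes> (\<alpha> i \<otimes> v) = \<alpha> i \<otimes> (\<alpha> (nat j) \<otimes> v)"
          using m_assoc c by simp
        then show ?thesis using step.IH G_mult[OF i] m_assoc c by auto
      qed
    qed
    from this[OF w] have "z \<otimes> inv x \<in> G (- {nat j}) \<or> (z \<otimes> inv x) \<otimes> \<alpha> (nat j) \<in> G (- {nat j})"
      by metis
    then have "same (nat j) x z \<or> same (nat j) (\<alpha> (nat j) \<otimes> x) z"
      using x z nj by (simp add: same_def inv_mult_group gen_inv m_assoc)
    then show "H \<in> ?R" using z x j nj by (auto simp: face_eq_iff agree_def same_sym)
  qed
qed


lemma face_least_greatest:
  "x \<in> G UNIV \<Longrightarrow> F \<in> faces coset_poset \<Longrightarrow> face_le coset_poset (face (-1) x) F"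
  "x \<in> G UNIV \<Longrightarrow> F \<in> faces coset_poset \<Longrightarrow> face_le coset_poset F (face (int n) x)"
proof -
  assume x: "x \<in> G UNIV" and F: "F \<in> faces coset_poset"
  obtain k y where k: "F = face k y" "-1 \<le> k" "k \<le> int n" "y \<in> G UNIV" using F face_cases by metis
  have "face (-1) x = face (-1) y" "face (int n) x = face (int n) y" by (simp_all add: face_def)
  then show "face_le coset_poset (face (-1) x) F" "face_le coset_poset F (face (int n) x)"
    using k by simp_all
qed

text \<open>
  If two flags share the faces of ranks in \<open>J\<close>, the intersection property writes their quotient as a
  word in the other generators. Its letters are the steps of a path that never moves a shared face.
\<close>

lemma coset_poset_connected:
  assumes ip: "intersection_property (\<lambda>x. x)"
  shows "strongly_flag_connected coset_poset"
  unfolding strongly_flag_connected_def flags_coset_poset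
proof (intro ballI)
  fix \<Phi> \<Psi> assume "\<Phi> \<in> flag_of ` G UNIV" "\<Psi> \<in> flag_of ` G UNIV"
  then obtain x y where x: "x \<in> G UNIV" "\<Phi> = flag_of x" and y: "y \<in> G UNIV" "\<Psi> = flag_of y" by blast
  let ?R = "{(X, Y). X \<in> flag_of ` G UNIV \<and> Y \<in> flag_of ` G UNIV \<and>
                     \<Phi> \<inter> \<Psi> \<subseteq> X \<and> \<Phi> \<inter> \<Psi> \<subseteq> Y \<and> differ_in_one_face X Y}"
  define J where "J = {j. j < n \<and> same j x y}"
  have "J \<subseteq> {..<n}" "\<forall>j\<in>J. y \<otimes> inv x \<in> G (- {j})" by (auto simp: J_def same_def)
  then have "y \<otimes> inv x \<in> G (- J)"
    using ip G_mult[OF y(1) G_inv[OF x(1)]] unfolding intersection_property_def image_ident by blast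
  have sub: "\<Phi> \<inter> \<Psi> \<subseteq> flag_of (w \<otimes> x)" if w: "w \<in> G (- J)" for w
  proof
    fix F assume F: "F \<in> \<Phi> \<inter> \<Psi>"
    then obtain k where k: "F = face k x" "-1 \<le> k" "k \<le> int n" using x by (auto simp: flag_of_def)
    moreover have "agree k x y" using F k x y by (auto simp: flag_of_def face_eq_iff)
    ultimately have "agree k x (w \<otimes> x)"
      using same_mult[OF w] x(1) by (auto simp: agree_def J_def)
    then have "F = face k (w \<otimes> x)"
      using k x G_mult[OF G_into_UNIV[OF w] x(1)] by (simp add: face_eq_iff)
    then show "F \<in> flag_of (w \<otimes> x)" using k by (auto simp: flag_of_def)
  qed
  have "(flag_of x, flag_of (w \<otimes> x)) \<in> ?R\<^sup>*" if "w \<in> G (- J)" for w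
    using that
  proof (induction rule: G_induct)
    case one
    then show ?case using x by simp
  next
    case (step i w)
    have w: "w \<otimes> x \<in> G UNIV" using G_mult[OF G_into_UNIV[OF step(3)] x(1)] .
    have aw: "(\<alpha> i \<otimes> w) \<otimes> x = \<alpha> i \<otimes> (w \<otimes> x)" using m_assoc step G_carrier[OF step(3)] x by simp
    have "\<alpha> i \<otimes> w \<in> G (- J)" using G_mult G_gen step by simp
    then have "(flag_of (w \<otimes> x), flag_of (\<alpha> i \<otimes> w \<otimes> x)) \<in> ?R"
      using sub[OF step(3)] sub[of "\<alpha> i \<otimes> w"] differ_gen[OF step(2) w] w step(2) unfolding aw by auto
    then show ?case using step.IH by (rule rtrancl_into_rtrancl[rotated])
  qed
  from this[OF \<open>y \<otimes> inv x \<in> G (- J)\<close>] have "(\<Phi>, flag_of (y \<otimes> inv x \<otimes> x)) \<in> ?R\<^sup>*"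
    using x by simp
  then show "(\<Phi>, \<Psi>) \<in> ?R\<^sup>*" using x y by (simp add: m_assoc)
qed

theorem intersection_property_imp_polytope:
  assumes ip: "intersection_property (\<lambda>x. x)"
  shows "abstract_polytope n coset_poset"
proof -
  note fl = face_least_greatest[OF G_one]
  have least: "F = face (-1) \<one>"
    if "F \<in> faces coset_poset" "\<forall>H\<in>faces coset_poset. face_le coset_poset F H" for F
    using face_le_rank[of F "face (-1) \<one>"] face_le_rank[of "face (-1) \<one>" F] fl that by (simp add: order_antisym)
  have greatest: "F = face (int n) \<one>"
    if "F \<in> faces coset_poset" "\<forall>H\<in>faces coset_poset. face_le coset_poset H F" for F
    using face_le_rank[of F "face (int n) \<one>"] face_le_rank[of "face (int n) \<one>" F] fl that by (simp add: order_antisym)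
  have ranks: "face_rank coset_poset (face (-1) \<one>) = -1" "face_rank coset_poset (face (int n) \<one>) = int n"
    by simp_all
  have card: "card \<Phi> = n + 2" if "\<Phi> \<in> flags coset_poset" for \<Phi>
  proof -
    obtain x where x: "x \<in> G UNIV" "\<Phi> = flag_of x" using \<open>\<Phi> \<in> flags coset_poset\<close> flags_coset_poset by auto
    have "inj_on (\<lambda>k. face k x) {-1..int n}" by (rule inj_onI) (use x in \<open>auto simp: face_eq_iff\<close>)
    then show ?thesis unfolding x flag_of_def by (simp add: card_image)
  qed
  have diamond: "card {H \<in> faces coset_poset. face_rank coset_poset H = j \<and>
      face_less coset_poset E H \<and> face_less coset_poset H F} = 2"
    if EF: "E \<in> faces coset_poset" "F \<in> faces coset_poset" "face_less coset_poset E F"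
      "face_rank coset_poset E = j - 1" "face_rank coset_poset F = j + 1" for j E F
  proof -
    obtain u where u: "E = face (j - 1) u" "u \<in> G UNIV" "-1 \<le> j - 1" using EF face_cases face_rank_face by metis
    obtain v where v: "F = face (j + 1) v" "v \<in> G UNIV" "j + 1 \<le> int n" using EF face_cases face_rank_face by metis
    obtain x where x: "x \<in> G UNIV" "agree (j - 1) u x" "agree (j + 1) v x"
      using EF(3) u v by (auto simp: face_less_def face_le_iff)
    have "E = face (j - 1) x" "F = face (j + 1) x" using x u v by (auto simp: face_eq_iff)
    moreover have "face j x \<noteq> face j (\<alpha> (nat j) \<otimes> x)"
    proof -
      have "nat j < n" using u v by linarith
      then show ?thesis using u v x agree_gen_iff[of "nat j" x j] by (simp add: face_eq_iff)
    qed
    ultimately show ?thesis using coset_poset_diamond[OF ip, of j x] u v x by simp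
  qed
  show ?thesis
    unfolding abstract_polytope_def
  proof (intro conjI allI ballI impI)
    show "\<exists>!F. F \<in> faces coset_poset \<and> (\<forall>H\<in>faces coset_poset. face_le coset_poset F H)"
      using least fl by (intro ex1I[of _ "face (-1) \<one>"]) auto
    show "\<exists>!F. F \<in> faces coset_poset \<and> (\<forall>H\<in>faces coset_poset. face_le coset_poset H F)"
      using greatest fl by (intro ex1I[of _ "face (int n) \<one>"]) auto
  next
    fix F assume "F \<in> faces coset_poset" "\<forall>H\<in>faces coset_poset. face_le coset_poset F H"
    then show "face_rank coset_poset F = -1" using least ranks by metis
  next
    fix F assume "F \<in> faces coset_poset" "\<forall>H\<in>faces coset_poset. face_le coset_poset H F"
    then show "face_rank coset_poset F = int n" using greatest ranks by metis
  qed (use card diamond coset_poset_order coset_poset_connected[OF ip] in auto)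
qed

text \<open>
  The flags of the identity and of \<open>g\<close> share their vertex and their facet, hence a path of flags with the
  same vertex and facet joins them. By the diamond condition each step of the path is one of the
  generators in between. The stabilizer being trivial, the endpoint of the path determines \<open>g\<close>.
\<close>

theorem polytope_imp_vertex_facet_intersection:
  assumes poly: "abstract_polytope n coset_poset"
    and stab: "\<And>x. x \<in> G UNIV \<Longrightarrow> (\<And>j. j < n \<Longrightarrow> x \<in> G (- {j})) \<Longrightarrow> x = \<one>"
    and g: "g \<in> G (- {0})" "g \<in> G (- {n - 1})"
  shows "g \<in> G (- {0, n - 1})"
proof -
  have gG: "g \<in> G UNIV" using g(1) by (rule G_into_UNIV)
  have eq: "x = y" if "x \<in> G UNIV" "y \<in> G UNIV" "flag_of x = flag_of y" for x y
  proof -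
    have "y \<otimes> inv x \<in> G (- {j})" if "j < n" for j
    proof -
      have "agree (int j) x y"
        using \<open>flag_of x = flag_of y\<close> flag_of_eq_iff[OF \<open>x \<in> G UNIV\<close> \<open>y \<in> G UNIV\<close>] by blast
      then show ?thesis using that by (simp add: agree_def same_def)
    qed
    then have "y \<otimes> inv x = \<one>"
      by (rule stab[OF G_mult[OF \<open>y \<in> G UNIV\<close> G_inv[OF \<open>x \<in> G UNIV\<close>]]])
    moreover have "(y \<otimes> inv x) \<otimes> x = y" using that by (simp add: m_assoc)
    ultimately show ?thesis using that by simp
  qed
  have diamond: "card {H \<in> faces coset_poset. face_rank coset_poset H = j \<and>
      face_less coset_poset E H \<and> face_less coset_poset H F} = 2"
    if "E \<in> faces coset_poset" "F \<in> faces coset_poset" "face_less coset_poset E F"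
      "face_rank coset_poset E = j - 1" "face_rank coset_poset F = j + 1" for j E F
    using poly that unfolding abstract_polytope_def by blast
  let ?\<Phi> = "flag_of \<one>" and ?\<Psi> = "flag_of g"
  let ?R = "{(X, Y). X \<in> flags coset_poset \<and> Y \<in> flags coset_poset \<and>
                     ?\<Phi> \<inter> ?\<Psi> \<subseteq> X \<and> ?\<Phi> \<inter> ?\<Psi> \<subseteq> Y \<and> differ_in_one_face X Y}"
  have common: "face (int k) \<one> \<in> ?\<Phi> \<inter> ?\<Psi>" if "k \<in> {0, n - 1}" for k
  proof -
    have "same k \<one> g" using that g G_carrier[OF gG] by (auto simp: same_def)
    then have "face (int k) \<one> = face (int k) g"
      using that rank_ge gG by (subst face_eq_iff) (auto simp: agree_def)
    moreover have "face (int k) x \<in> flag_of x" for x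
      using that rank_ge unfolding flag_of_def by (intro imageI) auto
    ultimately show ?thesis by (metis IntI)
  qed
  have "(?\<Phi>, ?\<Psi>) \<in> ?R\<^sup>*"
    using poly gG unfolding abstract_polytope_def strongly_flag_connected_def flags_coset_poset by auto
  then have "\<exists>w\<in>G (- {0, n - 1}). ?\<Psi> = flag_of w"
  proof (induction rule: rtrancl_induct)
    case base
    then show ?case by auto
  next
    case (step X Y)
    then obtain w where w: "w \<in> G (- {0, n - 1})" "X = flag_of w" by blast
    have wG: "w \<in> G UNIV" using w(1) by (rule G_into_UNIV)
    obtain z where z: "z \<in> G UNIV" "Y = flag_of z" using step(2) by (auto simp: flags_coset_poset)
    obtain E F where EF: "X - Y = {E}" "Y - X = {F}" using step(2) by (auto simp: differ_in_one_face_def)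
    have "E \<in> flag_of w" using EF(1) w by blast
    then obtain k where k: "E = face k w" "-1 \<le> k" "k \<le> int n" by (auto simp: flag_of_def)
    have agree_off: "agree l w z" if "l \<noteq> k" "-1 \<le> l" "l \<le> int n" for l
    proof -
      have "face l w \<noteq> E" using that k wG by (simp add: face_eq_iff)
      moreover have "face l w \<in> X" using that w by (auto simp: flag_of_def)
      ultimately have "face l w \<in> Y" using EF(1) by blast
      then show ?thesis using that z wG by (auto simp: flag_of_def face_eq_iff)
    qed
    have nagree: "\<not> agree k w z"
    proof
      assume "agree k w z"
      then have "E = face k z" using k wG z by (simp add: face_eq_iff)
      then have "E \<in> Y" using z k by (auto simp: flag_of_def)
      then show False using EF(1) by blast
    qed
    then have k0: "0 \<le> k" "k < int n" by (auto simp: agree_def)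
    define j where "j = nat k"
    have j: "j < n" "int j = k" using k0 by (auto simp: j_def)
    have "j \<notin> {0, n - 1}"
    proof
      assume "j \<in> {0, n - 1}"
      then have "face k \<one> \<in> X" "face k \<one> \<in> Y" using common[of j] step(2) j by auto
      then have "agree k \<one> w" "agree k \<one> z"
        using w z wG k by (simp_all add: face_mem_flag_iff)
      then show False using nagree agree_trans[OF agree_sym[of k \<one> w]] wG z by simp
    qed
    have aw: "\<alpha> j \<otimes> w \<in> G (- {0, n - 1})" using \<open>j \<notin> {0, n - 1}\<close> j w by (intro G_mult G_gen) auto
    have awG: "\<alpha> j \<otimes> w \<in> G UNIV" using wG j by simp
    let ?S = "{H \<in> faces coset_poset. face_rank coset_poset H = k \<and>
      face_less coset_poset (face (k - 1) w) H \<and> face_less coset_poset H (face (k + 1) w)}"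
    have card: "card ?S = 2"
      using wG k0 by (intro diamond) (auto simp: face_less_def face_eq_iff)
    have mem: "face k v \<in> ?S" if "v \<in> G UNIV" "agree (k - 1) w v" "agree (k + 1) w v" for v
    proof -
      have "face (k - 1) w = face (k - 1) v" "face (k + 1) w = face (k + 1) v"
        using that wG k0 by (auto simp: face_eq_iff)
      then have "face_le coset_poset (face (k - 1) w) (face k v)"
        "face_le coset_poset (face k v) (face (k + 1) w)"
        using that wG k0 by simp_all
      then show ?thesis using that wG k0 by (simp add: face_less_def face_eq_iff)
    qed
    have "face k w \<in> ?S" "face k (\<alpha> j \<otimes> w) \<in> ?S" "face k z \<in> ?S"
      using mem[OF wG] mem[OF awG] mem[OF z(1)] agree_off k0 wG j agree_gen_iff[OF j(1) wG] by auto
    moreover have "face k w \<noteq> face k (\<alpha> j \<otimes> w)" "face k w \<noteq> face k z"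
      using nagree agree_gen_iff[OF j(1) wG, of k] j wG awG z k by (auto simp: face_eq_iff)
    moreover obtain p q where "?S = {p, q}" using card unfolding card_2_iff by blast
    ultimately have "face k (\<alpha> j \<otimes> w) = face k z" by (metis insertE singletonD)
    then have "agree k (\<alpha> j \<otimes> w) z" using awG z k by (simp add: face_eq_iff)
    moreover have "agree l (\<alpha> j \<otimes> w) z" if "l \<noteq> k" for l
    proof (cases "0 \<le> l \<and> l < int n")
      case True
      have "agree l (\<alpha> j \<otimes> w) w" using that j agree_gen_iff[OF j(1) wG, of l] agree_sym wG awG by simp
      then show ?thesis using agree_off[of l] that True agree_trans wG awG z by auto
    qed (auto simp: agree_def)
    ultimately have "Y = flag_of (\<alpha> j \<otimes> w)" using z awG flag_of_eq_iff by metis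
    then show ?case using aw by blast
  qed
  then obtain w where w: "w \<in> G (- {0, n - 1})" "?\<Psi> = flag_of w" by blast
  have "g = w" using eq[OF gG G_into_UNIV[OF w(1)] w(2)] .
  then show ?thesis using w by simp
qed

end

section \<open>Face lattices presented by simplicial complexes\<close>

text \<open>
  The simplices in \<open>K\<close> present the faces of \<open>P\<close> other than one improper face, which is presented by the set
  \<open>V\<close> of all vertices. For the simplex and the cross-polytope \<open>K\<close> is the boundary complex. For the cube
  the vertices of \<open>K\<close> are its facets, a simplex is the set of facets that contain a face, and the
  order is reversed, which \<open>dual\<close> indicates.
\<close>

locale simplicial_model =
  fixes P :: "'f ranked_poset" and n :: nat and V :: "'v set" and K :: "'v set set"
    and h :: "'v set \<Rightarrow> 'f" and dual :: bool
  assumes finV: "finite V" and n_pos: "0 < n"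
    and K_sub: "A \<in> K \<Longrightarrow> A \<subseteq> V"
    and K_down: "A \<in> K \<Longrightarrow> B \<subseteq> A \<Longrightarrow> B \<in> K"
    and V_notin: "V \<notin> K"
    and K_single: "v \<in> V \<Longrightarrow> {v} \<in> K"
    and K_nonempty: "K \<noteq> {}"
    and K_pure: "A \<in> K \<Longrightarrow> \<exists>M\<in>K. A \<subseteq> M \<and> card M = n"
    and h_bij: "bij_betw h (insert V K) (faces P)"
    and h_le: "A \<in> insert V K \<Longrightarrow> B \<in> insert V K \<Longrightarrow>
      face_le P (h A) (h B) \<longleftrightarrow> (if dual then B \<subseteq> A else A \<subseteq> B)"
    and ranked: "ranked_partial_order n P"
begin

definition X :: "'v set set" where "X = insert V K"

definition chain_of :: "(nat \<Rightarrow> 'v) \<Rightarrow> 'v set set" where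
  "chain_of b = insert V ((\<lambda>j. b ` {..<j}) ` {..n})"

definition Sym :: "('v \<Rightarrow> 'v) set" where
  "Sym = {g. g permutes V \<and> (\<forall>A\<in>K. g ` A \<in> K)}"

lemma X_sub: "A \<in> X \<Longrightarrow> A \<subseteq> V"
  using K_sub by (auto simp: X_def)

lemma X_fin: "A \<in> X \<Longrightarrow> finite A"
  using X_sub finV finite_subset by blast

lemma V_in_X: "V \<in> X" and K_in_X: "A \<in> K \<Longrightarrow> A \<in> X"
  by (auto simp: X_def)

lemma empty_in_K: "{} \<in> K"
  using K_nonempty K_down by blast

lemma K_card_le: "A \<in> K \<Longrightarrow> card A \<le> n"
  using K_pure card_mono K_in_X X_fin by metis

lemma h_inj: "A \<in> X \<Longrightarrow> B \<in> X \<Longrightarrow> h A = h B \<longleftrightarrow> A = B"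
  using h_bij unfolding X_def bij_betw_def inj_on_def by blast

lemma h_in [simp]: "A \<in> X \<Longrightarrow> h A \<in> faces P"
  using h_bij unfolding X_def bij_betw_def by blast

lemma face_obtain:
  assumes "F \<in> faces P" obtains A where "A \<in> X" "F = h A"
  using assms h_bij unfolding X_def bij_betw_def by blast

lemma h_le_X: "A \<in> X \<Longrightarrow> B \<in> X \<Longrightarrow> face_le P (h A) (h B) \<longleftrightarrow> (if dual then B \<subseteq> A else A \<subseteq> B)"
  using h_le unfolding X_def by blast

text \<open>
  The rank as seen by the complex: it grows with the simplex also when \<open>h\<close> reverses the order.
\<close>

definition rk :: "'v set \<Rightarrow> int" where
  "rk A = (if dual then int n - 1 - face_rank P (h A) else face_rank P (h A))"

lemma rk_range: "A \<in> X \<Longrightarrow> -1 \<le> rk A \<and> rk A \<le> int n"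
  using ranked h_in[of A] unfolding ranked_partial_order_def rk_def by fastforce

lemma rk_less:
  assumes "A \<in> X" "B \<in> X" "A \<subset> B" shows "rk A < rk B"
proof -
  have *: "face_less P F H \<Longrightarrow> face_rank P F < face_rank P H" if "F \<in> faces P" "H \<in> faces P" for F H
    using ranked that unfolding ranked_partial_order_def by blast
  have "h A \<noteq> h B" using assms h_inj by blast
  then show ?thesis
    using *[of "h A" "h B"] *[of "h B" "h A"] assms h_le_X by (auto simp: face_less_def rk_def)
qed

text \<open>
  A chain of the \<open>n + 2\<close> possible sizes leaves no freedom to ranks that increase strictly within
  \<open>n + 2\<close> values.
\<close>

lemma rk_eq: "A \<in> K \<Longrightarrow> rk A = int (card A) - 1"
proof -
  assume A: "A \<in> K"
  have lower: "int (card B) - 1 \<le> rk B" if "B \<in> K" for B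
  proof -
    have "finite B" using that K_in_X X_fin by blast
    then show ?thesis using that
    proof (induction B rule: finite_induct)
      case empty
      then show ?case using rk_range K_in_X by fastforce
    next
      case (insert b B)
      then have "B \<in> K" using K_down by blast
      then have "rk B < rk (insert b B)" using insert by (intro rk_less K_in_X) auto
      then show ?case using insert \<open>B \<in> K\<close> by simp
    qed
  qed
  obtain M where M: "M \<in> K" "A \<subseteq> M" "card M = n" using K_pure A by blast
  have finM: "finite M" using M K_in_X X_fin by blast
  have upper: "rk B \<le> int n - 1 - int m" if "B \<subseteq> M" "card (M - B) = m" for B m
    using that
  proof (induction m arbitrary: B)
    case 0
    then have "B = M" using finM by auto
    moreover have "rk M < rk V" using M K_sub V_notin by (intro rk_less K_in_X V_in_X) auto
    ultimately show ?case using rk_range[OF V_in_X] by simp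
  next
    case (Suc m)
    then obtain b where b: "b \<in> M - B" by (metis card.empty ex_in_conv nat.distinct(1))
    have "M - insert b B = (M - B) - {b}" by auto
    then have "card (M - insert b B) = m" using Suc b finM by simp
    then have "rk (insert b B) \<le> int n - 1 - int m" using Suc b by auto
    moreover have "rk B < rk (insert b B)"
      using Suc b M K_down by (intro rk_less K_in_X) auto
    ultimately show ?case by simp
  qed
  have "rk A \<le> int n - 1 - int (card (M - A))" using upper[OF M(2) refl] .
  also have "card (M - A) = n - card A" using M finM by (simp add: card_Diff_subset finite_subset)
  finally show ?thesis using lower[OF A] K_card_le[OF A] by simp
qed

lemma rk_V: "rk V = int n"
proof -
  obtain M where M: "M \<in> K" "card M = n" using K_pure empty_in_K by blast
  have "rk M < rk V" using M K_sub V_notin by (intro rk_less K_in_X V_in_X) auto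
  then show ?thesis using rk_eq M rk_range[OF V_in_X] by simp
qed

lemma chain_of_sub:
  assumes "b ` {..<n} \<in> K"
  shows "chain_of b \<subseteq> X"
proof -
  have "b ` {..<j} \<in> X" if "j \<le> n" for j
    by (rule K_in_X, rule K_down[OF assms], rule image_mono) (use that in auto)
  then show ?thesis using V_in_X by (auto simp: chain_of_def)
qed

lemma pred_chain_iff:
  assumes "C \<subseteq> X"
  shows "pred_on.chain (faces P) (face_le P) (h ` C) \<longleftrightarrow> (\<forall>A\<in>C. \<forall>B\<in>C. A \<subseteq> B \<or> B \<subseteq> A)"
proof -
  have e: "(face_le P)\<^sup>=\<^sup>= (h A) (h B) \<or> (face_le P)\<^sup>=\<^sup>= (h B) (h A) \<longleftrightarrow> A \<subseteq> B \<or> B \<subseteq> A"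
    if "A \<in> C" "B \<in> C" for A B
  proof -
    have AB: "A \<in> X" "B \<in> X" using that assms by auto
    show ?thesis using h_le_X[OF AB] h_le_X[OF AB(2,1)] h_inj[OF AB] by (cases dual) auto
  qed
  have "h ` C \<subseteq> faces P" using assms h_in by blast
  then show ?thesis unfolding pred_on.chain_def by (simp only: ball_simps e simp_thms cong: ball_cong)
qed

lemma flags_subset:
  assumes "\<Phi> \<in> flags P"
  obtains C where "C \<subseteq> X" "\<Phi> = h ` C" "\<And>A B. A \<in> C \<Longrightarrow> B \<in> C \<Longrightarrow> A \<subseteq> B \<or> B \<subseteq> A"
    "\<And>A. A \<in> X \<Longrightarrow> (\<And>B. B \<in> C \<Longrightarrow> A \<subseteq> B \<or> B \<subseteq> A) \<Longrightarrow> A \<in> C"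
proof -
  have \<Phi>: "pred_on.chain (faces P) (face_le P) \<Phi>"
      "\<And>S. pred_on.chain (faces P) (face_le P) S \<Longrightarrow> \<not> \<Phi> \<subset> S"
    using assms by (auto simp: flags_def pred_on.maxchain_def)
  define C where "C = {A \<in> X. h A \<in> \<Phi>}"
  have C: "C \<subseteq> X" "\<Phi> = h ` C"
    using \<Phi>(1) face_obtain unfolding pred_on.chain_def C_def by auto
  then have cmp: "\<And>A B. A \<in> C \<Longrightarrow> B \<in> C \<Longrightarrow> A \<subseteq> B \<or> B \<subseteq> A" using \<Phi>(1) pred_chain_iff by blast
  have "A \<in> C" if A: "A \<in> X" "\<And>B. B \<in> C \<Longrightarrow> A \<subseteq> B \<or> B \<subseteq> A" for A
  proof -
    have "insert A C \<subseteq> X" using A C by simp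
    then have "pred_on.chain (faces P) (face_le P) (h ` insert A C)"
      using A(2) cmp by (subst pred_chain_iff) auto
    then have "h A \<in> \<Phi>" using \<Phi>(2)[of "h ` insert A C"] C by blast
    then show ?thesis using A by (simp add: C_def)
  qed
  then show thesis using that C cmp by blast
qed

text \<open>
  A maximal chain has a member of each size, since between the members next below and next above a
  missing size some simplex would extend the chain. The vertices that are added one by one give the
  enumeration.
\<close>

lemma flag_enumeration:
  assumes "\<Phi> \<in> flags P"
  obtains b where "inj_on b {..<n}" "b ` {..<n} \<in> K" "\<Phi> = h ` chain_of b"
proof -
  obtain C where C: "C \<subseteq> X" "\<Phi> = h ` C" and cmp: "\<And>A B. A \<in> C \<Longrightarrow> B \<in> C \<Longrightarrow> A \<subseteq> B \<or> B \<subseteq> A"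
    and max: "\<And>A. A \<in> X \<Longrightarrow> (\<And>B. B \<in> C \<Longrightarrow> A \<subseteq> B \<or> B \<subseteq> A) \<Longrightarrow> A \<in> C"
    using flags_subset[OF assms] by metis
  have VC: "V \<in> C" using max[OF V_in_X] C X_sub by blast
  have finC: "finite C" using C(1) X_sub finV by (meson PowI finite_Pow_iff finite_subset subsetI subset_iff)
  have mono: "A \<subseteq> B" if "A \<in> C" "B \<in> C" "card A \<le> card B" for A B
    using cmp[OF that(1,2)] that C X_fin by (metis card_seteq subset_iff subset_refl)
  have ex: "\<exists>A\<in>C \<inter> K. card A = j" if "j \<le> n" for j
    using that
  proof (induction j)
    case 0
    have "{} \<in> C" using max[of "{}"] empty_in_K K_in_X by auto
    then show ?case using empty_in_K by (intro bexI[of _ "{}"]) auto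
  next
    case (Suc j)
    then obtain A where A: "A \<in> C" "A \<in> K" "card A = j" by auto
    show ?case
    proof (rule ccontr)
      assume none: "\<not> ?case"
      define D where "D = {B \<in> C \<inter> K. Suc j < card B}"
      obtain B where B: "B \<in> K" "A \<subset> B" "\<And>E. E \<in> C \<Longrightarrow> E \<in> K \<Longrightarrow> Suc j < card E \<Longrightarrow> B \<subseteq> E"
      proof (cases "D = {}")
        case True
        obtain M where M: "M \<in> K" "A \<subseteq> M" "card M = n" using K_pure A by blast
        then have "A \<noteq> M" using A Suc(2) by auto
        then show ?thesis using that[of M] M True by (auto simp: D_def)
      next
        case False
        have "finite D" using finC by (simp add: D_def)
        then obtain B where "B \<in> D" "\<And>E. E \<in> D \<Longrightarrow> card B \<le> card E"
          using False arg_min_if_finite(1)[of D card] arg_min_least[of D _ card] by blast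
        then have "B \<in> C" "B \<in> K" "Suc j < card B"
          "\<And>E. E \<in> C \<Longrightarrow> E \<in> K \<Longrightarrow> Suc j < card E \<Longrightarrow> B \<subseteq> E"
          using mono by (auto simp: D_def)
        moreover have "A \<subset> B" using mono[of A B] A calculation by auto
        ultimately show ?thesis using that[of B] by blast
      qed
      obtain x where x: "x \<in> B" "x \<notin> A" using B by blast
      have AxK: "insert x A \<in> K" using B x K_down[of B "insert x A"] by auto
      have card: "card (insert x A) = Suc j" using A x X_fin[OF K_in_X] by simp
      have "insert x A \<in> C"
      proof (rule max)
        show "insert x A \<in> X" using AxK K_in_X by blast
        fix E assume E: "E \<in> C"
        show "insert x A \<subseteq> E \<or> E \<subseteq> insert x A"
        proof (cases "E = V")
          case True
          then show ?thesis using AxK K_sub by blast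
        next
          case False
          then have EK: "E \<in> K" using E C by (auto simp: X_def)
          then have "card E \<noteq> Suc j" using none E by blast
          then consider "card E \<le> j" | "Suc j < card E" by linarith
          then show ?thesis
          proof cases
            case 1
            then show ?thesis using mono[OF E A(1)] A by auto
          next
            case 2
            then have "B \<subseteq> E" "A \<subseteq> E" using B(3)[OF E EK] mono[OF A(1) E] A by auto
            then show ?thesis using x by auto
          qed
        qed
      qed
      then show False using none AxK card by blast
    qed
  qed
  define A where "A = (\<lambda>j. SOME A. A \<in> C \<and> A \<in> K \<and> card A = j)"
  have A: "A j \<in> C" "A j \<in> K" "card (A j) = j" if "j \<le> n" for j
    using someI_ex[of "\<lambda>B. B \<in> C \<and> B \<in> K \<and> card B = j"] ex[OF that] unfolding A_def by auto
  have A0: "A 0 = {}" using A[of 0] X_fin[OF K_in_X] by auto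
  have "\<exists>x. A (Suc j) = insert x (A j) \<and> x \<notin> A j" if "j < n" for j
  proof -
    have sub: "A j \<subseteq> A (Suc j)" using mono A that by simp
    have "card (A (Suc j) - A j) = 1" using A that sub X_fin[OF K_in_X]
      by (subst card_Diff_subset) (auto simp: less_imp_le)
    then obtain x where "A (Suc j) - A j = {x}" using card_1_singletonE by blast
    then show ?thesis using sub by (intro exI[of _ x]) auto
  qed
  then obtain b where b: "\<And>j. j < n \<Longrightarrow> A (Suc j) = insert (b j) (A j) \<and> b j \<notin> A j" by metis
  have Ab: "A j = b ` {..<j}" if "j \<le> n" for j
    using that
  proof (induction j)
    case (Suc j)
    then show ?case using b[of j] by (auto simp: lessThan_Suc)
  qed (simp add: A0)
  have inj: "inj_on b {..<n}"
  proof (rule inj_onI, rule ccontr)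
    fix i j assume ij: "i \<in> {..<n}" "j \<in> {..<n}" "b i = b j" "i \<noteq> j"
    have "b l \<noteq> b m" if "l < m" "m < n" for l m
    proof -
      have "b l \<in> A m" using Ab[of m] that by simp
      then show ?thesis using b[of m] that by metis
    qed
    then show False using ij by (metis lessThan_iff nat_neq_iff)
  qed
  have "C = chain_of b"
  proof
    show "chain_of b \<subseteq> C" using VC A Ab by (auto simp: chain_of_def)
    show "C \<subseteq> chain_of b"
    proof
      fix E assume E: "E \<in> C"
      show "E \<in> chain_of b"
      proof (cases "E = V")
        case True
        then show ?thesis by (simp add: chain_of_def)
      next
        case False
        then have "E \<in> K" using E C by (auto simp: X_def)
        then have le: "card E \<le> n" by (rule K_card_le)
        have "E = A (card E)" using mono[of E "A (card E)"] mono[of "A (card E)" E] E A[OF le] by auto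
        then show ?thesis using Ab[OF le] le by (auto simp: chain_of_def)
      qed
    qed
  qed
  then show thesis using that inj C Ab[of n] A[of n] by auto
qed

lemma chain_of_flag:
  assumes inj: "inj_on b {..<n}" and b: "b ` {..<n} \<in> K"
  shows "h ` chain_of b \<in> flags P"
proof -
  note sub = chain_of_sub[OF b]
  have "A \<subseteq> B \<or> B \<subseteq> A" if AB: "A \<in> chain_of b" "B \<in> chain_of b" for A B
  proof -
    have *: "b ` {..<i} \<subseteq> b ` {..<j} \<or> b ` {..<j} \<subseteq> b ` {..<i}" for i j
      using linorder_linear[of i j] by (auto intro!: image_mono)
    have AV: "A \<subseteq> V" "B \<subseteq> V" using AB sub X_sub by blast+
    consider "A = V" | "B = V" | i j where "A = b ` {..<i}" "B = b ` {..<j}"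
      using AB by (auto simp: chain_of_def)
    then show ?thesis
    proof cases
      case 3
      then show ?thesis using *[of i j] by simp
    qed (use AV in simp_all)
  qed
  then have ch: "pred_on.chain (faces P) (face_le P) (h ` chain_of b)"
    using pred_chain_iff[OF sub] by blast
  have "S = h ` chain_of b" if S: "pred_on.chain (faces P) (face_le P) S" "h ` chain_of b \<subseteq> S" for S
  proof -
    have "F \<in> h ` chain_of b" if F: "F \<in> S" for F
    proof -
      have "F \<in> faces P" using F S(1) by (auto simp: pred_on.chain_def)
      then obtain A where A: "A \<in> X" "F = h A" using face_obtain by blast
      have cmp: "A \<subseteq> B \<or> B \<subseteq> A" if "B \<in> chain_of b" for B
      proof -
        have B: "B \<in> X" using that sub by blast
        have "pred_on.chain (faces P) (face_le P) (h ` {A, B})"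
          using S F A that unfolding pred_on.chain_def by auto
        then show ?thesis using pred_chain_iff[of "{A, B}"] A B by auto
      qed
      show ?thesis
      proof (cases "A = V")
        case True
        then show ?thesis using A by (auto simp: chain_of_def)
      next
        case False
        then have AK: "A \<in> K" using A by (auto simp: X_def)
        define j where "j = card A"
        have j: "j \<le> n" using AK K_card_le by (simp add: j_def)
        have "card (b ` {..<j}) = j" using inj j by (subst card_image) (auto intro: inj_on_subset)
        moreover have "b ` {..<j} \<in> chain_of b" using j by (auto simp: chain_of_def)
        ultimately have "A = b ` {..<j}"
          using cmp[of "b ` {..<j}"] X_fin[OF A(1)] by (metis card_subset_eq finite_imageI finite_lessThan j_def)
        then show ?thesis using A j by (auto simp: chain_of_def)
      qed
    qed
    then show ?thesis using S by blast
  qed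
  then show ?thesis using ch unfolding flags_def pred_on.maxchain_def by blast
qed

end

section \<open>Automorphisms as permutations of vertices\<close>

lemma aut_carrier_iff:
  "\<phi> \<in> carrier (aut_group P) \<longleftrightarrow> \<phi> \<in> Bij (faces P) \<and>
     (\<forall>F\<in>faces P. \<forall>H\<in>faces P. face_le P (\<phi> F) (\<phi> H) \<longleftrightarrow> face_le P F H)"
  by (simp add: aut_group_def)

lemma aut_mult_apply:
  assumes "\<phi> \<in> carrier (aut_group P)" "\<psi> \<in> carrier (aut_group P)" "F \<in> faces P"
  shows "(\<phi> \<otimes>\<^bsub>aut_group P\<^esub> \<psi>) F = \<phi> (\<psi> F)"
  using assms by (simp add: aut_group_def BijGroup_def compose_def)

lemma aut_apply_in: "\<phi> \<in> carrier (aut_group P) \<Longrightarrow> F \<in> faces P \<Longrightarrow> \<phi> F \<in> faces P"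
  using Bij_imp_funcset by (fastforce simp: aut_carrier_iff)

lemma group_aut_group: "group (aut_group P)"
proof -
  let ?A = "{\<phi> \<in> Bij (faces P). \<forall>F\<in>faces P. \<forall>H\<in>faces P. face_le P (\<phi> F) (\<phi> H) \<longleftrightarrow> face_le P F H}"
  interpret B: group "BijGroup (faces P)" by (rule group_BijGroup)
  have "subgroup ?A (BijGroup (faces P))"
  proof (rule B.subgroupI)
    show "?A \<subseteq> carrier (BijGroup (faces P))" by (auto simp: BijGroup_def)
    have "(\<lambda>F\<in>faces P. F) \<in> ?A" using id_Bij by auto
    then show "?A \<noteq> {}" by blast
  next
    fix \<phi> assume \<phi>: "\<phi> \<in> ?A"
    then have bij: "bij_betw \<phi> (faces P) (faces P)" by (simp add: Bij_def)
    have inv: "inv_into (faces P) \<phi> F \<in> faces P" "\<phi> (inv_into (faces P) \<phi> F) = F" if "F \<in> faces P" for F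
      using that bij by (auto simp: bij_betw_def inv_into_into f_inv_into_f)
    have le: "face_le P (\<phi> F) (\<phi> H) \<longleftrightarrow> face_le P F H" if "F \<in> faces P" "H \<in> faces P" for F H
      using that \<phi> by blast
    have "face_le P (inv_into (faces P) \<phi> F) (inv_into (faces P) \<phi> H) \<longleftrightarrow> face_le P F H"
      if "F \<in> faces P" "H \<in> faces P" for F H
      using le[OF inv(1) inv(1), of F H] inv(2) that by simp
    then show "inv\<^bsub>BijGroup (faces P)\<^esub> \<phi> \<in> ?A"
      using \<phi> restrict_inv_into_Bij by (auto simp: inv_BijGroup)
  next
    fix \<phi> \<psi> assume "\<phi> \<in> ?A" "\<psi> \<in> ?A"
    then show "\<phi> \<otimes>\<^bsub>BijGroup (faces P)\<^esub> \<psi> \<in> ?A"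
      using Bij_imp_funcset[of \<psi> "faces P"] compose_Bij[of \<phi> "faces P" \<psi>]
      by (auto simp: BijGroup_def compose_def Pi_iff)
  qed
  then show ?thesis unfolding aut_group_def by (rule B.subgroup_imp_group)
qed

context simplicial_model
begin

definition act :: "('f \<Rightarrow> 'f) \<Rightarrow> 'v set \<Rightarrow> 'v set" where
  "act \<phi> A = inv_into X h (\<phi> (h A))"

definition perm :: "('f \<Rightarrow> 'f) \<Rightarrow> 'v \<Rightarrow> 'v" where
  "perm \<phi> v = (if v \<in> V then the_elem (act \<phi> {v}) else v)"

abbreviation Aut :: "('f \<Rightarrow> 'f) monoid" where "Aut \<equiv> aut_group P"

lemma h_img: "h ` X = faces P"
  using h_bij unfolding X_def bij_betw_def by blast

lemma act_in: "\<phi> \<in> carrier Aut \<Longrightarrow> A \<in> X \<Longrightarrow> act \<phi> A \<in> X"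
  and h_act: "\<phi> \<in> carrier Aut \<Longrightarrow> A \<in> X \<Longrightarrow> h (act \<phi> A) = \<phi> (h A)"
proof -
  assume "\<phi> \<in> carrier Aut" "A \<in> X"
  then have "\<phi> (h A) \<in> h ` X" using aut_apply_in h_in h_img by metis
  then show "act \<phi> A \<in> X" "h (act \<phi> A) = \<phi> (h A)"
    unfolding act_def by (auto intro: inv_into_into f_inv_into_f)
qed

lemma act_le:
  assumes "\<phi> \<in> carrier Aut" "A \<in> X" "B \<in> X"
  shows "act \<phi> A \<subseteq> act \<phi> B \<longleftrightarrow> A \<subseteq> B"
proof -
  have "face_le P (h C) (h D) \<longleftrightarrow> face_le P (\<phi> (h C)) (\<phi> (h D))" if "C \<in> X" "D \<in> X" for C D
    using assms(1) that h_in by (simp add: aut_carrier_iff)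
  then have "face_le P (h C) (h D) \<longleftrightarrow> face_le P (h (act \<phi> C)) (h (act \<phi> D))" if "C \<in> X" "D \<in> X" for C D
    using that h_act[OF assms(1)] by simp
  from this[of A B] this[of B A] show ?thesis
    using assms act_in h_le_X by (cases dual) auto
qed

lemma act_bij:
  assumes "\<phi> \<in> carrier Aut" shows "bij_betw (act \<phi>) X X"
proof -
  have "inj_on (act \<phi>) X"
  proof (rule inj_onI)
    fix A B assume "A \<in> X" "B \<in> X" "act \<phi> A = act \<phi> B"
    then show "A = B" using act_le[OF assms, of A B] act_le[OF assms, of B A] by blast
  qed
  moreover have "act \<phi> ` X \<subseteq> X" using act_in[OF assms] by blast
  moreover have "finite X" using X_sub finV by (meson PowI finite_Pow_iff finite_subset subsetI)
  ultimately show ?thesis by (simp add: bij_betw_def endo_inj_surj)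
qed

lemma act_V: assumes "\<phi> \<in> carrier Aut" shows "act \<phi> V = V"
proof -
  obtain A where A: "A \<in> X" "act \<phi> A = V"
    using act_bij[OF assms] V_in_X unfolding bij_betw_def by (metis imageE)
  then have "V \<subseteq> act \<phi> V" using act_le[OF assms A(1) V_in_X] X_sub by simp
  then show ?thesis using act_in[OF assms V_in_X] X_sub by blast
qed

lemma act_K: assumes "\<phi> \<in> carrier Aut" "A \<in> K" shows "act \<phi> A \<in> K"
proof -
  have "A \<noteq> V" using V_notin assms(2) by blast
  then have "\<not> V \<subseteq> A" using K_sub[OF assms(2)] by blast
  then have "\<not> act \<phi> V \<subseteq> act \<phi> A" using act_le[OF assms(1) V_in_X K_in_X[OF assms(2)]] by simp
  then have "act \<phi> A \<noteq> V" using act_V[OF assms(1)] by blast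
  then show ?thesis using act_in[OF assms(1) K_in_X[OF assms(2)]] by (auto simp: X_def)
qed

text \<open>
  An order automorphism preserves the size of a simplex, because a simplex has one face for each
  of its subsets.
\<close>

lemma act_card: assumes \<phi>: "\<phi> \<in> carrier Aut" and A: "A \<in> K" shows "card (act \<phi> A) = card A"
proof -
  have X: "B \<in> X" if "B \<subseteq> A" for B using that A K_down K_in_X by blast
  have "act \<phi> ` Pow A = Pow (act \<phi> A)"
  proof
    show "act \<phi> ` Pow A \<subseteq> Pow (act \<phi> A)" using act_le[OF \<phi>] X by auto
    show "Pow (act \<phi> A) \<subseteq> act \<phi> ` Pow A"
    proof
      fix B assume B: "B \<in> Pow (act \<phi> A)"
      then have "B \<in> X" using K_down[OF act_K[OF \<phi> A]] K_in_X by blast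
      then obtain C where C: "C \<in> X" "B = act \<phi> C" using act_bij[OF \<phi>] by (auto simp: bij_betw_def)
      then show "B \<in> act \<phi> ` Pow A" using B act_le[OF \<phi> C(1) X[of A]] by auto
    qed
  qed
  moreover have "inj_on (act \<phi>) (Pow A)"
    using act_bij[OF \<phi>] X by (auto simp: bij_betw_def intro: inj_on_subset)
  ultimately have "card (Pow (act \<phi> A)) = card (Pow A)" by (metis card_image)
  then show ?thesis
    using X_fin[OF K_in_X[OF A]] X_fin[OF K_in_X[OF act_K[OF \<phi> A]]] by (simp add: card_Pow)
qed

lemma act_single:
  assumes \<phi>: "\<phi> \<in> carrier Aut" and v: "v \<in> V"
  shows "act \<phi> {v} = {perm \<phi> v}"
proof -
  have "card (act \<phi> {v}) = 1" using act_card[OF \<phi> K_single[OF v]] by simp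
  then obtain w where "act \<phi> {v} = {w}" using card_1_singletonE by blast
  then show ?thesis using v by (simp add: perm_def)
qed

lemma perm_in: "\<phi> \<in> carrier Aut \<Longrightarrow> v \<in> V \<Longrightarrow> perm \<phi> v \<in> V"
  using act_single[of \<phi> v] K_sub[OF act_K[OF _ K_single[of v]]] by auto

text \<open>
  An automorphism permutes the simplices with one vertex, and these determine all the others.
\<close>

lemma act_eq_image:
  assumes \<phi>: "\<phi> \<in> carrier Aut" and A: "A \<in> X"
  shows "act \<phi> A = perm \<phi> ` A"
proof
  have sub: "perm \<phi> v \<in> act \<phi> A \<longleftrightarrow> v \<in> A" if "v \<in> V" for v
    using act_le[OF \<phi> K_in_X[OF K_single[OF that]] A] act_single[OF \<phi> that] by simp
  show "perm \<phi> ` A \<subseteq> act \<phi> A" using sub X_sub[OF A] by blast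
  show "act \<phi> A \<subseteq> perm \<phi> ` A"
  proof
    fix w assume w: "w \<in> act \<phi> A"
    then have "w \<in> V" using act_in[OF \<phi> A] X_sub by blast
    then have wK: "{w} \<in> K" by (rule K_single)
    then obtain B where B: "B \<in> X" "act \<phi> B = {w}"
      using act_bij[OF \<phi>] K_in_X unfolding bij_betw_def by (metis imageE)
    have "B \<in> K" using B act_V[OF \<phi>] wK V_notin by (auto simp: X_def)
    then have "card B = 1" using act_card[OF \<phi>] B by fastforce
    then obtain v where v: "B = {v}" using card_1_singletonE by blast
    then have "v \<in> V" using B X_sub by blast
    then have "w = perm \<phi> v" using act_single[OF \<phi>] B v by blast
    then show "w \<in> perm \<phi> ` A" using sub[OF \<open>v \<in> V\<close>] w by blast
  qed
qed

lemma h_perm: "\<phi> \<in> carrier Aut \<Longrightarrow> A \<in> X \<Longrightarrow> \<phi> (h A) = h (perm \<phi> ` A)"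
  using h_act act_eq_image by metis

lemma perm_Sym: assumes \<phi>: "\<phi> \<in> carrier Aut" shows "perm \<phi> \<in> Sym"
proof -
  have "perm \<phi> ` V = V" using act_eq_image[OF \<phi> V_in_X] act_V[OF \<phi>] by simp
  then have "bij_betw (perm \<phi>) V V" using finV by (simp add: bij_betw_def eq_card_imp_inj_on)
  then have "perm \<phi> permutes V" by (rule bij_imp_permutes) (simp add: perm_def)
  moreover have "perm \<phi> ` A \<in> K" if "A \<in> K" for A
    using act_K[OF \<phi> that] act_eq_image[OF \<phi> K_in_X[OF that]] by simp
  ultimately show ?thesis by (simp add: Sym_def)
qed

lemma perm_mult:
  assumes \<phi>: "\<phi> \<in> carrier Aut" and \<psi>: "\<psi> \<in> carrier Aut"
  shows "perm (\<phi> \<otimes>\<^bsub>Aut\<^esub> \<psi>) = perm \<phi> \<circ> perm \<psi>"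
proof
  fix v
  have c: "\<phi> \<otimes>\<^bsub>Aut\<^esub> \<psi> \<in> carrier Aut"
    using monoid.m_closed[OF group.is_monoid[OF group_aut_group]] \<phi> \<psi> .
  show "perm (\<phi> \<otimes>\<^bsub>Aut\<^esub> \<psi>) v = (perm \<phi> \<circ> perm \<psi>) v"
  proof (cases "v \<in> V")
    case True
    then have X: "{v} \<in> X" "{perm \<psi> v} \<in> X" using K_single perm_in[OF \<psi>] K_in_X by auto
    have "h {perm (\<phi> \<otimes>\<^bsub>Aut\<^esub> \<psi>) v} = \<phi> (\<psi> (h {v}))"
      using h_perm[OF c X(1)] aut_mult_apply[OF \<phi> \<psi> h_in[OF X(1)]] by simp
    also have "\<dots> = h {perm \<phi> (perm \<psi> v)}"
      using h_perm[OF \<psi> X(1)] h_perm[OF \<phi> X(2)] by simp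
    finally have "{perm (\<phi> \<otimes>\<^bsub>Aut\<^esub> \<psi>) v} = {perm \<phi> (perm \<psi> v)}"
      by (subst (asm) h_inj) (use True perm_in[OF c] perm_in[OF \<phi>] perm_in[OF \<psi>] K_single K_in_X in auto)
    then show ?thesis by simp
  qed (simp add: perm_def)
qed

lemma perm_inj: "inj_on perm (carrier Aut)"
proof (rule inj_onI)
  fix \<phi> \<psi> assume \<phi>: "\<phi> \<in> carrier Aut" and \<psi>: "\<psi> \<in> carrier Aut" and eq: "perm \<phi> = perm \<psi>"
  have "\<phi> F = \<psi> F" if "F \<in> faces P" for F
    using that face_obtain h_perm[OF \<phi>] h_perm[OF \<psi>] eq by metis
  then show "\<phi> = \<psi>"
    using \<phi> \<psi> by (meson Bij_imp_extensional aut_carrier_iff extensionalityI)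
qed

lemma Sym_image_X: "g \<in> Sym \<Longrightarrow> A \<in> X \<Longrightarrow> g ` A \<in> X"
  by (cases "A = V") (auto simp: Sym_def X_def permutes_image)

lemma Sym_subset: "g \<in> Sym \<Longrightarrow> g ` A \<subseteq> g ` B \<longleftrightarrow> A \<subseteq> B"
  using inj_image_subset_iff[OF permutes_inj[of g V]] by (simp add: Sym_def)

lemma Sym_image_bij: assumes "g \<in> Sym" shows "bij_betw ((`) g) X X"
proof -
  have "inj_on ((`) g) X"
  proof (rule inj_onI)
    fix A B assume "g ` A = g ` B"
    then show "A = B" using Sym_subset[OF assms, of A B] Sym_subset[OF assms, of B A] by simp
  qed
  moreover have "finite X" using X_sub finV by (meson PowI finite_Pow_iff finite_subset subsetI)
  ultimately show ?thesis using Sym_image_X[OF assms] by (simp add: bij_betw_def endo_inj_surj image_subset_iff)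
qed

lemma perm_surj:
  assumes g: "g \<in> Sym"
  obtains \<phi> where "\<phi> \<in> carrier Aut" "perm \<phi> = g"
proof -
  define \<phi> where "\<phi> = (\<lambda>F\<in>faces P. h (g ` inv_into X h F))"
  have \<phi>h: "\<phi> (h A) = h (g ` A)" if "A \<in> X" for A
    using that h_bij unfolding \<phi>_def X_def by (simp add: bij_betw_def h_in[unfolded X_def])
  have "bij_betw (h \<circ> (`) g \<circ> inv_into X h) (faces P) (faces P)"
    using bij_betw_trans[OF bij_betw_trans[OF bij_betw_inv_into[of h X "faces P"] Sym_image_bij[OF g]]]
      h_bij by (fold X_def) (auto simp: comp_assoc)
  then have "bij_betw \<phi> (faces P) (faces P)"
    by (rule bij_betw_cong[THEN iffD1, rotated]) (simp add: \<phi>_def)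
  then have "\<phi> \<in> Bij (faces P)" by (simp add: Bij_def \<phi>_def)
  moreover have "face_le P (\<phi> F) (\<phi> H) \<longleftrightarrow> face_le P F H" if FH: "F \<in> faces P" "H \<in> faces P" for F H
  proof -
    obtain A B where AB: "A \<in> X" "F = h A" "B \<in> X" "H = h B" using FH face_obtain by metis
    show ?thesis
      unfolding AB(2,4) \<phi>h[OF AB(1)] \<phi>h[OF AB(3)]
      using AB Sym_subset[OF g] h_le_X Sym_image_X[OF g] by simp
  qed
  ultimately have c: "\<phi> \<in> carrier Aut" by (simp add: aut_carrier_iff)
  have "perm \<phi> v = g v" for v
  proof (cases "v \<in> V")
    case True
    then have "h {perm \<phi> v} = h {g v}"
      using h_perm[OF c, of "{v}"] \<phi>h[of "{v}"] K_single K_in_X by simp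
    moreover have "g v \<in> V" using True g by (auto simp: Sym_def permutes_in_image)
    ultimately show ?thesis using h_inj perm_in[OF c True] K_single K_in_X by blast
  next
    case False
    then show ?thesis using g by (auto simp: Sym_def perm_def permutes_def)
  qed
  then show thesis using that c by blast
qed

lemma Sym_comp: "f \<in> Sym \<Longrightarrow> g \<in> Sym \<Longrightarrow> f \<circ> g \<in> Sym"
  unfolding Sym_def using permutes_compose[of g V f] by (auto simp: image_image[symmetric])

lemma Sym_inv: assumes "g \<in> Sym" shows "inv_into UNIV g \<in> Sym"
proof -
  obtain \<phi> where \<phi>: "\<phi> \<in> carrier Aut" "perm \<phi> = g" using perm_surj[OF assms] .
  interpret A: group Aut by (rule group_aut_group)
  let ?i = "inv\<^bsub>Aut\<^esub> \<phi>"
  have one: "perm \<one>\<^bsub>Aut\<^esub> permutes V" using perm_Sym by (simp add: Sym_def)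
  have "perm \<one>\<^bsub>Aut\<^esub> (perm \<one>\<^bsub>Aut\<^esub> v) = perm \<one>\<^bsub>Aut\<^esub> v" for v
    using fun_cong[OF perm_mult[of "\<one>\<^bsub>Aut\<^esub>" "\<one>\<^bsub>Aut\<^esub>"]] by simp
  then have "perm \<one>\<^bsub>Aut\<^esub> = id"
    using permutes_inj[OF one] by (auto simp: inj_def)
  then have "g \<circ> perm ?i = id" using perm_mult[of \<phi> ?i] \<phi> by simp
  then have "g (perm ?i v) = v" for v by (metis comp_apply id_apply)
  then have "inv_into UNIV g v = perm ?i v" for v
    using assms by (metis (no_types, lifting) Sym_def mem_Collect_eq permutes_inverses(2))
  then have "perm ?i = inv_into UNIV g" by auto
  then show ?thesis using perm_Sym[of ?i] \<phi> by simp
qed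

lemma relabel:
  assumes g: "g \<in> Sym"
  shows "simplicial_model P n V K (h \<circ> (`) g) dual"
proof
  show "bij_betw (h \<circ> (`) g) (insert V K) (faces P)"
    using bij_betw_trans[OF Sym_image_bij[OF g]] h_bij unfolding X_def by blast
  show "face_le P ((h \<circ> (`) g) A) ((h \<circ> (`) g) B) = (if dual then B \<subseteq> A else A \<subseteq> B)"
    if "A \<in> insert V K" "B \<in> insert V K" for A B
    using that h_le_X[OF Sym_image_X[OF g] Sym_image_X[OF g], of A B] Sym_subset[OF g]
    unfolding X_def by simp
qed (use finV n_pos K_sub K_down V_notin K_single K_nonempty K_pure ranked in auto)

lemma image_chain_of:
  assumes "g \<in> Sym" shows "(`) g ` chain_of b = chain_of (g \<circ> b)"
  using assms by (auto simp: chain_of_def Sym_def permutes_image image_image image_comp)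

text \<open>
  The hypotheses on \<open>s\<close> say that it moves only the member of size \<open>k\<close> of the base chain; \<open>uniq\<close> is the diamond
  condition at that member. An automorphism \<open>\<psi>\<close> with an adjacent image of the flag thus agrees with \<open>s\<close> on the
  whole chain, and \<open>rigid\<close> identifies the two.
\<close>

theorem reflection:
  assumes inj: "inj_on b {..<n}" and bK: "b ` {..<n} \<in> K" and \<Phi>: "\<Phi> = h ` chain_of b"
    and k: "1 \<le> k" "k \<le> n" and s: "s \<in> Sym"
    and fix_s: "\<And>j. j \<le> n \<Longrightarrow> j \<noteq> k \<Longrightarrow> s ` b ` {..<j} = b ` {..<j}"
    and move: "s ` b ` {..<k} \<noteq> b ` {..<k}"
    and uniq: "\<And>A. A \<in> K \<Longrightarrow> card A = k \<Longrightarrow> b ` {..<k - 1} \<subseteq> A \<Longrightarrow> (k < n \<Longrightarrow> A \<subseteq> b ` {..<Suc k}) \<Longrightarrow>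
      A = b ` {..<k} \<or> A = s ` b ` {..<k}"
    and rigid: "\<And>g. g \<in> Sym \<Longrightarrow> (\<And>j. j \<le> n \<Longrightarrow> g ` b ` {..<j} = b ` {..<j}) \<Longrightarrow> g = id"
    and i: "i = (if dual then n - k else k - 1)"
  shows "reflection_gen P \<Phi> i \<in> carrier Aut \<and> perm (reflection_gen P \<Phi> i) = s"
proof -
  define B where "B j = b ` {..<j}" for j
  have BK: "B j \<in> K" if "j \<le> n" for j
    unfolding B_def by (rule K_down[OF bK], rule image_mono) (use that in auto)
  have cardB: "card (B j) = j" if "j \<le> n" for j
    unfolding B_def using inj that by (subst card_image) (auto intro: inj_on_subset)
  have BX: "B j \<in> X" if "j \<le> n" for j using BK[OF that] K_in_X by blast
  have chain: "chain_of b = insert V (B ` {..n})" by (simp add: chain_of_def B_def)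
  have rank_h: "face_rank P (h A) = int i \<longleftrightarrow> A \<in> K \<and> card A = k" if "A \<in> X" for A
  proof (cases "A = V")
    case True
    then have "face_rank P (h A) = (if dual then -1 else int n)"
      using rk_V by (auto simp: rk_def)
    then show ?thesis using True V_notin i k by auto
  next
    case False
    then have "A \<in> K" using that by (auto simp: X_def)
    then show ?thesis using rk_eq[of A] K_card_le[of A] i k by (auto simp: rk_def)
  qed
  have img: "\<phi> ` \<Phi> = h ` insert V ((\<lambda>j. g ` B j) ` {..n})"
    if "\<phi> \<in> carrier Aut" "perm \<phi> = g" for \<phi> g
  proof -
    have "g ` V = V" using perm_Sym[OF that(1)] that(2) by (auto simp: Sym_def permutes_image)
    have "\<phi> ` \<Phi> = h ` ((\<lambda>A. g ` A) ` chain_of b)"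
      unfolding \<Phi> image_image
      by (rule image_cong[OF refl]) (use h_perm[OF that(1)] that(2) chain_of_sub[OF bK] in auto)
    then show ?thesis unfolding chain by (simp add: image_image \<open>g ` V = V\<close>)
  qed
  have \<Phi>flag: "\<Phi> \<in> flags P" using chain_of_flag[OF inj bK] \<Phi> by simp
  obtain \<phi> where \<phi>: "\<phi> \<in> carrier Aut" "perm \<phi> = s" using perm_surj[OF s] .
  have adj: "flag_adjacent P i \<Phi> (\<phi> ` \<Phi>)"
  proof -
    have "s permutes V" using s by (simp add: Sym_def)
    have "\<phi> ` \<Phi> = h ` chain_of (s \<circ> b)"
      using img[OF \<phi>] s unfolding chain_of_def B_def
      by (simp add: image_image image_comp)
    moreover have "inj_on (s \<circ> b) {..<n}"
      using inj \<open>s permutes V\<close> by (meson comp_inj_on inj_on_subset permutes_inj subset_UNIV)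
    moreover have "(s \<circ> b) ` {..<n} \<in> K" 
    proof -
      have "s ` b ` {..<n} \<in> K" using s bK by (simp only: Sym_def mem_Collect_eq)
      then show ?thesis by (simp add: image_image)
    qed
    ultimately have fl: "\<phi> ` \<Phi> \<in> flags P" using chain_of_flag by simp
    have sBX: "s ` B k \<in> K" using s BK[OF k(2)] by (auto simp: Sym_def)
    have cs: "card (s ` B k) = k"
      using cardB[OF k(2)] \<open>s permutes V\<close> by (metis card_image inj_on_subset permutes_inj subset_UNIV)
    have ne: "h (B j) \<noteq> h (s ` B k)" if "j \<le> n" for j
    proof (cases "j = k")
      case True
      then show ?thesis using h_inj[OF BX[OF k(2)] K_in_X[OF sBX]] move by (auto simp: B_def)
    next
      case False
      then have "B j \<noteq> s ` B k" using cs cardB[OF that] by metis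
      then show ?thesis using h_inj[OF BX[OF that] K_in_X[OF sBX]] by simp
    qed
    have neV: "h V \<noteq> h (B k)" "h V \<noteq> h (s ` B k)"
      using h_inj V_in_X K_in_X BK[OF k(2)] sBX V_notin by metis+
    have neB: "h (B j) \<noteq> h (B k)" if "j \<le> n" "j \<noteq> k" for j
      using h_inj[OF BX[OF that(1)] BX[OF k(2)]] cardB[OF that(1)] cardB[OF k(2)] that by metis
    define Q where "Q = h ` insert V (B ` ({..n} - {k}))"
    have split: "f ` {..n} = insert (f k) (f ` ({..n} - {k}))" for f :: "nat \<Rightarrow> 'v set"
      using k by auto
    have "\<Phi> = insert (h (B k)) Q"
      unfolding Q_def \<Phi> chain split[of B] by auto
    moreover have "\<phi> ` \<Phi> = insert (h (s ` B k)) Q"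
    proof -
      have "(\<lambda>j. s ` B j) ` ({..n} - {k}) = B ` ({..n} - {k})"
        by (rule image_cong[OF refl]) (use fix_s in \<open>auto simp: B_def\<close>)
      then show ?thesis unfolding Q_def img[OF \<phi>] split[of "\<lambda>j. s ` B j"] by auto
    qed
    moreover have "h (B k) \<notin> Q" using neV neB by (auto simp: Q_def) metis
    moreover have "h (s ` B k) \<notin> Q" using neV ne by (auto simp: Q_def) metis
    moreover have "h (B k) \<noteq> h (s ` B k)" using ne k by simp
    ultimately have "\<Phi> - \<phi> ` \<Phi> = {h (B k)}" "\<phi> ` \<Phi> - \<Phi> = {h (s ` B k)}" by auto
    moreover have "face_rank P (h (B k)) = int i" "face_rank P (h (s ` B k)) = int i"
      using rank_h BX[OF k(2)] BK[OF k(2)] cardB[OF k(2)] sBX cs K_in_X by auto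
    ultimately show ?thesis using \<Phi>flag fl unfolding flag_adjacent_def by blast
  qed
  have unique: "\<psi> = \<phi>" if \<psi>: "\<psi> \<in> carrier Aut" "flag_adjacent P i \<Phi> (\<psi> ` \<Phi>)" for \<psi>
  proof -
    define g where "g = perm \<psi>"
    have gS: "g \<in> Sym" using perm_Sym \<psi> by (simp add: g_def)
    then have gp: "g permutes V" by (simp add: Sym_def)
    have gBK: "g ` B j \<in> K" "card (g ` B j) = j" if "j \<le> n" for j
      using gS BK[OF that] cardB[OF that] gp
      by (auto simp: Sym_def) (metis card_image inj_on_subset permutes_inj subset_UNIV)
    obtain F H where FH: "\<Phi> - \<psi> ` \<Phi> = {F}" "\<psi> ` \<Phi> - \<Phi> = {H}" "face_rank P F = int i" "face_rank P H = int i"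
      using \<psi>(2) unfolding flag_adjacent_def by blast
    have mem: "j = l" if "h (B j) = h (g ` B l)" "j \<le> n" "l \<le> n" for j l
      using that h_inj[OF BX K_in_X[OF gBK(1)]] cardB gBK(2) by metis
    have memV: "h (B j) \<noteq> h V" if "j \<le> n" for j
      using h_inj[OF BX[OF that] V_in_X] BK[OF that] V_notin by metis
    have F: "F = h (B k)"
    proof -
      have "F \<in> h ` insert V (B ` {..n})" using FH(1) \<Phi> chain by auto
      then obtain A where A: "F = h A" "A \<in> insert V (B ` {..n})" by blast
      then have "A \<in> X" using V_in_X BX by auto
      then have "A \<in> K" "card A = k" using rank_h FH(3) A by auto
      then show ?thesis using A V_notin cardB by auto
    qed
    have gfix: "g ` B j = B j" if jn: "j \<le> n" "j \<noteq> k" for j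
    proof -
      have "h (B j) \<noteq> F" using F h_inj[OF BX[OF jn(1)] BX[OF k(2)]] cardB jn k by metis
      moreover have "h (B j) \<in> \<Phi>" using jn \<Phi> chain by auto
      ultimately have "h (B j) \<in> \<psi> ` \<Phi>" using FH(1) by blast
      then obtain l where l: "l \<le> n" "h (B j) = h (g ` B l)"
        unfolding img[OF \<psi>(1) g_def[symmetric]] using memV[OF jn(1)] by auto
      then show ?thesis using mem[OF l(2) jn(1) l(1)] h_inj[OF BX[OF jn(1)] K_in_X[OF gBK(1)[OF l(1)]]] by simp
    qed
    have gne: "g ` B k \<noteq> B k"
    proof
      assume "g ` B k = B k"
      then have "h (B k) \<in> \<psi> ` \<Phi>" unfolding img[OF \<psi>(1) g_def[symmetric]] using k by force
      then show False using F FH(1) by blast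
    qed
    have "g ` B k = s ` B k"
    proof -
      have "B (k - 1) \<subseteq> g ` B k"
        using gfix[of "k - 1"] k image_mono[of "B (k - 1)" "B k" g] image_mono[of "{..<k - 1}" "{..<k}" b]
        by (auto simp: B_def)
      moreover have "g ` B k \<subseteq> B (Suc k)" if "k < n"
        using gfix[of "Suc k"] that image_mono[of "B k" "B (Suc k)" g] image_mono[of "{..<k}" "{..<Suc k}" b]
        by (auto simp: B_def)
      ultimately show ?thesis
        using uniq[of "g ` B k"] gBK[OF k(2)] gne unfolding B_def by blast
    qed
    then have same: "g ` B j = s ` B j" if "j \<le> n" for j
      using that gfix fix_s by (cases "j = k") (auto simp: B_def)
    have sp: "s permutes V" using s by (simp add: Sym_def)
    have "inv_into UNIV s \<circ> g = id"
    proof (rule rigid)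
      show "inv_into UNIV s \<circ> g \<in> Sym" using Sym_comp Sym_inv s gS by blast
      show "(inv_into UNIV s \<circ> g) ` b ` {..<j} = b ` {..<j}" if "j \<le> n" for j
      proof -
        have "(inv_into UNIV s \<circ> g) ` B j = inv_into UNIV s ` g ` B j"
          by (rule image_comp[symmetric])
        also have "\<dots> = (inv_into UNIV s \<circ> s) ` B j"
          unfolding same[OF that] by (rule image_comp)
        also have "\<dots> = B j" unfolding permutes_inv_o(2)[OF sp] by simp
        finally show ?thesis by (simp add: B_def)
      qed
    qed
    then have "inv_into UNIV s (g v) = v" for v by (metis comp_apply id_apply)
    then have "g v = s v" for v by (metis permutes_inverses(1)[OF sp])
    then have "perm \<psi> = perm \<phi>" using \<phi>(2) by (auto simp: g_def)
    then show ?thesis using inj_onD[OF perm_inj _ \<psi>(1) \<phi>(1)] by blast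
  qed
  have "reflection_gen P \<Phi> i = \<phi>"
    unfolding reflection_gen_def
  proof (rule the_equality)
    show "\<phi> \<in> carrier Aut \<and> flag_adjacent P i \<Phi> (\<phi> ` \<Phi>)" using \<phi>(1) adj by simp
    show "\<psi> = \<phi>" if "\<psi> \<in> carrier Aut \<and> flag_adjacent P i \<Phi> (\<psi> ` \<Phi>)" for \<psi>
      using unique that by simp
  qed
  then show ?thesis using \<phi> by simp
qed

end

abbreviation adjacent_swap :: "nat \<Rightarrow> nat \<Rightarrow> nat" where
  "adjacent_swap i \<equiv> Transposition.transpose i (Suc i)"

section \<open>Reflections as permutations\<close>

definition sym_group :: "'v set \<Rightarrow> 'v set set \<Rightarrow> ('v \<Rightarrow> 'v) set" where
  "sym_group V K = {g. g permutes V \<and> (\<forall>A\<in>K. g ` A \<in> K)}"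

text \<open>
  The map \<open>\<eta>\<close> embeds the automorphism group of \<open>P\<close> in a group \<open>S\<close> of permutations and turns the reflections at
  the base flag \<open>\<Phi>\<close> into prescribed permutations \<open>t i\<close>.
\<close>

definition permutation_model ::
    "nat \<Rightarrow> 'f ranked_poset \<Rightarrow> 'f set \<Rightarrow> ('v \<Rightarrow> 'v) set \<Rightarrow> (nat \<Rightarrow> 'v \<Rightarrow> 'v) \<Rightarrow> (('f \<Rightarrow> 'f) \<Rightarrow> 'v \<Rightarrow> 'v) \<Rightarrow> bool" where
  "permutation_model n P \<Phi> S t \<eta> \<longleftrightarrow>
     (\<forall>i<n. reflection_gen P \<Phi> i \<in> carrier (aut_group P) \<and> \<eta> (reflection_gen P \<Phi> i) = t i) \<and>
     (\<forall>x\<in>carrier (aut_group P). \<eta> x \<in> S) \<and>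
     (\<forall>x\<in>carrier (aut_group P). \<forall>y\<in>carrier (aut_group P). \<eta> (x \<otimes>\<^bsub>aut_group P\<^esub> y) = \<eta> x \<circ> \<eta> y) \<and>
     inj_on \<eta> (carrier (aut_group P))"

lemma (in simplicial_model) permutation_modelI:
  assumes "\<And>i. i < n \<Longrightarrow> reflection_gen P \<Phi> i \<in> carrier Aut \<and> perm (reflection_gen P \<Phi> i) = t i"
  shows "permutation_model n P \<Phi> (sym_group V K) t perm"
  using assms perm_Sym perm_mult perm_inj unfolding permutation_model_def Sym_def sym_group_def by simp

lemma fixes_points_of_fixes_prefixes:
  assumes "inj_on b {..<n}" "inj g" and fix_g: "\<And>j. j \<le> n \<Longrightarrow> g ` b ` {..<j} = b ` {..<j}" and i: "i < (n::nat)"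
  shows "g (b i) = b i"
proof -
  have "g (b i) \<in> g ` b ` {..<Suc i}" by simp
  then have "g (b i) \<in> b ` {..<Suc i}" using fix_g[of "Suc i"] i by simp
  moreover have "g (b i) \<notin> b ` {..<i}"
  proof
    assume "g (b i) \<in> b ` {..<i}"
    then have "g (b i) \<in> g ` b ` {..<i}" using fix_g[of i] i by simp
    then obtain j where j: "j < i" "g (b i) = g (b j)" by auto
    then have "b i = b j" using injD[OF assms(2)] by blast
    then have "i = j" using inj_onD[OF assms(1)] j(1) i by simp
    then show False using j(1) by simp
  qed
  ultimately show ?thesis by (auto simp: lessThan_Suc)
qed

lemma extension_by_one:
  assumes "finite A" "B \<subseteq> A" "card A = Suc (card B)"
  obtains x where "x \<notin> B" "A = insert x B"
proof -
  have "card (A - B) = 1" using assms by (simp add: card_Diff_subset finite_subset)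
  then obtain x where "A - B = {x}" using card_1_singletonE by blast
  then show thesis using that[of x] assms by auto
qed

lemma transpose_lessThan:
  assumes "j \<noteq> Suc i" shows "adjacent_swap i ` {..<j} = {..<j}"
proof (cases "j < Suc i")
  case True
  then have "adjacent_swap i x = x" if "x < j" for x using that by (simp add: Transposition.transpose_def)
  then show ?thesis by force
next
  case False
  then have "i \<in> {..<j}" "Suc i \<in> {..<j}" using assms by auto
  then have "adjacent_swap i permutes {..<j}" by (rule permutes_swap_id)
  then show ?thesis by (rule permutes_image)
qed

lemma transpose_lessThan_Suc: "adjacent_swap i ` {..<Suc i} = insert (Suc i) {..<i}"
proof -
  have "adjacent_swap i ` {..<i} = {..<i}" by (rule transpose_lessThan) simp
  then show ?thesis by (simp add: lessThan_Suc)
qed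

definition simplex_complex :: "nat \<Rightarrow> nat set set" where
  "simplex_complex n = {A. A \<subset> {..n}}"

lemma simplex_complex_pure:
  assumes "A \<in> simplex_complex n" shows "\<exists>M\<in>simplex_complex n. A \<subseteq> M \<and> card M = n"
proof -
  obtain x where x: "x \<le> n" "x \<notin> A" using assms by (auto simp: simplex_complex_def)
  then have "{..n} - {x} \<in> simplex_complex n" "A \<subseteq> {..n} - {x}" "card ({..n} - {x}) = n"
    using assms by (auto simp: simplex_complex_def)
  then show ?thesis by blast
qed

text \<open>
  Relabelling by the enumeration of the given flag makes it the standard chain of initial segments.
\<close>

lemma simplex_permutation_model:
  assumes model: "simplicial_model P n {..n} (simplex_complex n) h False" and \<Phi>: "\<Phi> \<in> flags P"
  shows "\<exists>\<eta>. permutation_model n P \<Phi> (sym_group {..n} (simplex_complex n)) adjacent_swap \<eta>"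
proof -
  interpret H: simplicial_model P n "{..n}" "simplex_complex n" h False by fact
  have SymI: "g \<in> H.Sym" if "g permutes {..n}" for g
  proof -
    have "g ` A \<in> simplex_complex n" if "A \<in> simplex_complex n" for A
    proof -
      have A: "A \<subseteq> {..n}" "A \<noteq> {..n}" using that by (auto simp: simplex_complex_def)
      have "g ` A \<subseteq> {..n}" using image_mono[OF A(1), of g] permutes_image[OF \<open>g permutes {..n}\<close>] by simp
      moreover have "g ` A \<noteq> g ` {..n}"
        using A(2) inj_image_eq_iff[OF permutes_inj[OF \<open>g permutes {..n}\<close>]] by simp
      ultimately show ?thesis
        using permutes_image[OF \<open>g permutes {..n}\<close>] by (simp add: simplex_complex_def psubset_eq)
    qed
    then show ?thesis using that by (simp add: H.Sym_def)
  qed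
  obtain b where b: "inj_on b {..<n}" "b ` {..<n} \<in> simplex_complex n" "\<Phi> = h ` H.chain_of b"
    using H.flag_enumeration[OF \<Phi>] .
  have "b ` {..<n} \<subseteq> {..n}" using b(2) by (auto simp: simplex_complex_def)
  moreover have "card {..n} = Suc (card (b ` {..<n}))" using card_image[OF b(1)] by simp
  ultimately obtain w where w: "w \<notin> b ` {..<n}" "{..n} = insert w (b ` {..<n})"
    using extension_by_one[of "{..n}"] by blast
  define g where "g x = (if x < n then b x else if x = n then w else x)" for x
  have "g ` {..n} = {..n}"
  proof -
    have "{..n} = insert n {..<n}" by auto
    then have "g ` {..n} = insert (g n) (g ` {..<n})" by (metis image_insert)
    also have "g ` {..<n} = b ` {..<n}" by (auto simp: g_def)
    finally show ?thesis using w by (simp add: g_def)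
  qed
  then have "bij_betw g {..n} {..n}" by (simp add: bij_betw_def eq_card_imp_inj_on)
  then have gp: "g permutes {..n}" by (rule bij_imp_permutes) (simp add: g_def)
  interpret R: simplicial_model P n "{..n}" "simplex_complex n" "h \<circ> (`) g" False
    by (rule H.relabel[OF SymI[OF gp]])
  have "(`) g ` R.chain_of id = H.chain_of (g \<circ> id)" by (rule H.image_chain_of[OF SymI[OF gp]])
  also have "\<dots> = H.chain_of b"
    unfolding H.chain_of_def by (auto simp: g_def intro!: image_cong arg_cong[of _ _ "insert _"])
  finally have \<Phi>': "\<Phi> = (h \<circ> (`) g) ` R.chain_of id" using b(3) by (metis image_comp)
  have refl: "reflection_gen P \<Phi> i \<in> carrier R.Aut \<and> R.perm (reflection_gen P \<Phi> i) = adjacent_swap i"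
    if i: "i < n" for i
  proof (rule R.reflection[where b = id and k = "Suc i"])
    show "id ` {..<n} \<in> simplex_complex n" by (auto simp: simplex_complex_def)
    show "adjacent_swap i \<in> R.Sym" by (rule SymI, rule permutes_swap_id) (use i in auto)
    show "adjacent_swap i ` id ` {..<j} = id ` {..<j}" if "j \<noteq> Suc i" for j
      using transpose_lessThan[OF that] by simp
    show "adjacent_swap i ` id ` {..<Suc i} \<noteq> id ` {..<Suc i}"
      using transpose_lessThan_Suc[of i] by auto
    show "A = id ` {..<Suc i} \<or> A = adjacent_swap i ` id ` {..<Suc i}"
      if A: "A \<in> simplex_complex n" "card A = Suc i" "id ` {..<Suc i - 1} \<subseteq> A"
        "Suc i < n \<Longrightarrow> A \<subseteq> id ` {..<Suc (Suc i)}" for A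
    proof -
      have "finite A" using A(1) by (auto simp: simplex_complex_def intro: finite_subset)
      then obtain x where x: "x \<notin> {..<i}" "A = insert x {..<i}"
        using extension_by_one[of A "{..<i}"] A by auto
      have "x \<le> Suc i" using A(1,4) x i by (cases "Suc i < n") (auto simp: simplex_complex_def)
      then have "x = i \<or> x = Suc i" using x by auto
      then show ?thesis using x transpose_lessThan_Suc[of i] by (auto simp: lessThan_Suc)
    qed
    show "g' = id" if g': "g' \<in> R.Sym" "\<And>j. j \<le> n \<Longrightarrow> g' ` id ` {..<j} = id ` {..<j}" for g'
    proof
      fix x
      have p: "g' permutes {..n}" using g'(1) by (simp add: R.Sym_def)
      have less: "g' y = y" if "y < n" for y
        using fixes_points_of_fixes_prefixes[of id n g' y] permutes_inj[OF p] g'(2) that by simp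
      have "g' n = n"
      proof (rule ccontr)
        assume "g' n \<noteq> n"
        moreover have "g' n \<le> n" using permutes_in_image[OF p, of n] by simp
        ultimately have "g' (g' n) = g' n" using less by simp
        then show False using \<open>g' n \<noteq> n\<close> injD[OF permutes_inj[OF p]] by blast
      qed
      then show "g' x = id x" using less p by (cases "x < n"; cases "x = n") (auto simp: permutes_def)
    qed
  qed (use i \<Phi>' in auto)
  show ?thesis by (rule exI[of _ R.perm], rule R.permutation_modelI, rule refl)
qed

definition cross_vertices :: "nat \<Rightarrow> (nat \<times> bool) set" where
  "cross_vertices n = {..<n} \<times> UNIV"

definition antipode :: "nat \<times> bool \<Rightarrow> nat \<times> bool" where
  "antipode = (\<lambda>(i, c). (i, \<not> c))"

definition cross_complex :: "nat \<Rightarrow> (nat \<times> bool) set set" where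
  "cross_complex n = {A. A \<subseteq> cross_vertices n \<and> (\<forall>a\<in>A. antipode a \<notin> A)}"

text \<open>
  The label \<open>(i, c)\<close> stands for the \<open>i\<close>-th coordinate vector with sign \<open>c\<close>, which is a vertex of the cross-polytope and
  the normal of a facet of the cube. The last reflection changes the
  sign of the last coordinate, the others exchange neighbouring coordinates.
\<close>

definition cross_reflection :: "nat \<Rightarrow> nat \<Rightarrow> nat \<times> bool \<Rightarrow> nat \<times> bool" where
  "cross_reflection n i = (if Suc i < n then map_prod (adjacent_swap i) id
     else (\<lambda>a. if fst a = i then antipode a else a))"

lemma antipode_simps [simp]: "antipode (i, c) = (i, \<not> c)" "antipode (antipode a) = a" "antipode a \<noteq> a"
    "fst (antipode a) = fst a" "antipode a = antipode b \<longleftrightarrow> a = b"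
  by (auto simp: antipode_def split: prod.splits)

lemma antipode_in [simp]: "antipode a \<in> cross_vertices n \<longleftrightarrow> a \<in> cross_vertices n"
  by (cases a) (auto simp: cross_vertices_def)

lemma cross_complex_pure:
  assumes A: "A \<in> cross_complex n" shows "\<exists>M\<in>cross_complex n. A \<subseteq> M \<and> card M = n"
proof -
  define M where "M = (\<lambda>i. (i, (i, False) \<notin> A)) ` {..<n}"
  have "card M = n" unfolding M_def by (subst card_image) (auto simp: inj_on_def)
  moreover have "M \<in> cross_complex n" by (auto simp: M_def cross_complex_def cross_vertices_def)
  moreover have "A \<subseteq> M"
  proof
    fix a assume a: "a \<in> A"
    obtain i c where ic: "a = (i, c)" by (cases a)
    have "c = ((i, False) \<notin> A)" using a ic A by (cases c) (auto simp: cross_complex_def)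
    moreover have "i < n" using a ic A by (auto simp: cross_complex_def cross_vertices_def)
    ultimately show "a \<in> M" using ic by (auto simp: M_def)
  qed
  ultimately show ?thesis by blast
qed

text \<open>
  Two distinct labels form a simplex unless they are antipodal, so that a symmetry of the complex is
  a permutation that preserves antipodal pairs.
\<close>

lemma cross_sym_iff:
  "g \<in> sym_group (cross_vertices n) (cross_complex n) \<longleftrightarrow>
    g permutes cross_vertices n \<and> (\<forall>a\<in>cross_vertices n. g (antipode a) = antipode (g a))"
proof
  assume g: "g \<in> sym_group (cross_vertices n) (cross_complex n)"
  then have p: "g permutes cross_vertices n" by (simp add: sym_group_def)
  have "g (antipode a) = antipode (g a)" if a: "a \<in> cross_vertices n" for a
  proof (rule ccontr)
    assume ne: "g (antipode a) \<noteq> antipode (g a)"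
    obtain b where b: "g b = antipode (g a)" using permutes_surj[OF p] by (metis surjD)
    have "g b \<in> cross_vertices n" using b a permutes_in_image[OF p] by simp
    then have bV: "b \<in> cross_vertices n" using permutes_in_image[OF p] by blast
    have "b \<noteq> antipode a" using ne b by auto
    moreover from this have "antipode b \<noteq> a" by auto
    ultimately have "{a, b} \<in> cross_complex n"
      using a bV by (auto simp: cross_complex_def)
    then have "g ` {a, b} \<in> cross_complex n" using g unfolding sym_group_def by blast
    then show False using b by (auto simp: cross_complex_def)
  qed
  then show "g permutes cross_vertices n \<and> (\<forall>a\<in>cross_vertices n. g (antipode a) = antipode (g a))"
    using p by blast
next
  assume g: "g permutes cross_vertices n \<and> (\<forall>a\<in>cross_vertices n. g (antipode a) = antipode (g a))"
  have "g ` A \<in> cross_complex n" if A: "A \<in> cross_complex n" for A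
  proof -
    have sub: "A \<subseteq> cross_vertices n" using A by (simp add: cross_complex_def)
    have "antipode (g a) \<notin> g ` A" if a: "a \<in> A" for a
    proof
      assume "antipode (g a) \<in> g ` A"
      then obtain b where "b \<in> A" "g (antipode a) = g b" using g a sub by auto
      then have "antipode a \<in> A" using g permutes_inj by (metis injD)
      then show False using A a by (auto simp: cross_complex_def)
    qed
    moreover have "g ` A \<subseteq> cross_vertices n" using sub g permutes_in_image by fastforce
    ultimately show ?thesis by (auto simp: cross_complex_def)
  qed
  then show "g \<in> sym_group (cross_vertices n) (cross_complex n)" using g by (simp add: sym_group_def)
qed

lemma cross_reflection_sym:
  assumes "i < n" shows "cross_reflection n i \<in> sym_group (cross_vertices n) (cross_complex n)"
proof -
  have inv: "cross_reflection n i (cross_reflection n i a) = a" for a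
    by (cases a) (auto simp: cross_reflection_def)
  have "cross_reflection n i permutes cross_vertices n"
    unfolding permutes_def
  proof (intro conjI allI impI)
    show "cross_reflection n i a = a" if "a \<notin> cross_vertices n" for a
      using that assms by (cases a) (auto simp: cross_reflection_def cross_vertices_def Transposition.transpose_def)
    show "\<exists>!a. cross_reflection n i a = c" for c
      using inv by metis
  qed
  moreover have "cross_reflection n i (antipode a) = antipode (cross_reflection n i a)" for a
    by (cases a) (auto simp: cross_reflection_def)
  ultimately show ?thesis by (simp add: cross_sym_iff)
qed

lemma cross_reflection_prefix:
  assumes "i < n" "j \<le> n" "j \<noteq> Suc i"
  shows "cross_reflection n i ` (\<lambda>i. (i, True)) ` {..<j} = (\<lambda>i. (i, True)) ` {..<j}"
proof (cases "Suc i < n")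
  case True
  have "cross_reflection n i ` (\<lambda>i. (i, True)) ` {..<j} = (\<lambda>i. (i, True)) ` adjacent_swap i ` {..<j}"
    using True by (simp add: cross_reflection_def image_image)
  then show ?thesis using transpose_lessThan[OF assms(3)] by simp
next
  case False
  then have "cross_reflection n i (k, True) = (k, True)" if "k < j" for k
    using that assms by (auto simp: cross_reflection_def)
  then show ?thesis by (force simp: image_image)
qed

lemma cross_reflection_prefix_Suc:
  assumes "i < n"
  shows "cross_reflection n i ` (\<lambda>i. (i, True)) ` {..<Suc i} =
    insert (if Suc i < n then (Suc i, True) else (i, False)) ((\<lambda>i. (i, True)) ` {..<i})"
proof -
  have "cross_reflection n i ` (\<lambda>i. (i, True)) ` {..<i} = (\<lambda>i. (i, True)) ` {..<i}"
    using assms by (intro cross_reflection_prefix) auto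
  moreover have "cross_reflection n i (i, True) = (if Suc i < n then (Suc i, True) else (i, False))"
    by (simp add: cross_reflection_def)
  ultimately show ?thesis by (simp add: lessThan_Suc)
qed

lemma cross_rigid:
  assumes g: "g \<in> sym_group (cross_vertices n) (cross_complex n)"
    and fix_g: "\<And>j. j \<le> n \<Longrightarrow> g ` (\<lambda>i. (i, True)) ` {..<j} = (\<lambda>i. (i, True)) ` {..<j}"
  shows "g = id"
proof
  fix a
  have S: "g permutes cross_vertices n" "\<And>a. a \<in> cross_vertices n \<Longrightarrow> g (antipode a) = antipode (g a)"
    using g cross_sym_iff[of g n] by auto
  have pos: "g (i, True) = (i, True)" if "i < n" for i
    using fixes_points_of_fixes_prefixes[of "\<lambda>i. (i, True)" n g i] permutes_inj[OF S(1)] fix_g that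
    by (simp add: inj_on_def)
  have "g (i, False) = (i, False)" if "i < n" for i
    using S(2)[of "(i, True)"] pos[OF that] that by (simp add: cross_vertices_def)
  then show "g a = id a"
    using pos S(1) by (cases a; cases "snd a"; cases "fst a < n") (auto simp: permutes_def cross_vertices_def)
qed

text \<open>
  In the dual case the chain is read from its other end, which reverses the numbering of the
  reflections.
\<close>

lemma cross_permutation_model:
  assumes model: "simplicial_model P n (cross_vertices n) (cross_complex n) h dual" and \<Phi>: "\<Phi> \<in> flags P"
  shows "\<exists>\<eta>. permutation_model n P \<Phi> (sym_group (cross_vertices n) (cross_complex n))
    (\<lambda>i. cross_reflection n (if dual then n - 1 - i else i)) \<eta>"
proof -
  let ?V = "cross_vertices n" and ?K = "cross_complex n"
  interpret H: simplicial_model P n ?V ?K h dual by fact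
  have Sym: "H.Sym = sym_group ?V ?K" by (simp add: H.Sym_def sym_group_def)
  obtain b where b: "inj_on b {..<n}" "b ` {..<n} \<in> ?K" "\<Phi> = h ` H.chain_of b"
    using H.flag_enumeration[OF \<Phi>] .
  define g where "g a = (if fst a < n then (if snd a then b (fst a) else antipode (b (fst a))) else a)" for a
  have bV: "b i \<in> ?V" if "i < n" for i using that b(2) by (auto simp: cross_complex_def)
  have bne: "b i \<noteq> antipode (b j)" if "i < n" "j < n" for i j
  proof -
    have "b i \<in> b ` {..<n}" "antipode (b j) \<notin> b ` {..<n}" using that b(2) by (auto simp: cross_complex_def)
    then show ?thesis by metis
  qed
  have "inj_on g ?V"
  proof (rule inj_onI)
    fix a c assume ac: "a \<in> ?V" "c \<in> ?V" "g a = g c"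
    then have "fst a < n" "fst c < n" by (auto simp: cross_vertices_def)
    then show "a = c"
      using ac(3) bne[of "fst a" "fst c"] bne[of "fst c" "fst a"] b(1)
      by (cases a; cases c) (auto simp: g_def inj_on_def split: if_splits)
  qed
  moreover have "g ` ?V \<subseteq> ?V"
  proof (rule image_subsetI)
    fix a assume "a \<in> ?V"
    then have "fst a < n" by (auto simp: cross_vertices_def)
    then show "g a \<in> ?V" using bV[of "fst a"] by (simp add: g_def)
  qed
  ultimately have "bij_betw g ?V ?V" using H.finV by (simp add: bij_betw_def endo_inj_surj)
  then have "g permutes ?V" by (rule bij_imp_permutes) (auto simp: g_def cross_vertices_def)
  moreover have "g (antipode a) = antipode (g a)" if "a \<in> ?V" for a
    using that by (cases a) (auto simp: g_def cross_vertices_def)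
  ultimately have gS: "g \<in> H.Sym" by (simp add: Sym cross_sym_iff)
  interpret R: simplicial_model P n ?V ?K "h \<circ> (`) g" dual
    by (rule H.relabel[OF gS])
  let ?b = "\<lambda>i::nat. (i, True)"
  have "(`) g ` R.chain_of ?b = H.chain_of (g \<circ> ?b)" by (rule H.image_chain_of[OF gS])
  also have "\<dots> = H.chain_of b"
    unfolding H.chain_of_def by (auto simp: g_def intro!: image_cong arg_cong[of _ _ "insert _"])
  finally have \<Phi>': "\<Phi> = (h \<circ> (`) g) ` R.chain_of ?b" using b(3) by (metis image_comp)
  have refl: "reflection_gen P \<Phi> i \<in> carrier R.Aut \<and> R.perm (reflection_gen P \<Phi> i) = cross_reflection n k"
    if k: "k < n" and i: "i = (if dual then n - Suc k else Suc k - 1)" for i k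
  proof (rule R.reflection[where b = ?b and k = "Suc k"])
    show "?b ` {..<n} \<in> ?K" by (auto simp: cross_complex_def cross_vertices_def)
    show "inj_on ?b {..<n}" by (auto simp: inj_on_def)
    show "cross_reflection n k \<in> R.Sym" using cross_reflection_sym[OF k] by (simp add: R.Sym_def sym_group_def)
    show "cross_reflection n k ` ?b ` {..<j} = ?b ` {..<j}" if "j \<le> n" "j \<noteq> Suc k" for j
      by (rule cross_reflection_prefix[OF k that])
    show "cross_reflection n k ` ?b ` {..<Suc k} \<noteq> ?b ` {..<Suc k}"
    proof -
      have "(if Suc k < n then (Suc k, True) else (k, False)) \<notin> ?b ` {..<Suc k}" by auto
      then show ?thesis unfolding cross_reflection_prefix_Suc[OF k] by blast
    qed
    show "A = ?b ` {..<Suc k} \<or> A = cross_reflection n k ` ?b ` {..<Suc k}"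
      if A: "A \<in> ?K" "card A = Suc k" "?b ` {..<Suc k - 1} \<subseteq> A"
        "Suc k < n \<Longrightarrow> A \<subseteq> ?b ` {..<Suc (Suc k)}" for A
    proof -
      have "finite A" using A(1) H.finV by (auto simp: cross_complex_def intro: finite_subset)
      moreover have "card (?b ` {..<k}) = k" by (subst card_image) (auto simp: inj_on_def)
      then have "card A = Suc (card (?b ` {..<k}))" using A(2) by simp
      moreover have "?b ` {..<k} \<subseteq> A" using A(3) by simp
      ultimately obtain x where x: "x \<notin> ?b ` {..<k}" "A = insert x (?b ` {..<k})"
        using extension_by_one by metis
      have "x = (k, True) \<or> x = (if Suc k < n then (Suc k, True) else (k, False))"
      proof (cases "Suc k < n")
        case True
        then show ?thesis using A(4) x by (auto simp: lessThan_Suc)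
      next
        case False
        then have n: "n = Suc k" using k by simp
        obtain l c where lc: "x = (l, c)" by (cases x)
        have l: "l \<le> k" using A(1) x lc n by (auto simp: cross_complex_def cross_vertices_def)
        have "l = k"
        proof (rule ccontr)
          assume "l \<noteq> k"
          then have lk: "(l, True) \<in> A" using l x by auto
          then have "\<not> c" using x lc \<open>l \<noteq> k\<close> l by auto
          then show False using A(1) x lc lk by (auto simp: cross_complex_def)
        qed
        then show ?thesis using lc n by auto
      qed
      then show ?thesis
        unfolding cross_reflection_prefix_Suc[OF k] using x by (auto simp: lessThan_Suc)
    qed
    show "g' = id" if "g' \<in> R.Sym" "\<And>j. j \<le> n \<Longrightarrow> g' ` ?b ` {..<j} = ?b ` {..<j}" for g'
    proof (rule cross_rigid)
      show "g' \<in> sym_group ?V ?K" using that(1) by (simp add: R.Sym_def sym_group_def)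
    qed (rule that(2))
  qed (use k i \<Phi>' in auto)
  have refl': "reflection_gen P \<Phi> i \<in> carrier R.Aut \<and>
      R.perm (reflection_gen P \<Phi> i) = cross_reflection n (if dual then n - 1 - i else i)" if "i < n" for i
    using that by (intro refl) auto
  show ?thesis by (rule exI[of _ R.perm], rule R.permutation_modelI, rule refl')
qed

lemma face_lattice_ranked:
  fixes S :: "(real ^ 'n) set"
  assumes "convex S"
  shows "ranked_partial_order CARD('n) (face_lattice S)"
proof -
  have "aff_dim F < aff_dim H" if "F face_of S" "H face_of S" "F \<subset> H" for F H :: "(real ^ 'n) set"
  proof (rule face_of_aff_dim_lt)
    show "convex H" using that(2) by (rule face_of_imp_convex)
    show "F face_of H" using face_of_subset[OF that(1)] that face_of_imp_subset by blast
  qed (use that in auto)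
  moreover have "-1 \<le> aff_dim F \<and> aff_dim F \<le> int CARD('n)" for F :: "(real ^ 'n) set"
    using aff_dim_geq[of F] aff_dim_le_DIM[of F] by simp
  moreover have "partial_order_on {F. F face_of S} {(F, H). F face_of S \<and> H face_of S \<and> F \<subseteq> H}"
    by (auto simp: partial_order_on_def preorder_on_def refl_on_def trans_def antisym_def)
  ultimately show ?thesis
    unfolding ranked_partial_order_def face_lattice_def face_less_def by (auto simp: psubset_eq)
qed

section \<open>Faces of the simplex\<close>

lemma affine_hull_Basis_subset: "affine hull (Basis :: 'a::euclidean_space set) \<subseteq> {x. One \<bullet> x = 1}"
  by (rule hull_minimal) (auto simp: affine_hyperplane)

text \<open>
  The coordinate vectors lie in the hyperplane on which the coordinates add up to 1; the additional
  vertex does not, because its coordinates add up to \<open>1 + sqrt (n + 1)\<close>.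
\<close>

lemma regular_simplex_vertices:
  obtains W :: "(real ^ 'n) set" where "regular_simplex = convex hull W" "\<not> affine_dependent W"
    "card W = Suc CARD('n)"
proof -
  define q :: "real ^ 'n" where "q = (\<chi> i. (1 + sqrt (real CARD('n) + 1)) / real CARD('n))"
  have basis: "range (\<lambda>i. axis i 1) = (Basis :: (real ^ 'n) set)" by (auto simp: Basis_vec_def)
  have "One \<bullet> q = (\<Sum>i\<in>UNIV. q $ i)"
  proof -
    have "One \<bullet> q = (\<Sum>b\<in>Basis. b \<bullet> q)" by (simp add: inner_sum_left)
    also have "\<dots> = (\<Sum>i\<in>UNIV. axis i 1 \<bullet> q)"
      unfolding basis[symmetric] by (subst sum.reindex) (auto simp: inj_on_def axis_eq_axis)
    finally show ?thesis by (simp add: inner_axis')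
  qed
  also have "\<dots> = 1 + sqrt (real CARD('n) + 1)" by (simp add: q_def)
  also have "\<dots> \<noteq> 1" by simp
  finally have "q \<notin> affine hull Basis" using affine_hull_Basis_subset by blast
  moreover have "\<not> affine_dependent (Basis :: (real ^ 'n) set)"
    using affine_dependent_imp_dependent independent_Basis by blast
  ultimately have "\<not> affine_dependent (insert q Basis)" by (simp add: affine_independent_insert)
  moreover have "card (insert q (Basis :: (real ^ 'n) set)) = Suc CARD('n)"
    using \<open>q \<notin> affine hull Basis\<close> hull_inc[of q Basis affine] by (subst card_insert_disjoint) auto
  moreover have "regular_simplex = convex hull (insert q Basis)"
    by (simp add: regular_simplex_def q_def basis)
  ultimately show thesis using that by blast
qed

lemma affine_independent_hull_subset:
  assumes "\<not> affine_dependent W" "C \<subseteq> W" "D \<subseteq> W"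
  shows "convex hull C \<subseteq> convex hull D \<longleftrightarrow> C \<subseteq> D"
proof
  assume hull: "convex hull C \<subseteq> convex hull D"
  show "C \<subseteq> D"
  proof (rule subsetI, rule ccontr)
    fix x assume x: "x \<in> C" "x \<notin> D"
    have "x \<in> convex hull D" using subsetD[OF hull hull_inc[OF x(1)]] .
    then have "x \<in> affine hull D" by (rule subsetD[OF convex_hull_subset_affine_hull])
    moreover have "affine hull D \<subseteq> affine hull (W - {x})" using assms x by (intro hull_mono) auto
    ultimately have "x \<in> affine hull (W - {x})" by blast
    moreover have "x \<in> W" using assms(2) x(1) by blast
    ultimately show False using assms(1) unfolding affine_dependent_def by blast
  qed
qed (rule hull_mono)

theorem simplex_model:
  assumes n: "n = CARD('n)"
  shows "\<exists>h. simplicial_model (simplex_T :: (real ^ 'n) set ranked_poset) n {..n} (simplex_complex n) h False"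
proof -
  obtain W :: "(real ^ 'n) set" where W: "regular_simplex = convex hull W" "\<not> affine_dependent W"
    "card W = Suc CARD('n)" by (rule regular_simplex_vertices)
  have "finite W" using W(3) card.infinite by fastforce
  then obtain v where "bij_betw v {0..<card W} W" using ex_bij_betw_nat_finite by blast
  moreover have "{0..<card W} = {..n}" using W(3) n by auto
  ultimately have v: "inj_on v {..n}" "v ` {..n} = W" by (auto simp: bij_betw_def)
  define h where "h A = convex hull (v ` A)" for A
  have X: "insert {..n} (simplex_complex n) = Pow {..n}" by (auto simp: simplex_complex_def)
  have le: "h A \<subseteq> h B \<longleftrightarrow> A \<subseteq> B" if "A \<subseteq> {..n}" "B \<subseteq> {..n}" for A B
  proof -
    have "h A \<subseteq> h B \<longleftrightarrow> v ` A \<subseteq> v ` B"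
      unfolding h_def by (rule affine_independent_hull_subset[OF W(2)]) (use that v in auto)
    also have "\<dots> \<longleftrightarrow> A \<subseteq> B" using v(1) that by (rule inj_on_image_subset_iff)
    finally show ?thesis .
  qed
  have "simplicial_model (simplex_T :: (real ^ 'n) set ranked_poset) n {..n} (simplex_complex n) h False"
  proof
    show "bij_betw h (insert {..n} (simplex_complex n)) (faces (simplex_T :: (real ^ 'n) set ranked_poset))"
      unfolding X bij_betw_def
    proof
      show "inj_on h (Pow {..n})" using le by (intro inj_onI) (metis PowD subset_antisym subset_refl)
      have "faces (simplex_T :: (real ^ 'n) set ranked_poset) = {F. \<exists>c\<subseteq>W. F = convex hull c}"
        unfolding simplex_T_def face_lattice_def W(1)
        by (simp add: face_of_convex_hull_affine_independent[OF W(2)])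
      also have "\<dots> = h ` Pow {..n}" unfolding h_def v(2)[symmetric]
        by (auto simp: subset_image_iff image_iff)
      finally show "h ` Pow {..n} = faces simplex_T" by simp
    qed
    show "face_le (simplex_T :: (real ^ 'n) set ranked_poset) (h A) (h B) = (if False then B \<subseteq> A else A \<subseteq> B)"
      if "A \<in> insert {..n} (simplex_complex n)" "B \<in> insert {..n} (simplex_complex n)" for A B
      using that le[of A B] unfolding X by (simp add: simplex_T_def face_lattice_def)
    show "ranked_partial_order n (simplex_T :: (real ^ 'n) set ranked_poset)"
      unfolding n simplex_T_def by (rule face_lattice_ranked) (simp add: regular_simplex_def)
    show "{v} \<in> simplex_complex n" if "v \<in> {..n}" for v
    proof -
      have "0 < n" using n by simp
      then have "\<exists>x\<le>n. x \<noteq> v" by (cases "v = 0") auto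
      then show ?thesis using that by (auto simp: simplex_complex_def)
    qed
    show "simplex_complex n \<noteq> {}" by (auto simp: simplex_complex_def intro!: exI[of _ "{}"])
  qed (use n simplex_complex_pure in \<open>auto simp: simplex_complex_def\<close>)
  then show ?thesis by blast
qed

section \<open>Faces of the cross-polytope and of the cube\<close>

locale signed_basis =
  fixes n :: nat and e :: "nat \<Rightarrow> 'n::finite"
  assumes n: "n = CARD('n)" and e: "bij_betw e {..<n} UNIV"
begin

definition vec_of :: "nat \<times> bool \<Rightarrow> real ^ 'n" where
  "vec_of a = axis (e (fst a)) (if snd a then 1 else -1)"

abbreviation "V \<equiv> cross_vertices n"
abbreviation "K \<equiv> cross_complex n"

text \<open>
  This vector exposes the face of the cross-polytope with vertex set \<open>A\<close>, and it lies on exactly those facets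
  of the cube that belong to \<open>A\<close>.
\<close>

definition centre :: "(nat \<times> bool) set \<Rightarrow> real ^ 'n" where
  "centre A = (\<Sum>a\<in>A. vec_of a)"

lemma n_pos: "0 < n" using n by simp

lemma finite_V: "finite V" by (simp add: cross_vertices_def)

lemma vec_antipode: "vec_of (antipode a) = - vec_of a"
  by (cases a) (auto simp: vec_of_def antipode_def vec_eq_iff axis_def)

lemma inner_vec_of:
  assumes "a \<in> V" "b \<in> V"
  shows "vec_of a \<bullet> vec_of b = (if a = b then 1 else if a = antipode b then -1 else 0)"
proof -
  have "e (fst a) = e (fst b) \<longleftrightarrow> fst a = fst b"
    using assms e by (auto simp: cross_vertices_def bij_betw_def inj_on_def)
  then show ?thesis
    by (cases a; cases b) (auto simp: vec_of_def inner_axis_axis antipode_def)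
qed

lemma inner_centre:
  assumes A: "A \<in> K" and b: "b \<in> V"
  shows "centre A \<bullet> vec_of b = (if b \<in> A then 1 else if antipode b \<in> A then -1 else 0)"
proof -
  have sub: "A \<subseteq> V" and fin: "finite A" using A finite_V by (auto simp: cross_complex_def intro: finite_subset)
  have eq: "centre A \<bullet> vec_of b = (\<Sum>a\<in>A. (if a = b then 1 else 0) + (if a = antipode b then -1 else 0))"
    unfolding centre_def inner_sum_left
  proof (rule sum.cong[OF refl])
    fix a assume "a \<in> A"
    then have "a \<in> V" using sub by blast
    moreover have "b \<noteq> antipode b" using antipode_simps(3)[of b] by metis
    ultimately show "vec_of a \<bullet> vec_of b = (if a = b then 1 else 0) + (if a = antipode b then -1 else 0)"
      using inner_vec_of[OF _ b, of a] by (simp del: split_paired_All)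
  qed
  have "b \<in> A \<Longrightarrow> antipode b \<notin> A" using A by (auto simp: cross_complex_def)
  then show ?thesis unfolding eq sum.distrib using fin by auto
qed

lemma vertices_eq: "{x. \<exists>i. x = axis i 1 \<or> x = axis i (-1)} = vec_of ` V" (is "?L = _")
proof
  show "?L \<subseteq> vec_of ` V"
  proof
    fix x :: "real ^ 'n" assume "x \<in> ?L"
    then obtain i where i: "x = axis i 1 \<or> x = axis i (-1)" by blast
    obtain j where j: "j < n" "e j = i" using e by (metis bij_betw_iff_bijections UNIV_I lessThan_iff)
    have "x = vec_of (j, True) \<or> x = vec_of (j, False)" using i j by (simp add: vec_of_def)
    then show "x \<in> vec_of ` V" using j by (auto simp: cross_vertices_def)
  qed
qed (auto simp: vec_of_def cross_vertices_def)

lemma cross_polytope_eq: "cross_polytope = convex hull (vec_of ` V)"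
  by (simp add: cross_polytope_def vertices_eq)

lemma complex_axioms:
  "A \<in> K \<Longrightarrow> A \<subseteq> V" "A \<in> K \<Longrightarrow> B \<subseteq> A \<Longrightarrow> B \<in> K" "V \<notin> K" "v \<in> V \<Longrightarrow> {v} \<in> K" "K \<noteq> {}"
proof -
  show "V \<notin> K"
  proof
    assume "V \<in> K"
    moreover have "(0, True) \<in> V" using n_pos by (simp add: cross_vertices_def)
    ultimately have "antipode (0, True) \<notin> V" by (auto simp: cross_complex_def)
    then show False using \<open>(0, True) \<in> V\<close> by (simp del: antipode_simps(1))
  qed
  have "{} \<in> K" by (simp add: cross_complex_def)
  then show "K \<noteq> {}" by blast
qed (auto simp: cross_complex_def)

lemma cross_face:
  assumes A: "A \<in> K"
  shows "convex hull (vec_of ` A) = cross_polytope \<inter> {x. centre A \<bullet> x = 1}"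
    and "convex hull (vec_of ` A) face_of cross_polytope"
proof -
  have sub: "A \<subseteq> V" using A complex_axioms by blast
  have "convex hull (vec_of ` V) \<subseteq> {x. centre A \<bullet> x \<le> 1}"
    by (rule hull_minimal) (auto simp: inner_centre[OF A] convex_halfspace_le)
  then have "cross_polytope \<inter> {x. centre A \<bullet> x = 1} face_of cross_polytope"
    unfolding cross_polytope_eq by (intro face_of_Int_supporting_hyperplane_le) auto
  moreover from this obtain S' where S': "S' \<subseteq> vec_of ` V"
      "cross_polytope \<inter> {x. centre A \<bullet> x = 1} = convex hull S'"
    using face_of_convex_hull_subset[of "vec_of ` V"] finite_V finite_imp_compact
    unfolding cross_polytope_eq by blast
  moreover have "S' \<subseteq> vec_of ` A"
  proof
    fix x assume x: "x \<in> S'"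
    then obtain a where a: "a \<in> V" "x = vec_of a" using S' by blast
    have "x \<in> convex hull S'" using x by (rule hull_inc)
    then have "centre A \<bullet> x = 1" using S'(2) by blast
    then show "x \<in> vec_of ` A" using a inner_centre[OF A] by (auto split: if_splits)
  qed
  moreover have "convex hull (vec_of ` A) \<subseteq> cross_polytope \<inter> {x. centre A \<bullet> x = 1}"
  proof (rule hull_minimal)
    show "vec_of ` A \<subseteq> cross_polytope \<inter> {x. centre A \<bullet> x = 1}"
    proof (rule image_subsetI)
      fix a assume a: "a \<in> A"
      then have "a \<in> V" using sub by blast
      then show "vec_of a \<in> cross_polytope \<inter> {x. centre A \<bullet> x = 1}"
        using inner_centre[OF A, of a] a by (simp add: cross_polytope_eq hull_inc)
    qed
    show "convex (cross_polytope \<inter> {x. centre A \<bullet> x = 1})"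
      by (simp add: cross_polytope_def convex_Int convex_hyperplane)
  qed
  ultimately show eq: "convex hull (vec_of ` A) = cross_polytope \<inter> {x. centre A \<bullet> x = 1}"
    using hull_mono[of S' "vec_of ` A" convex] by auto
  show "convex hull (vec_of ` A) face_of cross_polytope"
    unfolding eq by fact
qed

lemma cross_face_le:
  assumes "A \<in> insert V K" "B \<in> insert V K"
  shows "convex hull (vec_of ` A) \<subseteq> convex hull (vec_of ` B) \<longleftrightarrow> A \<subseteq> B"
proof
  assume sub: "convex hull (vec_of ` A) \<subseteq> convex hull (vec_of ` B)"
  have AV: "A \<subseteq> V" using assms complex_axioms by blast
  show "A \<subseteq> B"
  proof (cases "B = V")
    case False
    then have B: "B \<in> K" using assms by blast
    show ?thesis
    proof
      fix a assume a: "a \<in> A"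
      have "vec_of a \<in> convex hull (vec_of ` A)" using a by (intro hull_inc) blast
      then have "centre B \<bullet> vec_of a = 1" using sub cross_face(1)[OF B] by blast
      then show "a \<in> B" using inner_centre[OF B, of a] a AV by (auto split: if_splits)
    qed
  qed (use AV in simp)
qed (intro hull_mono image_mono)

text \<open>
  A face is spanned by its vertices. If two of them are antipodal, the face contains the origin,
  which lies between any two antipodal vertices, and is therefore everything.
\<close>

lemma cross_face_cases:
  assumes F: "F face_of cross_polytope"
  shows "\<exists>A\<in>insert V K. F = convex hull (vec_of ` A)"
proof -
  define A where "A = {a \<in> V. vec_of a \<in> F}"
  obtain S' where S': "S' \<subseteq> vec_of ` V" "F = convex hull S'"
    using face_of_convex_hull_subset[of "vec_of ` V" F] F finite_V finite_imp_compact
    unfolding cross_polytope_eq by blast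
  have "S' \<subseteq> vec_of ` A" using S' hull_subset[of S' convex] by (auto simp: A_def)
  then have "F \<subseteq> convex hull (vec_of ` A)" unfolding S'(2) by (rule hull_mono)
  moreover have "convex hull (vec_of ` A) \<subseteq> F"
    using face_of_imp_convex[OF F] by (intro hull_minimal) (auto simp: A_def)
  ultimately have eq: "F = convex hull (vec_of ` A)" by blast
  show ?thesis
  proof (cases "A \<in> K")
    case False
    then obtain a where a: "a \<in> A" "antipode a \<in> A" by (auto simp: A_def cross_complex_def)
    then have "(1/2) *\<^sub>R vec_of a + (1/2) *\<^sub>R vec_of (antipode a) \<in> F"
      using face_of_imp_convex[OF F] by (intro convexD) (auto simp: A_def)
    then have zero: "0 \<in> F" by (simp add: vec_antipode)
    have "b \<in> A" if b: "b \<in> V" for b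
    proof -
      have "vec_of b \<noteq> 0" using inner_vec_of[OF b b] by auto
      then have "0 \<in> open_segment (vec_of b) (vec_of (antipode b))"
        unfolding in_segment vec_antipode by (auto intro!: exI[of _ "1/2"] simp: eq_neg_iff_add_eq_0 scaleR_2[symmetric])
      moreover have "vec_of b \<in> cross_polytope" "vec_of (antipode b) \<in> cross_polytope"
        using b hull_subset[of "vec_of ` V" convex] unfolding cross_polytope_eq by auto
      ultimately have "vec_of b \<in> F" using face_ofD[OF F] zero by blast
      then show ?thesis using b by (simp add: A_def)
    qed
    then have "A = V" by (auto simp: A_def)
    then show ?thesis using eq by blast
  qed (use eq in blast)
qed

theorem cross_model: "simplicial_model cross_C n V K (\<lambda>A. convex hull (vec_of ` A)) False"
proof
  let ?h = "\<lambda>A. convex hull (vec_of ` A)"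
  have faces: "faces (cross_C :: (real ^ 'n) set ranked_poset) = {F. F face_of cross_polytope}"
    by (simp add: cross_C_def face_lattice_def)
  show "bij_betw ?h (insert V K) (faces cross_C)"
    unfolding bij_betw_def faces
  proof
    show "inj_on ?h (insert V K)"
      using cross_face_le by (intro inj_onI) (metis subset_antisym subset_refl)
    have "?h V face_of cross_polytope" unfolding cross_polytope_eq by (simp add: face_of_refl)
    then show "?h ` insert V K = {F. F face_of cross_polytope}"
      using cross_face(2) cross_face_cases by auto
  qed
  show "face_le cross_C (?h A) (?h B) = (if False then B \<subseteq> A else A \<subseteq> B)"
    if "A \<in> insert V K" "B \<in> insert V K" for A B
    using cross_face_le[OF that] by (simp add: cross_C_def face_lattice_def)
  show "ranked_partial_order n (cross_C :: (real ^ 'n) set ranked_poset)"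
    unfolding n cross_C_def by (rule face_lattice_ranked) (simp add: cross_polytope_def)
qed (use complex_axioms cross_complex_pure finite_V n_pos in auto)

definition cube :: "(real ^ 'n) set" where
  "cube = {x. \<forall>a\<in>V. vec_of a \<bullet> x \<le> 1}"

lemma cube_iff: "x \<in> cube \<longleftrightarrow> (\<forall>i. -1 \<le> x $ i \<and> x $ i \<le> 1)"
proof -
  have "x \<in> cube \<longleftrightarrow> (\<forall>j<n. -1 \<le> x $ e j \<and> x $ e j \<le> 1)"
    by (force simp: cube_def cross_vertices_def vec_of_def inner_axis')
  also have "\<dots> \<longleftrightarrow> (\<forall>i. -1 \<le> x $ i \<and> x $ i \<le> 1)"
    using e by (metis bij_betw_iff_bijections UNIV_I lessThan_iff)
  finally show ?thesis .
qed

lemma hypercube_eq: "hypercube = cube"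
proof -
  let ?f = "\<lambda>x :: real ^ 'n. (- 1) + 2 *\<^sub>R x" and ?U = "{x :: real ^ 'n. \<forall>i. x $ i = 0 \<or> x $ i = 1}"
  have inv: "x = ?f ((1/2) *\<^sub>R (x + 1))" for x by (simp add: vec_eq_iff algebra_simps)
  have "{x :: real ^ 'n. \<forall>i. x $ i \<in> {-1, 1}} = ?f ` ?U"
  proof
    show "{x :: real ^ 'n. \<forall>i. x $ i \<in> {-1, 1}} \<subseteq> ?f ` ?U"
    proof
      fix x :: "real ^ 'n" assume "x \<in> {x. \<forall>i. x $ i \<in> {-1, 1}}"
      then have xi: "x $ i = -1 \<or> x $ i = 1" for i by simp
      have "((1/2) *\<^sub>R (x + 1)) $ i = 0 \<or> ((1/2) *\<^sub>R (x + 1)) $ i = 1" for i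
        using xi[of i] by (elim disjE) simp_all
      then have "(1/2) *\<^sub>R (x + 1) \<in> ?U" by blast
      then show "x \<in> ?f ` ?U" using inv by blast
    qed
  qed auto
  moreover have "convex hull ?U = cbox 0 1"
  proof -
    have "(One :: real ^ 'n) = 1" by (rule Cart_1[symmetric])
    moreover have "?U = {x. \<forall>b\<in>Basis. x \<bullet> b = 0 \<or> x \<bullet> b = 1}" by (auto simp: Basis_vec_def inner_axis)
    ultimately show ?thesis using unit_interval_convex_hull[where 'a = "real ^ 'n"] by simp
  qed
  ultimately have "hypercube = ?f ` cbox 0 1"
    unfolding hypercube_def by (simp only: convex_hull_affinity)
  also have "\<dots> = cube"
  proof
    show "?f ` cbox 0 1 \<subseteq> cube" by (auto simp: cube_iff mem_box_cart)
    show "cube \<subseteq> ?f ` cbox 0 1"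
    proof
      fix x assume "x \<in> cube"
      then have "-1 \<le> x $ i" "x $ i \<le> 1" for i by (simp_all add: cube_iff)
      then have "0 \<le> x $ i + 1" "x $ i + 1 \<le> 2" for i by (smt (verit))+
      then have "(1/2) *\<^sub>R (x + 1) \<in> cbox 0 1" by (simp add: mem_box_cart)
      then show "x \<in> ?f ` cbox 0 1" using inv by blast
    qed
  qed
  finally show ?thesis .
qed

definition cube_face :: "(nat \<times> bool) set \<Rightarrow> (real ^ 'n) set" where
  "cube_face A = {x \<in> cube. \<forall>a\<in>A. vec_of a \<bullet> x = 1}"

lemma convex_cube: "convex cube"
  using hypercube_eq by (metis convex_convex_hull hypercube_def)

lemma cube_face_face:
  assumes "A \<subseteq> V" shows "cube_face A face_of cube"
proof -
  have "finite A" using assms finite_V finite_subset by blast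
  then show ?thesis using assms
  proof (induction A rule: finite_induct)
    case empty
    then show ?case using convex_cube by (simp add: cube_face_def face_of_refl)
  next
    case (insert a A)
    have "cube \<inter> {x. vec_of a \<bullet> x = 1} face_of cube"
      using insert convex_cube by (intro face_of_Int_supporting_hyperplane_le) (auto simp: cube_def)
    moreover have "cube_face A face_of cube" using insert by simp
    ultimately have "cube_face A \<inter> (cube \<inter> {x. vec_of a \<bullet> x = 1}) face_of cube"
      by (rule face_of_Int[rotated])
    moreover have "cube_face A \<inter> (cube \<inter> {x. vec_of a \<bullet> x = 1}) = cube_face (insert a A)"
      by (auto simp: cube_face_def)
    ultimately show ?case by simp
  qed
qed

lemma cube_face_V: "cube_face V = {}"
proof -
  have "(0, True) \<in> V" "(0, False) \<in> V" using n_pos by (auto simp: cross_vertices_def)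
  moreover have "vec_of (0, False) = - vec_of (0, True)" using vec_antipode[of "(0, True)"] by simp
  ultimately have "\<not> (\<forall>a\<in>V. vec_of a \<bullet> x = 1)" for x
    by (metis inner_minus_left one_neq_neg_one)
  then show ?thesis by (simp add: cube_face_def)
qed

lemma cube_face_le:
  assumes "A \<in> insert V K" "B \<in> insert V K"
  shows "cube_face A \<subseteq> cube_face B \<longleftrightarrow> B \<subseteq> A"
proof
  assume sub: "cube_face A \<subseteq> cube_face B"
  have BV: "B \<subseteq> V" using assms complex_axioms by blast
  show "B \<subseteq> A"
  proof (cases "A = V")
    case False
    then have A: "A \<in> K" using assms by blast
    have AV: "A \<subseteq> V" using A complex_axioms by blast
    have "centre A \<in> cube_face A"
      using inner_centre[OF A] AV by (auto simp: cube_face_def cube_def inner_commute[of "vec_of _"])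
    then have "centre A \<in> cube_face B" using sub by blast
    then show ?thesis
      using inner_centre[OF A] BV by (fastforce simp: cube_face_def inner_commute[of "vec_of _"] split: if_splits)
  qed (use BV in simp)
qed (auto simp: cube_face_def)

text \<open>
  Averaging points of \<open>F\<close> leaves slack in every inequality that some point of \<open>F\<close> satisfies strictly.
\<close>

lemma cube_face_interior:
  assumes F: "convex F" "F \<noteq> {}" "F \<subseteq> cube" and D: "finite D" "D \<subseteq> V"
    and ex: "\<And>a. a \<in> D \<Longrightarrow> \<exists>x\<in>F. vec_of a \<bullet> x < 1"
  shows "\<exists>x\<in>F. \<exists>\<epsilon>>0. \<forall>a\<in>D. vec_of a \<bullet> x + 2 * \<epsilon> \<le> 1"
  using D ex
proof (induction D rule: finite_induct)
  case empty
  then show ?case using F(2) by (auto intro: exI[of _ 1])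
next
  case (insert a D)
  then obtain x \<epsilon> where x: "x \<in> F" "\<epsilon> > 0" "\<And>b. b \<in> D \<Longrightarrow> vec_of b \<bullet> x + 2 * \<epsilon> \<le> 1" by auto
  obtain y where y: "y \<in> F" "vec_of a \<bullet> y < 1" using insert.prems by blast
  define \<delta> where "\<delta> = min \<epsilon> ((1 - vec_of a \<bullet> y) / 2) / 2"
  have \<delta>: "\<delta> > 0" "2 * \<delta> \<le> \<epsilon>" "4 * \<delta> \<le> 1 - vec_of a \<bullet> y"
    using x(2) y(2) unfolding \<delta>_def by (auto simp: min_def)
  define z where "z = (1/2) *\<^sub>R x + (1/2) *\<^sub>R y"
  have "z \<in> F" unfolding z_def using F x y by (intro convexD) auto
  moreover have "vec_of b \<bullet> z + 2 * \<delta> \<le> 1" if b: "b \<in> insert a D" for b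
  proof -
    have bz: "vec_of b \<bullet> z = (vec_of b \<bullet> x + vec_of b \<bullet> y) / 2" by (simp add: z_def inner_add_right)
    have "b \<in> V" using b insert.prems by auto
    then have le: "vec_of b \<bullet> x \<le> 1" "vec_of b \<bullet> y \<le> 1" using x y F(3) by (auto simp: cube_def)
    show ?thesis
    proof (cases "b \<in> D")
      case True
      then show ?thesis using bz le x(3)[OF True] \<delta> by simp
    next
      case False
      then show ?thesis using bz le b \<delta> by simp
    qed
  qed
  ultimately show ?case using \<delta> by blast
qed

text \<open>
  Let \<open>A\<close> be the set of facets that contain \<open>F\<close>, and let \<open>x\<close> in \<open>F\<close> have slack in all other inequalities. A segment
  from a point \<open>y\<close> in all facets of \<open>A\<close> to \<open>x\<close> can be prolonged beyond \<open>x\<close> within the cube, so that \<open>y\<close> belongs to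
  \<open>F\<close>.
\<close>

lemma cube_face_cases:
  assumes F: "F face_of cube"
  shows "\<exists>A\<in>insert V K. F = cube_face A"
proof (cases "F = {}")
  case True
  then show ?thesis using cube_face_V by auto
next
  case False
  define A where "A = {a \<in> V. \<forall>x\<in>F. vec_of a \<bullet> x = 1}"
  have FC: "F \<subseteq> cube" by (rule face_of_imp_subset[OF F])
  have "A \<in> K"
  proof -
    obtain y where "y \<in> F" using False by blast
    then have "antipode a \<notin> A" if "a \<in> A" for a
      using that by (force simp: A_def vec_antipode)
    then show ?thesis by (auto simp: A_def cross_complex_def)
  qed
  moreover have "F = cube_face A"
  proof
    show "F \<subseteq> cube_face A" using FC by (auto simp: cube_face_def A_def)
    show "cube_face A \<subseteq> F"
    proof
      fix y assume y: "y \<in> cube_face A"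
      have "\<exists>x\<in>F. vec_of a \<bullet> x < 1" if a: "a \<in> V - A" for a
      proof -
        obtain x where x: "x \<in> F" "vec_of a \<bullet> x \<noteq> 1" using a by (auto simp: A_def)
        moreover have "vec_of a \<bullet> x \<le> 1" using x FC a by (auto simp: cube_def)
        ultimately show ?thesis by (intro bexI[of _ x]) auto
      qed
      then obtain x \<epsilon> where x: "x \<in> F" "\<epsilon> > 0" "\<And>a. a \<in> V - A \<Longrightarrow> vec_of a \<bullet> x + 2 * \<epsilon> \<le> 1"
        using cube_face_interior[of F "V - A"] face_of_imp_convex[OF F] False FC finite_V by blast
      show "y \<in> F"
      proof (cases "x = y")
        case False
        define z where "z = x + \<epsilon> *\<^sub>R (x - y)"
        have yC: "y \<in> cube" using y by (simp add: cube_face_def)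
        have az: "vec_of a \<bullet> z = vec_of a \<bullet> x + \<epsilon> * (vec_of a \<bullet> x - vec_of a \<bullet> y)" for a
          by (simp add: z_def inner_add_right inner_diff_right)
        have "vec_of a \<bullet> z \<le> 1" if a: "a \<in> V" for a
        proof (cases "a \<in> A")
          case True
          then have "vec_of a \<bullet> x = 1" "vec_of a \<bullet> y = 1"
            using y x(1) unfolding A_def cube_face_def by blast+
          then show ?thesis unfolding az by simp
        next
          case False
          have "- (vec_of a \<bullet> y) \<le> 1"
            using yC a vec_antipode[of a] antipode_in[of a n] unfolding cube_def by (metis (mono_tags, lifting) inner_minus_left mem_Collect_eq)
          moreover have "vec_of a \<bullet> x \<le> 1" using x FC a by (auto simp: cube_def)
          ultimately have "vec_of a \<bullet> x - vec_of a \<bullet> y \<le> 2" by simp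
          then have "\<epsilon> * (vec_of a \<bullet> x - vec_of a \<bullet> y) \<le> \<epsilon> * 2" using x(2) by (intro mult_left_mono) auto
          then show ?thesis using x(3)[of a] a False unfolding az by simp
        qed
        then have zC: "z \<in> cube" by (simp add: cube_def)
        have "x \<in> open_segment y z"
          unfolding in_segment
        proof (intro conjI exI[of _ "1 / (1 + \<epsilon>)"])
          show "y \<noteq> z"
          proof
            assume "y = z"
            then have "(1 + \<epsilon>) *\<^sub>R (x - y) = 0" by (simp add: z_def algebra_simps)
            then show False using False x(2) by simp
          qed
          have "(1 + \<epsilon>) *\<^sub>R ((1 - 1 / (1 + \<epsilon>)) *\<^sub>R y + (1 / (1 + \<epsilon>)) *\<^sub>R z) = \<epsilon> *\<^sub>R y + z"
            using x(2) by (simp add: scaleR_add_right right_diff_distrib)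
          also have "\<dots> = (1 + \<epsilon>) *\<^sub>R x" by (simp add: z_def algebra_simps)
          finally show "x = (1 - 1 / (1 + \<epsilon>)) *\<^sub>R y + (1 / (1 + \<epsilon>)) *\<^sub>R z" using x(2) by simp
        qed (use x(2) in auto)
        then show ?thesis using face_ofD[OF F] yC zC x(1) by blast
      qed (use x in simp)
    qed
  qed
  ultimately show ?thesis by blast
qed

theorem cube_model: "simplicial_model cube_B n V K cube_face True"
proof
  have faces: "faces (cube_B :: (real ^ 'n) set ranked_poset) = {F. F face_of cube}"
    by (simp add: cube_B_def face_lattice_def hypercube_eq)
  show "bij_betw cube_face (insert V K) (faces cube_B)"
    unfolding bij_betw_def faces
  proof
    show "inj_on cube_face (insert V K)"
      using cube_face_le by (intro inj_onI) (metis subset_antisym subset_refl)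
    show "cube_face ` insert V K = {F. F face_of cube}"
    proof
      show "cube_face ` insert V K \<subseteq> {F. F face_of cube}"
        using cube_face_face complex_axioms(1) by blast
      show "{F. F face_of cube} \<subseteq> cube_face ` insert V K" using cube_face_cases by blast
    qed
  qed
  show "face_le cube_B (cube_face A) (cube_face B) = (if True then B \<subseteq> A else A \<subseteq> B)"
    if "A \<in> insert V K" "B \<in> insert V K" for A B
    using cube_face_le[OF that] by (simp add: cube_B_def face_lattice_def)
  show "ranked_partial_order n (cube_B :: (real ^ 'n) set ranked_poset)"
    unfolding n cube_B_def by (rule face_lattice_ranked) (simp add: hypercube_def)
qed (use complex_axioms cross_complex_pure finite_V n_pos in auto)

end

lemma signed_basis_exists:
  obtains e :: "nat \<Rightarrow> 'n::finite" where "signed_basis CARD('n) e"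
proof -
  obtain e :: "nat \<Rightarrow> 'n" where "bij_betw e {0..<CARD('n)} UNIV"
    using ex_bij_betw_nat_finite[of "UNIV :: 'n set"] by auto
  then have "signed_basis CARD('n) e" by unfold_locales (auto simp: lessThan_atLeast0)
  then show thesis by (rule that)
qed

section \<open>The mix as a coset poset\<close>

text \<open>
  The reflections are not rotations, so that the product of the full automorphism groups is needed as
  the ambient group; the product of the rotation groups is a subgroup of it.
\<close>

definition aut_product :: "('a ranked_poset \<times> 'a set) list \<Rightarrow> (nat \<Rightarrow> 'a \<Rightarrow> 'a) monoid" where
  "aut_product Ps = product_group {..<length Ps} (\<lambda>r. aut_group (fst (Ps ! r)))"

definition mix_reflection :: "('a ranked_poset \<times> 'a set) list \<Rightarrow> nat \<Rightarrow> nat \<Rightarrow> 'a \<Rightarrow> 'a" where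
  "mix_reflection Ps i = (\<lambda>r\<in>{..<length Ps}. reflection_gen (fst (Ps ! r)) (snd (Ps ! r)) i)"

lemma group_aut_product: "group (aut_product Ps)"
  unfolding aut_product_def by (rule product_group) (rule group_aut_group)

lemma aut_product_mult: "r < length Ps \<Longrightarrow>
    (x \<otimes>\<^bsub>aut_product Ps\<^esub> y) r = x r \<otimes>\<^bsub>aut_group (fst (Ps ! r))\<^esub> y r"
  by (simp add: aut_product_def)

lemma aut_product_one: "r < length Ps \<Longrightarrow> \<one>\<^bsub>aut_product Ps\<^esub> r = \<one>\<^bsub>aut_group (fst (Ps ! r))\<^esub>"
  by (simp add: aut_product_def)

lemma aut_product_carrier: "x \<in> carrier (aut_product Ps) \<longleftrightarrow>
    x \<in> extensional {..<length Ps} \<and> (\<forall>r<length Ps. x r \<in> carrier (aut_group (fst (Ps ! r))))"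
  by (auto simp: aut_product_def PiE_iff)

lemma aut_product_eqI:
  assumes "x \<in> carrier (aut_product Ps)" "y \<in> carrier (aut_product Ps)"
    and "\<And>r. r < length Ps \<Longrightarrow> x r = y r"
  shows "x = y"
  using assms unfolding aut_product_carrier by (metis extensionalityI lessThan_iff)

lemma string_group_aut_product:
  assumes "\<And>r. r < length Ps \<Longrightarrow> string_group (aut_group (fst (Ps ! r))) n (reflection_gen (fst (Ps ! r)) (snd (Ps ! r)))"
  shows "string_group (aut_product Ps) n (mix_reflection Ps)"
proof -
  interpret group "aut_product Ps" by (rule group_aut_product)
  have closed: "mix_reflection Ps i \<in> carrier (aut_product Ps)" if "i < n" for i
    using string_group.gen_closed[OF assms that] by (auto simp: aut_product_carrier mix_reflection_def)
  have comp: "mix_reflection Ps i r = reflection_gen (fst (Ps ! r)) (snd (Ps ! r)) i" if "r < length Ps" for i r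
    using that by (simp add: mix_reflection_def)
  show ?thesis
  proof
    show "mix_reflection Ps i \<otimes>\<^bsub>aut_product Ps\<^esub> mix_reflection Ps i = \<one>\<^bsub>aut_product Ps\<^esub>" if "i < n" for i
      using that closed string_group.gen_invol[OF assms]
      by (intro aut_product_eqI[OF m_closed one_closed]) (auto simp: aut_product_mult aut_product_one comp)
    show "mix_reflection Ps i \<otimes>\<^bsub>aut_product Ps\<^esub> mix_reflection Ps j =
        mix_reflection Ps j \<otimes>\<^bsub>aut_product Ps\<^esub> mix_reflection Ps i" if "j < n" "i + 1 < j" for i j
      using that closed string_group.gen_comm_less[OF assms]
      by (intro aut_product_eqI[OF m_closed m_closed]) (auto simp: aut_product_mult comp)
  qed (rule closed)
qed

locale mix_group_setup = signed_string_group "aut_product Ps" n "mix_reflection Ps" sgn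
  for Ps :: "('a ranked_poset \<times> 'a set) list" and n sgn
begin

abbreviation "M \<equiv> aut_product Ps"
abbreviation "\<alpha> \<equiv> mix_reflection Ps"

lemma reflection_closed: "r < length Ps \<Longrightarrow> i < n \<Longrightarrow>
    reflection_gen (fst (Ps ! r)) (snd (Ps ! r)) i \<in> carrier (aut_group (fst (Ps ! r)))"
  using gen_closed[of i] by (auto simp: aut_product_carrier mix_reflection_def)

definition rotation_carrier :: "(nat \<Rightarrow> 'a \<Rightarrow> 'a) set" where
  "rotation_carrier = (\<Pi>\<^sub>E r\<in>{..<length Ps}. generate (aut_group (fst (Ps ! r)))
     (rotation_gen (fst (Ps ! r)) (snd (Ps ! r)) ` {1..n-1}))"

lemma rotation_product_eq: "rotation_product n Ps = M\<lparr>carrier := rotation_carrier\<rparr>"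
  by (simp add: rotation_product_def aut_product_def product_group_def rotation_group_def
      rotation_carrier_def cong: restrict_cong)

lemma mix_gen_eq: "1 \<le> i \<Longrightarrow> mix_gen Ps i = \<alpha> (i - 1) \<otimes>\<^bsub>M\<^esub> \<alpha> i"
  by (auto simp: mix_gen_def aut_product_def mix_reflection_def rotation_gen_def)

lemma rotation_carrier_subgroup: "subgroup rotation_carrier M"
proof -
  have sub: "subgroup (generate (aut_group (fst (Ps ! r)))
      (rotation_gen (fst (Ps ! r)) (snd (Ps ! r)) ` {1..n-1})) (aut_group (fst (Ps ! r)))"
    if "r < length Ps" for r
  proof -
    interpret A: group "aut_group (fst (Ps ! r))" by (rule group_aut_group)
    show ?thesis
      using reflection_closed[OF that] by (intro A.generate_is_subgroup) (auto simp: rotation_gen_def)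
  qed
  note mem = subgroup.mem_carrier[OF sub]
  show ?thesis
  proof (rule subgroupI)
    show "rotation_carrier \<subseteq> carrier M"
      using mem by (auto simp: rotation_carrier_def aut_product_carrier PiE_iff)
    have "(\<lambda>r\<in>{..<length Ps}. \<one>\<^bsub>aut_group (fst (Ps ! r))\<^esub>) \<in> rotation_carrier"
      by (auto simp: rotation_carrier_def intro: generate.one)
    then show "rotation_carrier \<noteq> {}" by blast
  next
    fix x assume x: "x \<in> rotation_carrier"
    then have "inv\<^bsub>M\<^esub> x = (\<lambda>r\<in>{..<length Ps}. inv\<^bsub>aut_group (fst (Ps ! r))\<^esub> x r)"
      unfolding aut_product_def using mem
      by (intro inv_product_group) (auto simp: rotation_carrier_def PiE_iff group_aut_group)
    then show "inv\<^bsub>M\<^esub> x \<in> rotation_carrier"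
      using x subgroup.m_inv_closed[OF sub] by (auto simp: rotation_carrier_def PiE_iff)
  next
    fix x y assume "x \<in> rotation_carrier" "y \<in> rotation_carrier"
    then show "x \<otimes>\<^bsub>M\<^esub> y \<in> rotation_carrier"
      using subgroup.m_closed[OF sub] by (auto simp: rotation_carrier_def PiE_iff aut_product_def)
  qed
qed

lemma mix_gen_in: "1 \<le> i \<Longrightarrow> i \<le> n - 1 \<Longrightarrow> mix_gen Ps i \<in> rotation_carrier"
  by (auto simp: mix_gen_def rotation_carrier_def intro!: generate.incl)

text \<open>
  The partial products of rotations telescope, because reflections are involutions.
\<close>

lemma mix_gen_prod_eq:
  assumes "1 \<le> i" "i \<le> j" "j \<le> n - 1"
  shows "mix_gen_prod n Ps i j = \<alpha> (i - 1) \<otimes>\<^bsub>M\<^esub> \<alpha> j"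
  using assms(2,1)
proof (induction i rule: inc_induct)
  case base
  then show ?case using assms rank_ge
    by (simp add: mix_gen_prod_def rotation_product_eq mix_gen_eq)
next
  case (step i)
  have "mix_gen_prod n Ps i j = mix_gen Ps i \<otimes>\<^bsub>M\<^esub> mix_gen_prod n Ps (Suc i) j"
    using step(2) by (simp add: mix_gen_prod_def rotation_product_eq upt_conv_Cons del: upt_Suc)
  also have "\<dots> = (\<alpha> (i - 1) \<otimes>\<^bsub>M\<^esub> \<alpha> i) \<otimes>\<^bsub>M\<^esub> (\<alpha> i \<otimes>\<^bsub>M\<^esub> \<alpha> j)"
    using step by (simp add: mix_gen_eq)
  also have "\<dots> = \<alpha> (i - 1) \<otimes>\<^bsub>M\<^esub> \<alpha> j"
    using step assms rank_ge by (simp add: m_assoc gen_cancel)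
  finally show ?case .
qed

lemma mix_subgroup_eq: "mix_subgroup n Ps I = Gp I"
proof -
  have eq: "{mix_gen_prod n Ps i j | i j. 1 \<le> i \<and> i \<le> j \<and> j \<le> n - 1 \<and> i - 1 \<in> I \<and> j \<in> I} =
    {\<alpha> i \<otimes>\<^bsub>M\<^esub> \<alpha> j | i j. i < j \<and> j < n \<and> i \<in> I \<and> j \<in> I}" (is "?L = ?R")
  proof
    show "?L \<subseteq> ?R"
    proof
      fix x assume "x \<in> ?L"
      then obtain i j where ij: "1 \<le> i" "i \<le> j" "j \<le> n - 1" "i - 1 \<in> I" "j \<in> I" "x = mix_gen_prod n Ps i j"
        by blast
      then have "x = \<alpha> (i - 1) \<otimes>\<^bsub>M\<^esub> \<alpha> j" "i - 1 < j" "j < n" using mix_gen_prod_eq rank_ge by auto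
      then show "x \<in> ?R" using ij by blast
    qed
    show "?R \<subseteq> ?L"
    proof
      fix x assume "x \<in> ?R"
      then obtain i j where ij: "i < j" "j < n" "i \<in> I" "j \<in> I" "x = \<alpha> i \<otimes>\<^bsub>M\<^esub> \<alpha> j" by blast
      then have "x = mix_gen_prod n Ps (Suc i) j" "1 \<le> Suc i" "Suc i \<le> j" "j \<le> n - 1" "Suc i - 1 \<in> I"
        using mix_gen_prod_eq[of "Suc i" j] by auto
      then show "x \<in> ?L" using ij by blast
    qed
  qed
  have "?thesis \<longleftrightarrow> generate (M\<lparr>carrier := rotation_carrier\<rparr>)
      {\<alpha> i \<otimes>\<^bsub>M\<^esub> \<alpha> j | i j. i < j \<and> j < n \<and> i \<in> I \<and> j \<in> I} =
    generate M {\<alpha> i \<otimes>\<^bsub>M\<^esub> \<alpha> j | i j. i < j \<and> j < n \<and> i \<in> I \<and> j \<in> I}"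
    unfolding mix_subgroup_def eq rotation_product_eq Gp_def ..
  moreover have "\<alpha> i \<otimes>\<^bsub>M\<^esub> \<alpha> j \<in> rotation_carrier" if ij: "i < j" "j < n" for i j
    using ij
  proof (induction j)
    case (Suc j)
    have step: "\<alpha> j \<otimes>\<^bsub>M\<^esub> \<alpha> (Suc j) \<in> rotation_carrier"
      using mix_gen_in[of "Suc j"] mix_gen_eq[of "Suc j"] Suc by simp
    show ?case
    proof (cases "i = j")
      case False
      then have "\<alpha> i \<otimes>\<^bsub>M\<^esub> \<alpha> j \<in> rotation_carrier" using Suc by simp
      then have "(\<alpha> i \<otimes>\<^bsub>M\<^esub> \<alpha> j) \<otimes>\<^bsub>M\<^esub> (\<alpha> j \<otimes>\<^bsub>M\<^esub> \<alpha> (Suc j)) \<in> rotation_carrier"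
        using subgroup.m_closed[OF rotation_carrier_subgroup] step by blast
      then show ?thesis using Suc by (simp add: m_assoc gen_cancel)
    qed (use step in simp)
  qed simp
  then have "{\<alpha> i \<otimes>\<^bsub>M\<^esub> \<alpha> j | i j. i < j \<and> j < n \<and> i \<in> I \<and> j \<in> I} \<subseteq> rotation_carrier" by blast
  ultimately show ?thesis using generate_consistent rotation_carrier_subgroup by blast
qed

lemma mix_group_eq: "mix_group n Ps = Gp UNIV"
proof -
  have "mix_gen Ps ` {1..n-1} \<subseteq> rotation_carrier" using mix_gen_in by auto
  then have eq: "mix_group n Ps = generate M (mix_gen Ps ` {1..n-1})"
    unfolding mix_group_def rotation_product_eq using generate_consistent rotation_carrier_subgroup by blast
  have gens: "mix_gen Ps i \<in> carrier M" if "i \<in> {1..n-1}" for i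
    using that mix_gen_eq[of i] rank_ge by auto
  have "\<alpha> i \<otimes>\<^bsub>M\<^esub> \<alpha> j \<in> generate M (mix_gen Ps ` {1..n-1})" if "i < j" "j < n" for i j
    using that
  proof (induction j)
    case (Suc j)
    have step: "\<alpha> j \<otimes>\<^bsub>M\<^esub> \<alpha> (Suc j) \<in> generate M (mix_gen Ps ` {1..n-1})"
      using mix_gen_eq[of "Suc j"] Suc(3) by (metis Suc_pred' atLeastAtMost_iff diff_Suc_1 generate.incl image_eqI le_add1 less_Suc_eq_le less_nat_zero_code not_gr_zero plus_1_eq_Suc)
    show ?case
    proof (cases "i = j")
      case False
      then have "\<alpha> i \<otimes>\<^bsub>M\<^esub> \<alpha> j \<in> generate M (mix_gen Ps ` {1..n-1})" using Suc by simp
      from generate.eng[OF this step] show ?thesis using Suc by (simp add: m_assoc gen_cancel)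
    qed (use step in simp)
  qed simp
  then have "Gp UNIV \<subseteq> generate M (mix_gen Ps ` {1..n-1})"
    unfolding Gp_def using gens
    by (intro generate_subgroup_incl generate_is_subgroup) auto
  moreover have "generate M (mix_gen Ps ` {1..n-1}) \<subseteq> Gp UNIV"
  proof (rule generate_subgroup_incl[OF _ Gp_subgroup], rule image_subsetI)
    fix i assume i: "i \<in> {1..n-1}"
    then have "i - 1 < i \<and> i < n" by auto
    then show "mix_gen Ps i \<in> Gp UNIV"
      using i mix_gen_eq[of i] unfolding Gp_def by (intro generate.incl) auto
  qed
  ultimately show ?thesis using eq by blast
qed

lemma Gp_restrict: "Gp ({..<n} - {j}) = Gp (- {j})"
proof -
  have "({..<n} - {j}) \<inter> {..<n} = - {j} \<inter> {..<n}" by blast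
  then show ?thesis unfolding Gp_eq G_def by simp
qed

theorem mix_eq_coset_poset: "mix n Ps = coset_poset"
proof -
  have rc: "A #>\<^bsub>rotation_product n Ps\<^esub> x = A #>\<^bsub>M\<^esub> x" for A x
    by (simp add: r_coset_def rotation_product_eq)
  have "{Proper_Face j (mix_subgroup n Ps ({..<n} - {j}) #>\<^bsub>rotation_product n Ps\<^esub> x) | j x.
      j < n \<and> x \<in> mix_group n Ps} = {Proper_Face j A | j A. j < n \<and> A \<in> {Gp (- {j}) #>\<^bsub>M\<^esub> x | x. x \<in> Gp UNIV}}"
    unfolding mix_subgroup_eq mix_group_eq rc Gp_restrict by blast
  also have "\<dots> = {Proper_Face j A | j A. j < n \<and> A \<in> coset j ` G UNIV}"
    by (intro Collect_cong ex_cong1 conj_cong refl) (simp only: proper_faces_eq)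
  also have "\<dots> = {Proper_Face j (coset j x) | j x. j < n \<and> x \<in> G UNIV}" by blast
  finally show ?thesis unfolding mix_def coset_poset_def by simp
qed

end

section \<open>Actions of the mix on vertices\<close>

text \<open>
  The two actions may name the same label differently, by \<open>f\<close> and \<open>f'\<close>; the argument \<open>c\<close> stands for data that
  the generators in question leave alone, such as the sign of a coordinate vector.
\<close>

lemma (in string_group) parallel_actions:
  assumes "z \<in> G I"
    and \<phi>: "\<phi> \<one> = id" "\<And>i x. i < n \<Longrightarrow> x \<in> carrier M \<Longrightarrow> \<phi> (\<alpha> i \<otimes> x) = t i \<circ> \<phi> x"
    and \<psi>: "\<psi> \<one> = id" "\<And>i x. i < n \<Longrightarrow> x \<in> carrier M \<Longrightarrow> \<psi> (\<alpha> i \<otimes> x) = u i \<circ> \<psi> x"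
    and swap: "\<And>i a c. i \<in> I \<Longrightarrow> i < n \<Longrightarrow> a \<in> A \<Longrightarrow> s i a \<in> A \<and> t i (f a c) = f (s i a) c \<and> u i (f' a c) = f' (s i a) c"
  obtains p where "\<And>a. a \<in> A \<Longrightarrow> p a \<in> A" "\<And>a c. a \<in> A \<Longrightarrow> \<phi> z (f a c) = f (p a) c"
    "\<And>a c. a \<in> A \<Longrightarrow> \<psi> z (f' a c) = f' (p a) c"
proof -
  have "\<exists>p. \<forall>a\<in>A. p a \<in> A \<and> (\<forall>c. \<phi> z (f a c) = f (p a) c \<and> \<psi> z (f' a c) = f' (p a) c)"
    using assms(1)
  proof (induction rule: G_induct)
    case one
    then show ?case using \<phi> \<psi> by (intro exI[of _ id]) simp
  next
    case (step i x)
    then obtain p where p: "\<And>a. a \<in> A \<Longrightarrow> p a \<in> A" "\<And>a c. a \<in> A \<Longrightarrow> \<phi> x (f a c) = f (p a) c"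
      "\<And>a c. a \<in> A \<Longrightarrow> \<psi> x (f' a c) = f' (p a) c" by blast
    have "s i (p a) \<in> A \<and> (\<forall>c. \<phi> (\<alpha> i \<otimes> x) (f a c) = f (s i (p a)) c \<and> \<psi> (\<alpha> i \<otimes> x) (f' a c) = f' (s i (p a)) c)"
      if "a \<in> A" for a
      using swap[OF step(1,2) p(1)[OF that]] p[OF that] \<phi>(2)[OF step(2)] \<psi>(2)[OF step(2)] G_carrier[OF step(3)]
      by simp
    then show ?case by (intro exI[of _ "\<lambda>a. s i (p a)"]) blast
  qed
  then show thesis using that by blast
qed

locale string_action = string_group M n \<alpha> for M (structure) and n \<alpha> +
  fixes \<phi> :: "'a \<Rightarrow> 'v \<Rightarrow> 'v" and t :: "nat \<Rightarrow> 'v \<Rightarrow> 'v"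
  assumes act_mult: "x \<in> carrier M \<Longrightarrow> y \<in> carrier M \<Longrightarrow> \<phi> (x \<otimes> y) = \<phi> x \<circ> \<phi> y"
    and act_gen: "i < n \<Longrightarrow> \<phi> (\<alpha> i) = t i"
    and act_one: "\<phi> \<one> = id"
begin

lemma act_step: "i < n \<Longrightarrow> x \<in> carrier M \<Longrightarrow> \<phi> (\<alpha> i \<otimes> x) = t i \<circ> \<phi> x"
  by (simp add: act_mult act_gen)

lemma act_preserves:
  assumes "z \<in> G I" "\<And>i. i \<in> I \<Longrightarrow> i < n \<Longrightarrow> t i ` D = D"
  shows "\<phi> z ` D = D"
  using assms(1)
proof (induction rule: G_induct)
  case one
  then show ?case by (simp add: act_one)
next
  case (step i x)
  have "\<phi> (\<alpha> i \<otimes> x) ` D = t i ` \<phi> x ` D"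
    using act_step[OF step(2) G_carrier[OF step(3)]] by (simp add: image_comp)
  then show ?case using step assms(2) by simp
qed

end

lemma adjacent_swap_comm: "i + 1 < j \<Longrightarrow> adjacent_swap i \<circ> adjacent_swap j = adjacent_swap j \<circ> adjacent_swap i"
  by (auto simp: fun_eq_iff Transposition.transpose_def)

lemma cross_reflection_invol: "cross_reflection n i \<circ> cross_reflection n i = id"
  by (auto simp: fun_eq_iff cross_reflection_def)

lemma cross_reflection_comm:
  assumes "i + 1 < j \<or> j + 1 < i" "i < n" "j < n"
  shows "cross_reflection n i \<circ> cross_reflection n j = cross_reflection n j \<circ> cross_reflection n i"
  using assms by (auto simp: fun_eq_iff cross_reflection_def Transposition.transpose_def)

text \<open>
  In a mix, \<open>\<phi>\<close> is the action of the automorphism in the factor that is a simplex on its \<open>n + 1\<close> vertices.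
\<close>

locale simplex_action = string_action M n \<alpha> \<phi> adjacent_swap for M (structure) and n \<alpha> \<phi> +
  assumes act_permutes: "x \<in> carrier M \<Longrightarrow> \<phi> x permutes {..n}"
    and rank3: "3 \<le> n"
begin

lemma act_initial:
  assumes "z \<in> G (- {j})" "j < n" shows "\<phi> z ` {..j} = {..j}"
  using assms(1)
proof (rule act_preserves)
  fix i assume "i \<in> - {j}"
  then show "adjacent_swap i ` {..j} = {..j}"
    using transpose_lessThan[of "Suc j" i] by (simp add: lessThan_Suc_atMost)
qed

sublocale signed_string_group M n \<alpha> "\<lambda>z. sign (\<phi> z)"
proof
  show "sign (\<phi> (x \<otimes> y)) = sign (\<phi> x) * sign (\<phi> y)" if "x \<in> carrier M" "y \<in> carrier M" for x y
    unfolding act_mult[OF that]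
    using act_permutes that by (intro sign_compose) (auto intro: permutes_imp_permutation[of "{..n}"])
  show "sign (\<phi> (\<alpha> i)) = -1" if "i < n" for i
    using act_gen[OF that] by (simp add: sign_swap_id)
  show "3 \<le> n" by (rule rank3)
  show "\<alpha> j \<notin> G (- {j})" if "j < n" for j
  proof
    assume "\<alpha> j \<in> G (- {j})"
    then have "adjacent_swap j ` {..j} = {..j}" using act_initial[of "\<alpha> j" j] act_gen that by simp
    then have "adjacent_swap j j \<in> {..j}" by blast
    then show False by simp
  qed
qed

text \<open>
  Bubble sort: exchanging an adjacent descent increases \<open>\<Sum>a\<le>n. a * g a\<close>. A permutation that
  preserves an initial segment has no descent at its end.
\<close>

lemma sorting:
  assumes x: "x \<in> G UNIV" and seg: "\<And>j. j \<in> J \<Longrightarrow> j < n \<Longrightarrow> \<phi> x ` {..j} = {..j}"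
  shows "\<exists>y\<in>G (- J). \<phi> y = \<phi> x"
proof -
  define m where "m g = (\<Sum>a\<le>n. int a * int (g a))" for g :: "nat \<Rightarrow> nat"
  have bound: "m (\<phi> x) \<le> int n * (int n * int (Suc n))" if "x \<in> G UNIV" for x
  proof -
    have "int a * int (\<phi> x a) \<le> int n * int n" if "a \<le> n" for a
      using permutes_in_image[OF act_permutes[OF G_carrier[OF \<open>x \<in> G UNIV\<close>]], of a] that
      by (intro mult_mono) auto
    then have "m (\<phi> x) \<le> (\<Sum>a\<le>n. int n * int n)" unfolding m_def by (intro sum_mono) auto
    then show ?thesis by (simp add: algebra_simps)
  qed
  define d where "d x = nat (int n * (int n * int (Suc n)) - m (\<phi> x))" for x
  show ?thesis
    using x seg
  proof (induction "d x" arbitrary: x rule: less_induct)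
    case less
    have xc: "x \<in> carrier M" by (rule G_carrier[OF less.prems(1)])
    note p = act_permutes[OF xc]
    show ?case
    proof (cases "\<exists>i<n. \<phi> x (Suc i) < \<phi> x i")
      case True
      then obtain i where i: "i < n" "\<phi> x (Suc i) < \<phi> x i" by blast
      have "i \<notin> J"
      proof
        assume "i \<in> J"
        then have img: "\<phi> x ` {..i} = {..i}" by (rule less.prems(2)[OF _ i(1)])
        then have "\<phi> x i \<le> i" by auto
        then have "\<phi> x (Suc i) \<in> \<phi> x ` {..i}" unfolding img using i by simp
        then obtain k where "k \<le> i" "\<phi> x (Suc i) = \<phi> x k" by auto
        then show False using injD[OF permutes_inj[OF p], of "Suc i" k] by simp
      qed
      have sp: "adjacent_swap i permutes {..n}" by (rule permutes_swap_id) (use i in auto)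
      have ax: "\<phi> (x \<otimes> \<alpha> i) = \<phi> x \<circ> adjacent_swap i"
        using act_mult[OF xc gen_closed[OF i(1)]] act_gen[OF i(1)] by simp
      have "m (\<phi> (x \<otimes> \<alpha> i)) = (\<Sum>a\<le>n. int (adjacent_swap i a) * int (\<phi> x a))"
        unfolding m_def ax by (subst sum.permute[OF sp]) (simp add: comp_def)
      then have "m (\<phi> (x \<otimes> \<alpha> i)) - m (\<phi> x) = (\<Sum>a\<le>n. (int (adjacent_swap i a) - int a) * int (\<phi> x a))"
        by (simp add: m_def sum_subtractf left_diff_distrib)
      also have "\<dots> = (\<Sum>a\<in>{i, Suc i}. (int (adjacent_swap i a) - int a) * int (\<phi> x a))"
        using i by (intro sum.mono_neutral_right) (auto simp: Transposition.transpose_def)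
      also have "\<dots> = int (\<phi> x i) - int (\<phi> x (Suc i))" by simp
      finally have "m (\<phi> x) < m (\<phi> (x \<otimes> \<alpha> i))" using i by simp
      moreover have xa: "x \<otimes> \<alpha> i \<in> G UNIV" by (rule G_mult[OF less.prems(1) G_gen]) (use i in auto)
      ultimately have dec: "d (x \<otimes> \<alpha> i) < d x" using bound[OF xa] by (simp add: d_def)
      have "\<phi> (x \<otimes> \<alpha> i) ` {..j} = {..j}" if "j \<in> J" "j < n" for j
      proof -
        have "j \<noteq> i" using that \<open>i \<notin> J\<close> by blast
        then have "adjacent_swap i ` {..j} = {..j}"
          using transpose_lessThan[of "Suc j" i] by (simp add: lessThan_Suc_atMost)
        then show ?thesis unfolding ax image_comp[symmetric] using less.prems(2)[OF that] by simp
      qed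
      then obtain y where y: "y \<in> G (- J)" "\<phi> y = \<phi> (x \<otimes> \<alpha> i)"
        using less.hyps[OF dec xa] by blast
      have "\<alpha> i \<in> G (- J)" using \<open>i \<notin> J\<close> i by (intro G_gen) auto
      moreover have "\<phi> (y \<otimes> \<alpha> i) = \<phi> x"
        using act_mult[OF G_carrier[OF y(1)] gen_closed[OF i(1)]] act_gen[OF i(1)] y(2) ax
        by (simp add: comp_assoc)
      ultimately show ?thesis using y(1) G_mult by blast
    next
      case False
      have inc: "\<phi> x i < \<phi> x (Suc i)" if "i < n" for i
      proof -
        have "\<phi> x i \<noteq> \<phi> x (Suc i)" using injD[OF permutes_inj[OF p], of i "Suc i"] by auto
        then show ?thesis using False that by (metis linorder_less_linear)
      qed
      have lower: "a \<le> \<phi> x a" if "a \<le> n" for a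
        using that
      proof (induction a)
        case (Suc a)
        then show ?case using inc[of a] by simp
      qed simp
      have upper: "\<phi> x a \<le> a" if "a \<le> n" for a
        using that
      proof (induction a rule: inc_induct)
        case base
        then show ?case using permutes_in_image[OF p, of n] by simp
      next
        case (step a)
        then show ?case using inc[of a] by simp
      qed
      have "\<phi> x a = id a" for a
      proof (cases "a \<le> n")
        case True
        then show ?thesis using lower[OF True] upper[OF True] by simp
      next
        case False
        then show ?thesis using p by (simp add: permutes_def)
      qed
      then have "\<phi> x = id" by blast
      then show ?thesis using act_one by (intro bexI[of _ \<one>]) auto
    qed
  qed
qed

lemma simplex_intersection_property: "intersection_property \<phi>"
  unfolding intersection_property_def
proof (intro allI impI ballI)
  fix J x assume J: "J \<subseteq> {..<n}" and x: "x \<in> G UNIV" and xJ: "\<forall>j\<in>J. \<phi> x \<in> \<phi> ` G (- {j})"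
  have "\<phi> x ` {..j} = {..j}" if "j \<in> J" "j < n" for j
  proof -
    obtain y where "y \<in> G (- {j})" "\<phi> x = \<phi> y" using xJ \<open>j \<in> J\<close> by blast
    then show ?thesis using act_initial[of y j] that by simp
  qed
  then show "\<phi> x \<in> \<phi> ` G (- J)" using sorting[OF x, of J] by (metis image_eqI)
qed

text \<open>
  The generators \<open>\<alpha> i\<close> with \<open>i < n - 1\<close> permute the coordinates of the cross-polytope as they permute the
  vertices \<open>0, \<dots>, n - 1\<close> of the simplex. Those with \<open>0 < i\<close> permute the coordinates of the cube, in reverse
  order, as they permute the vertices \<open>1, \<dots>, n\<close>.
\<close>

lemma simplex_determines_cross:
  assumes act: "string_action M n \<alpha> \<psi> (\<lambda>i. cross_reflection n (if dual then n - 1 - i else i))"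
    and mem: "\<And>x. x \<in> carrier M \<Longrightarrow> \<psi> x permutes cross_vertices n"
    and xy: "x \<in> G (- {if dual then 0 else n - 1})" "y \<in> G (- {if dual then 0 else n - 1})" "\<phi> x = \<phi> y"
  shows "\<psi> x = \<psi> y"
proof -
  interpret C: string_action M n \<alpha> \<psi> "\<lambda>i. cross_reflection n (if dual then n - 1 - i else i)" by fact
  define A where "A = (if dual then {1..n} else {..<n})"
  define l where "l a = (if dual then n - a else a)" for a
  have swap: "adjacent_swap i a \<in> A \<and> adjacent_swap i a = adjacent_swap i a \<and>
      cross_reflection n (if dual then n - 1 - i else i) (l a, c) = (l (adjacent_swap i a), c)"
    if "i \<in> - {if dual then 0 else n - 1}" "i < n" "a \<in> A" for i a and c :: bool
    using that by (cases dual) (auto simp: A_def l_def cross_reflection_def Transposition.transpose_def)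
  have ex: "\<exists>p. (\<forall>a\<in>A. \<phi> z a = p a) \<and> (\<forall>a\<in>A. \<forall>c. \<psi> z (l a, c) = (l (p a), c))"
    if "z \<in> G (- {if dual then 0 else n - 1})" for z
    by (rule parallel_actions[OF that, where \<phi> = \<phi> and \<psi> = \<psi> and A = A and s = adjacent_swap and f = "\<lambda>a _. a"
        and f' = "\<lambda>a c. (l a, c)", OF act_one act_step C.act_one C.act_step swap]) blast+
  obtain p q where p: "\<And>a. a \<in> A \<Longrightarrow> \<phi> x a = p a" "\<And>a c. a \<in> A \<Longrightarrow> \<psi> x (l a, c) = (l (p a), c)"
    and q: "\<And>a. a \<in> A \<Longrightarrow> \<phi> y a = q a" "\<And>a c. a \<in> A \<Longrightarrow> \<psi> y (l a, c) = (l (q a), c)"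
    using ex[OF xy(1)] ex[OF xy(2)] by blast
  have "\<psi> x v = \<psi> y v" for v
  proof (cases "v \<in> cross_vertices n")
    case True
    then obtain i c where ic: "v = (i, c)" "i < n" by (auto simp: cross_vertices_def)
    define a where "a = (if dual then n - i else i)"
    have "a \<in> A" "l a = i" using ic by (auto simp: a_def A_def l_def)
    then show ?thesis using p q xy(3) ic by metis
  next
    case False
    then show ?thesis using mem G_carrier xy by (metis permutes_not_in)
  qed
  then show ?thesis by blast
qed

end

definition base_perm :: "(nat \<times> bool \<Rightarrow> nat \<times> bool) \<Rightarrow> nat \<Rightarrow> nat" where
  "base_perm g i = fst (g (i, True))"

text \<open>
  On the \<open>2 n\<close> labels, a sign change is one transposition, whereas an exchange of coordinates is two.
  The induced permutation of the coordinates corrects this, so that every reflection is odd.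
\<close>

definition signed_sign :: "(nat \<times> bool \<Rightarrow> nat \<times> bool) \<Rightarrow> int" where
  "signed_sign g = sign g * sign (base_perm g)"

lemma base_perm_fst:
  assumes "g \<in> sym_group (cross_vertices n) (cross_complex n)"
  shows "fst (g a) = base_perm g (fst a)"
proof (cases "a \<in> cross_vertices n")
  case True
  obtain i c where ic: "a = (i, c)" by (cases a)
  have "(i, True) \<in> cross_vertices n" using True ic by (simp add: cross_vertices_def)
  then have "g (i, False) = antipode (g (i, True))"
    using assms cross_sym_iff[of g n] by (metis antipode_simps(1))
  then show ?thesis using ic by (cases c) (auto simp: base_perm_def)
next
  case False
  then have "(fst a, True) \<notin> cross_vertices n" by (cases a) (auto simp: cross_vertices_def)
  moreover have "g permutes cross_vertices n" using assms cross_sym_iff by blast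
  ultimately show ?thesis using False by (simp add: base_perm_def permutes_not_in)
qed

lemma base_perm_permutes:
  assumes g: "g \<in> sym_group (cross_vertices n) (cross_complex n)"
  shows "base_perm g permutes {..<n}"
proof -
  have p: "g permutes cross_vertices n" and anti: "\<And>a. a \<in> cross_vertices n \<Longrightarrow> g (antipode a) = antipode (g a)"
    using g cross_sym_iff by blast+
  have in_n: "base_perm g i < n" if "i < n" for i
    using permutes_in_image[OF p, of "(i, True)"] that
    by (cases "g (i, True)") (auto simp: base_perm_def cross_vertices_def)
  have "inj_on (base_perm g) {..<n}"
  proof (rule inj_onI)
    fix i j assume ij: "i \<in> {..<n}" "j \<in> {..<n}" "base_perm g i = base_perm g j"
    have "g (i, True) = g (j, True) \<or> g (i, True) = antipode (g (j, True))"
      using ij(3) by (cases "g (i, True)"; cases "g (j, True)") (auto simp: base_perm_def)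
    moreover have "antipode (g (j, True)) = g (j, False)"
      using anti[of "(j, True)"] ij by (simp add: cross_vertices_def)
    ultimately show "i = j" using injD[OF permutes_inj[OF p]] by fastforce
  qed
  moreover have "base_perm g ` {..<n} \<subseteq> {..<n}" using in_n by auto
  ultimately have "bij_betw (base_perm g) {..<n} {..<n}" by (simp add: bij_betw_def endo_inj_surj)
  then show ?thesis
  proof (rule bij_imp_permutes)
    show "base_perm g i = i" if "i \<notin> {..<n}" for i
      using that permutes_not_in[OF p, of "(i, True)"] by (simp add: base_perm_def cross_vertices_def)
  qed
qed

lemma signed_sign_comp:
  assumes f: "f \<in> sym_group (cross_vertices n) (cross_complex n)"
    and g: "g \<in> sym_group (cross_vertices n) (cross_complex n)"
  shows "signed_sign (f \<circ> g) = signed_sign f * signed_sign g"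
proof -
  have "f permutes cross_vertices n" "g permutes cross_vertices n" using f g cross_sym_iff by blast+
  then have "permutation f" "permutation g"
    by (auto intro!: permutes_imp_permutation[of "cross_vertices n"] simp: cross_vertices_def)
  moreover have "permutation (base_perm f)" "permutation (base_perm g)"
    using base_perm_permutes[OF f] base_perm_permutes[OF g] permutes_imp_permutation by blast+
  moreover have "base_perm (f \<circ> g) = base_perm f \<circ> base_perm g"
  proof
    fix i show "base_perm (f \<circ> g) i = (base_perm f \<circ> base_perm g) i"
      using base_perm_fst[OF f, of "g (i, True)"] by (simp add: base_perm_def)
  qed
  ultimately show ?thesis by (simp add: signed_sign_def sign_compose)
qed

lemma signed_sign_cross_reflection: "signed_sign (cross_reflection n i) = -1"
proof (cases "Suc i < n")
  case True
  have "cross_reflection n i = Transposition.transpose (i, True) (Suc i, True) \<circ> Transposition.transpose (i, False) (Suc i, False)"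
    using True by (auto simp: fun_eq_iff cross_reflection_def Transposition.transpose_def)
  then have "sign (cross_reflection n i) = 1"
    by (simp add: sign_compose sign_swap_id permutation_swap_id)
  moreover have "base_perm (cross_reflection n i) = adjacent_swap i"
    using True by (auto simp: fun_eq_iff base_perm_def cross_reflection_def)
  ultimately show ?thesis by (simp add: signed_sign_def sign_swap_id)
next
  case False
  have "cross_reflection n i = Transposition.transpose (i, True) (i, False)"
    using False by (auto simp: fun_eq_iff cross_reflection_def Transposition.transpose_def)
  then have "sign (cross_reflection n i) = -1" by (simp add: sign_swap_id)
  moreover have "base_perm (cross_reflection n i) = id"
    using False by (auto simp: fun_eq_iff base_perm_def cross_reflection_def)
  ultimately show ?thesis by (simp add: signed_sign_def)
qed

locale cross_action = string_action M n \<alpha> \<phi> "\<lambda>i. cross_reflection n (if dual then n - 1 - i else i)"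
  for M (structure) and n \<alpha> \<phi> and dual :: bool +
  assumes act_sym: "x \<in> carrier M \<Longrightarrow> \<phi> x \<in> sym_group (cross_vertices n) (cross_complex n)"
    and rank3: "3 \<le> n"
begin

lemma act_prefix:
  assumes z: "z \<in> G (- {j})" and j: "j < n" and k: "k = (if dual then n - j else Suc j)"
  shows "\<phi> z ` (\<lambda>i. (i, True)) ` {..<k} = (\<lambda>i. (i, True)) ` {..<k}"
  using z
proof (rule act_preserves)
  fix i assume "i \<in> - {j}" "i < n"
  then show "cross_reflection n (if dual then n - 1 - i else i) ` (\<lambda>i. (i, True)) ` {..<k} = (\<lambda>i. (i, True)) ` {..<k}"
    using j k by (intro cross_reflection_prefix) (auto split: if_splits)
qed

lemma act_trivial:
  assumes x: "x \<in> carrier M" and fix_x: "\<And>j. j < n \<Longrightarrow> x \<in> G (- {j})"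
  shows "\<phi> x = id"
proof (rule cross_rigid[OF act_sym[OF x]])
  fix k assume k: "k \<le> n"
  show "\<phi> x ` (\<lambda>i. (i, True)) ` {..<k} = (\<lambda>i. (i, True)) ` {..<k}"
  proof (cases "k = 0")
    case False
    define j where "j = (if dual then n - k else k - 1)"
    have "j < n" "k = (if dual then n - j else Suc j)" using False k by (auto simp: j_def)
    then show ?thesis using act_prefix fix_x by blast
  qed simp
qed

sublocale signed_string_group M n \<alpha> "\<lambda>z. signed_sign (\<phi> z)"
proof
  show "signed_sign (\<phi> (x \<otimes> y)) = signed_sign (\<phi> x) * signed_sign (\<phi> y)"
    if "x \<in> carrier M" "y \<in> carrier M" for x y
    unfolding act_mult[OF that] using act_sym that by (intro signed_sign_comp) auto
  show "signed_sign (\<phi> (\<alpha> i)) = -1" if "i < n" for i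
    using act_gen[OF that] by (simp add: signed_sign_cross_reflection)
  show "3 \<le> n" by (rule rank3)
  show "\<alpha> j \<notin> G (- {j})" if j: "j < n" for j
  proof
    assume a: "\<alpha> j \<in> G (- {j})"
    define k where "k = (if dual then n - 1 - j else j)"
    have k: "k < n" "Suc k = (if dual then n - j else Suc j)" using j by (auto simp: k_def)
    have "cross_reflection n k ` (\<lambda>i. (i, True)) ` {..<Suc k} = (\<lambda>i. (i, True)) ` {..<Suc k}"
      using act_prefix[OF a j k(2)] act_gen[OF j] by (simp add: k_def)
    then have "(if Suc k < n then (Suc k, True) else (k, False)) \<in> (\<lambda>i. (i, True)) ` {..<Suc k}"
      unfolding cross_reflection_prefix_Suc[OF k(1)] by blast
    then show False by (auto split: if_splits)
  qed
qed

end

lemma permutation_model_string_group: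
  assumes pm: "permutation_model n P \<Phi> (sym_group V K) t \<eta>"
    and invol: "\<And>i. i < n \<Longrightarrow> t i \<circ> t i = id"
    and comm: "\<And>i j. j < n \<Longrightarrow> i + 1 < j \<Longrightarrow> t i \<circ> t j = t j \<circ> t i"
  shows "string_group (aut_group P) n (reflection_gen P \<Phi>)" and "\<eta> \<one>\<^bsub>aut_group P\<^esub> = id"
proof -
  interpret A: group "aut_group P" by (rule group_aut_group)
  let ?A = "aut_group P" and ?\<rho> = "reflection_gen P \<Phi>"
  have gen: "?\<rho> i \<in> carrier ?A" "\<eta> (?\<rho> i) = t i" if "i < n" for i
    using pm that by (auto simp: permutation_model_def)
  have mult: "\<eta> (x \<otimes>\<^bsub>?A\<^esub> y) = \<eta> x \<circ> \<eta> y" if "x \<in> carrier ?A" "y \<in> carrier ?A" for x y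
    using pm that by (auto simp: permutation_model_def)
  have inj: "x = y" if "\<eta> x = \<eta> y" "x \<in> carrier ?A" "y \<in> carrier ?A" for x y
    using pm that unfolding permutation_model_def by (blast dest: inj_onD)
  have "\<eta> \<one>\<^bsub>?A\<^esub> permutes V" using pm by (auto simp: permutation_model_def sym_group_def)
  moreover have "\<eta> \<one>\<^bsub>?A\<^esub> (\<eta> \<one>\<^bsub>?A\<^esub> v) = \<eta> \<one>\<^bsub>?A\<^esub> v" for v
    using fun_cong[OF mult[of "\<one>\<^bsub>?A\<^esub>" "\<one>\<^bsub>?A\<^esub>"], of v] by simp
  ultimately show one: "\<eta> \<one>\<^bsub>?A\<^esub> = id"
    using injD[OF permutes_inj] by (metis eq_id_iff)
  show "string_group ?A n ?\<rho>"
  proof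
    show "?\<rho> i \<otimes>\<^bsub>?A\<^esub> ?\<rho> i = \<one>\<^bsub>?A\<^esub>" if "i < n" for i
      using gen[OF that] invol[OF that] one by (intro inj) (simp_all add: mult)
    show "?\<rho> i \<otimes>\<^bsub>?A\<^esub> ?\<rho> j = ?\<rho> j \<otimes>\<^bsub>?A\<^esub> ?\<rho> i" if "j < n" "i + 1 < j" for i j
      using gen[of i] gen[of j] comm[OF that] that by (intro inj) (simp_all add: mult)
  qed (rule gen)
qed

lemma mix_string_action:
  assumes sg: "string_group (aut_product Ps) n (mix_reflection Ps)" and r: "r < length Ps"
    and pm: "permutation_model n (fst (Ps ! r)) (snd (Ps ! r)) S t \<eta>"
    and one: "\<eta> \<one>\<^bsub>aut_group (fst (Ps ! r))\<^esub> = id"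
  shows "string_action (aut_product Ps) n (mix_reflection Ps) (\<lambda>z. \<eta> (z r)) t"
    and "x \<in> carrier (aut_product Ps) \<Longrightarrow> \<eta> (x r) \<in> S"
proof -
  interpret string_group "aut_product Ps" n "mix_reflection Ps" by fact
  have comp: "x r \<in> carrier (aut_group (fst (Ps ! r)))" if "x \<in> carrier (aut_product Ps)" for x
    using that r by (simp add: aut_product_carrier)
  show "string_action (aut_product Ps) n (mix_reflection Ps) (\<lambda>z. \<eta> (z r)) t"
  proof
    show "\<eta> ((x \<otimes>\<^bsub>aut_product Ps\<^esub> y) r) = \<eta> (x r) \<circ> \<eta> (y r)"
      if "x \<in> carrier (aut_product Ps)" "y \<in> carrier (aut_product Ps)" for x y
      using pm comp[OF that(1)] comp[OF that(2)] by (simp add: aut_product_mult[OF r] permutation_model_def)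
    show "\<eta> (mix_reflection Ps i r) = t i" if "i < n" for i
      using pm that r by (simp add: mix_reflection_def permutation_model_def)
    show "\<eta> (\<one>\<^bsub>aut_product Ps\<^esub> r) = id" using one by (simp add: aut_product_one[OF r])
  qed
  show "x \<in> carrier (aut_product Ps) \<Longrightarrow> \<eta> (x r) \<in> S"
    using pm comp by (simp add: permutation_model_def)
qed

lemma mix_component_eqI:
  assumes "r < length Ps" and pm: "permutation_model n (fst (Ps ! r)) (snd (Ps ! r)) S t \<eta>"
    and "x \<in> carrier (aut_product Ps)" "y \<in> carrier (aut_product Ps)" "\<eta> (x r) = \<eta> (y r)"
  shows "x r = y r"
proof -
  have "inj_on \<eta> (carrier (aut_group (fst (Ps ! r))))" using pm by (simp add: permutation_model_def)
  moreover have "x r \<in> carrier (aut_group (fst (Ps ! r)))" "y r \<in> carrier (aut_group (fst (Ps ! r)))"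
    using assms by (simp_all add: aut_product_carrier)
  ultimately show ?thesis using assms(5) by (simp add: inj_on_eq_iff)
qed

section \<open>The intersection of vertex group and facet group\<close>

definition (in string_group) word :: "nat list \<Rightarrow> 'a" where
  "word is = foldr (\<lambda>i x. \<alpha> i \<otimes> x) is \<one>"

lemma (in string_group) word_G: "set is \<subseteq> I \<inter> {..<n} \<Longrightarrow> word is \<in> G I"
  by (induction "is") (auto simp: word_def intro!: G_mult G_gen)

lemma (in string_action) act_word: "set is \<subseteq> {..<n} \<Longrightarrow> \<phi> (word is) = foldr (\<lambda>i g. t i \<circ> g) is id"
proof (induction "is")
  case (Cons i "is")
  have "word is \<in> carrier M" using word_G[of "is" UNIV] Cons.prems G_carrier by auto
  then show ?case using Cons act_step[of i "word is"] by (simp add: word_def)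
qed (simp add: word_def act_one)

lemma cross_reflection_order_3:
  assumes "Suc (Suc i) < n"
  shows "foldr (\<lambda>i g. cross_reflection n i \<circ> g) [i, Suc i, i, Suc i, i, Suc i, i, Suc i] id =
      cross_reflection n i \<circ> cross_reflection n (Suc i)"
    and "foldr (\<lambda>i g. cross_reflection n i \<circ> g) [Suc i, i, Suc i, i, Suc i, i, Suc i, i] id =
      cross_reflection n (Suc i) \<circ> cross_reflection n i"
  using assms by (auto simp: fun_eq_iff cross_reflection_def Transposition.transpose_def)

lemma cross_reflection_order_4:
  assumes "Suc (Suc i) = n"
  shows "foldr (\<lambda>i g. cross_reflection n i \<circ> g) [i, Suc i, i, Suc i, i, Suc i, i, Suc i] id = id"
    and "foldr (\<lambda>i g. cross_reflection n i \<circ> g) [Suc i, i, Suc i, i, Suc i, i, Suc i, i] id = id"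
  using assms by (auto simp: fun_eq_iff cross_reflection_def Transposition.transpose_def)

lemma cross_reflection_conjugate:
  assumes "i + 3 < n"
  shows "foldr (\<lambda>i g. cross_reflection n i \<circ> g)
        [i, Suc i, Suc (Suc i), i, Suc i, Suc (Suc i), Suc i, i] id =
      cross_reflection n (Suc i) \<circ> cross_reflection n (Suc (Suc i))"
    and "foldr (\<lambda>i g. cross_reflection n i \<circ> g)
        [i, Suc i, Suc (Suc i), Suc i, i, Suc (Suc i), Suc i, i] id =
      cross_reflection n (Suc (Suc i)) \<circ> cross_reflection n (Suc i)"
  using assms by (auto simp: fun_eq_iff cross_reflection_def Transposition.transpose_def)

lemma cross_reflection_cancel: "cross_reflection n i \<circ> (cross_reflection n i \<circ> g) = g"
  using cross_reflection_invol[of n i] by (simp add: comp_assoc[symmetric])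

locale cube_cross_action = string_group M n \<alpha> + B: cross_action M n \<alpha> \<phi> True + C: cross_action M n \<alpha> \<psi> False
  for M (structure) and n \<alpha> \<phi> \<psi> +
  assumes rank4: "4 \<le> n"
    and faithful: "x \<in> carrier M \<Longrightarrow> y \<in> carrier M \<Longrightarrow> \<phi> x = \<phi> y \<Longrightarrow> \<psi> x = \<psi> y \<Longrightarrow> x = y"
begin

lemma phi_word: "set is \<subseteq> {..<n} \<Longrightarrow> \<phi> (word is) = foldr (\<lambda>i g. cross_reflection n (n - 1 - i) \<circ> g) is id"
  and psi_word: "set is \<subseteq> {..<n} \<Longrightarrow> \<psi> (word is) = foldr (\<lambda>i g. cross_reflection n i \<circ> g) is id"
  using B.act_word[of "is"] C.act_word[of "is"] by simp_all

text \<open>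
  In the cube \<open>\<alpha> 0 \<otimes> \<alpha> 1\<close> has order 4, in the cross-polytope it has order 3. Its fourth power is therefore
  trivial in the cube and a 3-cycle in the cross-polytope; conjugation moves the 3-cycle along the
  string.
\<close>

lemma facet_group_element:
  "i + 3 \<le> n \<Longrightarrow> \<exists>z\<in>G (- {n - 1}). \<phi> z = id \<and> \<psi> z = cross_reflection n i \<circ> cross_reflection n (Suc i)"
proof (induction i)
  case 0
  let ?z = "word [0, Suc 0, 0, Suc 0, 0, Suc 0, 0, Suc 0]"
  have "n - 1 = Suc (n - 2)" using rank4 by simp
  then have "\<phi> ?z = id"
    using phi_word[of "[0, Suc 0, 0, Suc 0, 0, Suc 0, 0, Suc 0]"] cross_reflection_order_4(2)[of "n - 2" n] rank4
    by (simp add: numeral_2_eq_2)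
  moreover have "\<psi> ?z = cross_reflection n 0 \<circ> cross_reflection n (Suc 0)"
    using psi_word[of "[0, Suc 0, 0, Suc 0, 0, Suc 0, 0, Suc 0]"] cross_reflection_order_3(1)[of 0 n] rank4
    by simp
  moreover have "?z \<in> G (- {n - 1})" by (rule word_G) (use rank4 in auto)
  ultimately show ?case by blast
next
  case (Suc i)
  then have "i + 3 \<le> n" by simp
  then obtain z where z: "z \<in> G (- {n - 1})" "\<phi> z = id"
    "\<psi> z = cross_reflection n i \<circ> cross_reflection n (Suc i)" using Suc.IH by blast
  let ?w = "word [i, Suc i, Suc (Suc i)]" and ?w' = "word [Suc (Suc i), Suc i, i]"
  have w: "?w \<in> G (- {n - 1})" "?w' \<in> G (- {n - 1})" 
    by (intro word_G; use Suc in auto)+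
  note c = G_carrier[OF w(1)] G_carrier[OF w(2)] G_carrier[OF z(1)]
  have "\<phi> ((?w \<otimes> z) \<otimes> ?w') = id"
    using Suc(2) c z(2) phi_word[of "[i, Suc i, Suc (Suc i)]"] phi_word[of "[Suc (Suc i), Suc i, i]"]
    by (simp add: B.act_mult comp_assoc cross_reflection_cancel cross_reflection_invol)
  moreover have "\<psi> ((?w \<otimes> z) \<otimes> ?w') = cross_reflection n (Suc i) \<circ> cross_reflection n (Suc (Suc i))"
    using Suc(2) c z(3) psi_word[of "[i, Suc i, Suc (Suc i)]"] psi_word[of "[Suc (Suc i), Suc i, i]"]
      cross_reflection_conjugate(1)[of i n]
    by (simp add: C.act_mult comp_assoc)
  ultimately show ?case using G_mult[OF G_mult[OF w(1) z(1)] w(2)] by blast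
qed

text \<open>
  The same with the two polytopes exchanged, starting from the other end of the string.
\<close>

lemma vertex_group_element:
  "\<exists>z\<in>G (- {0}). \<phi> z = cross_reflection n 2 \<circ> cross_reflection n 1 \<and> \<psi> z = id"
proof -
  define m where "m = n - 3"
  have n: "n = Suc (Suc (Suc m))" "1 \<le> m" using rank4 by (auto simp: m_def)
  define v where "v = [Suc m, Suc (Suc m), Suc m, Suc (Suc m), Suc m, Suc (Suc m), Suc m, Suc (Suc m)]"
  let ?w = "word [Suc (Suc m), Suc m, m]" and ?w' = "word [m, Suc m, Suc (Suc m)]"
  have z: "word v \<in> G (- {0})" by (rule word_G) (auto simp: v_def n(1))
  have w: "?w \<in> G (- {0})" "?w' \<in> G (- {0})"
    by (intro word_G; use n in auto)+
  note c = G_carrier[OF w(1)] G_carrier[OF w(2)] G_carrier[OF z]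
  have v: "\<phi> (word v) = cross_reflection n (Suc 0) \<circ> cross_reflection n 0" "\<psi> (word v) = id"
    using phi_word[of v] psi_word[of v] cross_reflection_order_3(2)[of 0 n] cross_reflection_order_4(1)[of "Suc m" n]
    by (simp_all add: v_def n(1))
  have "\<phi> ((?w \<otimes> word v) \<otimes> ?w') = cross_reflection n 2 \<circ> cross_reflection n 1"
    using c v(1) phi_word[of "[Suc (Suc m), Suc m, m]"] phi_word[of "[m, Suc m, Suc (Suc m)]"]
      cross_reflection_conjugate(2)[of 0 n] n
    by (simp add: B.act_mult comp_assoc numeral_2_eq_2)
  moreover have "\<psi> ((?w \<otimes> word v) \<otimes> ?w') = id"
    using c v(2) psi_word[of "[Suc (Suc m), Suc m, m]"] psi_word[of "[m, Suc m, Suc (Suc m)]"] n(1)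
    by (simp add: C.act_mult comp_assoc cross_reflection_cancel cross_reflection_invol)
  ultimately show ?thesis using G_mult[OF G_mult[OF w(1) z] w(2)] by blast
qed

text \<open>
  The product of \<open>\<alpha> (n - 3) \<otimes> \<alpha> (n - 2)\<close> with the inverse of the element of the vertex group is trivial in the cube
  and a 3-cycle in the cross-polytope, hence equal to the element of the facet group. Words in the
  generators \<open>\<alpha> 1, \<dots>, \<alpha> (n - 2)\<close> act on coordinates of both polytopes in step, so that none of them is such an
  element.
\<close>

lemma vertex_facet_intersection_fails:
  "\<exists>g. g \<in> G (- {0}) \<and> g \<in> G (- {n - 1}) \<and> g \<notin> G (- {0, n - 1})"
proof -
  let ?R = "cross_reflection n"
  have n3: "Suc (n - 3) = n - 2" using rank4 by simp
  obtain e where e: "e \<in> G (- {n - 1})" "\<phi> e = id" "\<psi> e = ?R (n - 3) \<circ> ?R (n - 2)"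
    using facet_group_element[of "n - 3"] rank4 n3 by auto
  obtain f where f: "f \<in> G (- {0})" "\<phi> f = ?R 2 \<circ> ?R 1" "\<psi> f = id" using vertex_group_element by blast
  have a: "\<alpha> (n - 3) \<otimes> \<alpha> (n - 2) \<in> G (- {0})" using rank4 by (intro G_mult G_gen) auto
  have eqs: "n - 1 - (n - 3) = 2" "n - 1 - (n - 2) = 1" using rank4 by auto
  have acta: "\<phi> (\<alpha> (n - 3) \<otimes> \<alpha> (n - 2)) = ?R 2 \<circ> ?R 1" "\<psi> (\<alpha> (n - 3) \<otimes> \<alpha> (n - 2)) = ?R (n - 3) \<circ> ?R (n - 2)"
    using rank4 B.act_gen[of "n - 3"] B.act_gen[of "n - 2"] C.act_gen[of "n - 3"] C.act_gen[of "n - 2"]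
    unfolding if_True if_False eqs by (simp_all add: B.act_mult C.act_mult)
  note fc = G_carrier[OF f(1)]
  have inv_f: "\<phi> (inv f) \<circ> \<phi> f = id" "\<psi> (inv f) \<circ> \<psi> f = id"
    using B.act_mult[of "inv f" f] C.act_mult[of "inv f" f] fc B.act_one C.act_one by simp_all
  define g where "g = inv f \<otimes> (\<alpha> (n - 3) \<otimes> \<alpha> (n - 2))"
  have g: "g \<in> G (- {0})" unfolding g_def by (rule G_mult[OF G_inv[OF f(1)] a])
  have "\<phi> g = id" "\<psi> g = ?R (n - 3) \<circ> ?R (n - 2)"
    using inv_f f(2,3) acta fc G_carrier[OF a] by (simp_all add: g_def B.act_mult C.act_mult)
  then have "g = e" using faithful G_carrier[OF g] G_carrier[OF e(1)] e by simp
  have "g \<notin> G (- {0, n - 1})"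
  proof
    assume gI: "g \<in> G (- {0, n - 1})"
    have swap: "adjacent_swap i a \<in> {1..n-1} \<and> ?R i (a, c) = (adjacent_swap i a, c) \<and>
        ?R (n - 1 - i) (n - a, c) = (n - adjacent_swap i a, c)"
      if "i \<in> - {0, n - 1}" "i < n" "a \<in> {1..n-1}" for i a and c :: bool
      using that by (auto simp: cross_reflection_def Transposition.transpose_def)
    have steps: "\<psi> (\<alpha> i \<otimes> x) = ?R i \<circ> \<psi> x" "\<phi> (\<alpha> i \<otimes> x) = ?R (n - 1 - i) \<circ> \<phi> x"
      if "i < n" "x \<in> carrier M" for i x
      using C.act_step[OF that] B.act_step[OF that] by simp_all
    have "\<exists>p. (\<forall>a\<in>{1..n-1}. p a \<in> {1..n-1}) \<and> (\<forall>a\<in>{1..n-1}. \<forall>c. \<psi> g (a, c) = (p a, c)) \<and>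
        (\<forall>a\<in>{1..n-1}. \<forall>c. \<phi> g (n - a, c) = (n - p a, c))"
      by (rule parallel_actions[OF gI, where \<phi> = \<psi> and \<psi> = \<phi> and s = adjacent_swap and f = "\<lambda>a c. (a, c)"
          and f' = "\<lambda>a c. (n - a, c)" and A = "{1..n-1}" and t = ?R and u = "\<lambda>i. ?R (n - 1 - i)",
          OF C.act_one steps(1) B.act_one steps(2) swap]) blast+
    then obtain p where p: "\<And>a. a \<in> {1..n-1} \<Longrightarrow> p a \<in> {1..n-1}"
      "\<And>a c. a \<in> {1..n-1} \<Longrightarrow> \<psi> g (a, c) = (p a, c)"
      "\<And>a c. a \<in> {1..n-1} \<Longrightarrow> \<phi> g (n - a, c) = (n - p a, c)"
      by blast
    have "n - 1 \<in> {1..n-1}" using rank4 by simp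
    then have "p (n - 1) \<in> {1..n-1}" "n - (n - 1) = n - p (n - 1)"
      using p(1) p(3)[of "n - 1" True] \<open>\<phi> g = id\<close> by auto
    then have "p (n - 1) = n - 1" using rank4 by auto
    then have "\<psi> g (n - 1, True) = (n - 1, True)" using p(2)[OF \<open>n - 1 \<in> {1..n-1}\<close>] by simp
    moreover have "\<psi> g (n - 1, True) = (n - 3, True)"
    proof -
      have "Suc (n - 3) < n" "Suc (n - 2) < n" "Suc (n - 2) = n - 1" using rank4 by auto
      then show ?thesis unfolding \<open>\<psi> g = ?R (n - 3) \<circ> ?R (n - 2)\<close>
        using n3 by (simp add: cross_reflection_def)
    qed
    ultimately show False using rank4 by simp
  qed
  then show ?thesis using g e(1) \<open>g = e\<close> by blast
qed

lemma stabilizer_trivial: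
  assumes x: "x \<in> carrier M" and fix_x: "\<And>j. j < n \<Longrightarrow> x \<in> G (- {j})"
  shows "x = \<one>"
  using faithful[OF x one_closed] B.act_trivial[OF x] C.act_trivial[OF x] fix_x B.act_one C.act_one by simp

theorem not_polytope: "\<not> abstract_polytope n C.coset_poset"
  using C.polytope_imp_vertex_facet_intersection vertex_facet_intersection_fails stabilizer_trivial
    G_carrier by metis

end

section \<open>The four mixes\<close>

abbreviation simplex_model_of :: "nat \<Rightarrow> 'f ranked_poset \<Rightarrow> 'f set \<Rightarrow> (('f \<Rightarrow> 'f) \<Rightarrow> nat \<Rightarrow> nat) \<Rightarrow> bool" where
  "simplex_model_of n P \<Phi> \<equiv> permutation_model n P \<Phi> (sym_group {..n} (simplex_complex n)) adjacent_swap"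

abbreviation cross_model_of ::
    "nat \<Rightarrow> 'f ranked_poset \<Rightarrow> 'f set \<Rightarrow> bool \<Rightarrow> (('f \<Rightarrow> 'f) \<Rightarrow> nat \<times> bool \<Rightarrow> nat \<times> bool) \<Rightarrow> bool" where
  "cross_model_of n P \<Phi> dual \<equiv> permutation_model n P \<Phi> (sym_group (cross_vertices n) (cross_complex n))
     (\<lambda>i. cross_reflection n (if dual then n - 1 - i else i))"

lemma simplex_string_group:
  assumes "simplex_model_of n P \<Phi> \<eta>"
  shows "string_group (aut_group P) n (reflection_gen P \<Phi>)" "\<eta> \<one>\<^bsub>aut_group P\<^esub> = id"
proof -
  note * = permutation_model_string_group[OF assms transpose_comp_involutory adjacent_swap_comm]
  show "string_group (aut_group P) n (reflection_gen P \<Phi>)" by (rule *(1))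
  show "\<eta> \<one>\<^bsub>aut_group P\<^esub> = id" by (rule *(2))
qed

lemma cross_string_group:
  assumes "cross_model_of n P \<Phi> dual \<eta>"
  shows "string_group (aut_group P) n (reflection_gen P \<Phi>)" "\<eta> \<one>\<^bsub>aut_group P\<^esub> = id"
proof -
  have "cross_reflection n (if dual then n - 1 - i else i) \<circ> cross_reflection n (if dual then n - 1 - j else j) =
      cross_reflection n (if dual then n - 1 - j else j) \<circ> cross_reflection n (if dual then n - 1 - i else i)"
    if "j < n" "i + 1 < j" for i j
    using that by (intro cross_reflection_comm) auto
  note * = permutation_model_string_group[OF assms cross_reflection_invol this]
  show "string_group (aut_group P) n (reflection_gen P \<Phi>)" by (rule *(1))
  show "\<eta> \<one>\<^bsub>aut_group P\<^esub> = id" by (rule *(2))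
qed

lemma mix_simplex_action:
  assumes sg: "string_group (aut_product Ps) n (mix_reflection Ps)" and r: "r < length Ps"
    and pm: "simplex_model_of n (fst (Ps ! r)) (snd (Ps ! r)) \<eta>" and n: "3 \<le> n"
  shows "simplex_action (aut_product Ps) n (mix_reflection Ps) (\<lambda>z. \<eta> (z r))"
proof -
  note a = mix_string_action[OF sg r pm simplex_string_group(2)[OF pm]]
  interpret string_action "aut_product Ps" n "mix_reflection Ps" "\<lambda>z. \<eta> (z r)" adjacent_swap by (rule a(1))
  show ?thesis by unfold_locales (use a(2) n in \<open>auto simp: sym_group_def\<close>)
qed

lemma mix_cross_action:
  assumes sg: "string_group (aut_product Ps) n (mix_reflection Ps)" and r: "r < length Ps"
    and pm: "cross_model_of n (fst (Ps ! r)) (snd (Ps ! r)) dual \<eta>" and n: "3 \<le> n"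
  shows "cross_action (aut_product Ps) n (mix_reflection Ps) (\<lambda>z. \<eta> (z r)) dual"
proof -
  note a = mix_string_action[OF sg r pm cross_string_group(2)[OF pm]]
  interpret string_action "aut_product Ps" n "mix_reflection Ps" "\<lambda>z. \<eta> (z r)"
    "\<lambda>i. cross_reflection n (if dual then n - 1 - i else i)" by (rule a(1))
  show ?thesis by unfold_locales (use a(2) n in auto)
qed

text \<open>
  Without the end generator that changes a sign, the second factor is determined by the first.
\<close>

theorem simplex_cross_mix_polytopal:
  assumes T: "simplex_model_of n P \<Phi> \<eta>" and Q: "cross_model_of n Q \<Psi> dual \<theta>" and n: "3 \<le> n"
  shows "polytopal n (mix n [(P, \<Phi>), (Q, \<Psi>)])"
proof -
  let ?Ps = "[(P, \<Phi>), (Q, \<Psi>)]"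
  have len: "0 < length ?Ps" "1 < length ?Ps" by simp_all
  have sg: "string_group (aut_product ?Ps) n (mix_reflection ?Ps)"
    by (rule string_group_aut_product)
      (use simplex_string_group(1)[OF T] cross_string_group(1)[OF Q] in \<open>auto simp: less_Suc_eq\<close>)
  have T0: "simplex_model_of n (fst (?Ps ! 0)) (snd (?Ps ! 0)) \<eta>" using T by simp
  interpret T: simplex_action "aut_product ?Ps" n "mix_reflection ?Ps" "\<lambda>z. \<eta> (z 0)"
    by (rule mix_simplex_action[OF sg len(1) T0 n])
  have Q1: "cross_model_of n (fst (?Ps ! 1)) (snd (?Ps ! 1)) dual \<theta>" using Q by simp
  interpret Q: cross_action "aut_product ?Ps" n "mix_reflection ?Ps" "\<lambda>z. \<theta> (z 1)" dual
    by (rule mix_cross_action[OF sg len(2) Q1 n])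
  interpret mix_group_setup ?Ps n "\<lambda>z. sign (\<eta> (z 0))" ..
  have T_eq: "x 0 = y 0" if "x \<in> carrier (aut_product ?Ps)" "y \<in> carrier (aut_product ?Ps)" "\<eta> (x 0) = \<eta> (y 0)" for x y
    by (rule mix_component_eqI[OF len(1) T0 that])
  have Q_eq: "x 1 = y 1" if "x \<in> carrier (aut_product ?Ps)" "y \<in> carrier (aut_product ?Ps)" "\<theta> (x 1) = \<theta> (y 1)" for x y
    by (rule mix_component_eqI[OF len(2) Q1 that])
  have "T.intersection_property (\<lambda>x. x)"
  proof (rule T.intersection_property_refine[OF T.simplex_intersection_property])
    show "(if dual then 0 else n - 1) = 0 \<or> (if dual then 0 else n - 1) = n - 1" by simp
    fix x y assume xy: "x \<in> T.G (- {if dual then 0 else n - 1})" "y \<in> T.G (- {if dual then 0 else n - 1})"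
      "\<eta> (x 0) = \<eta> (y 0)"
    note c = T.G_carrier[OF xy(1)] T.G_carrier[OF xy(2)]
    have "\<theta> (x 1) = \<theta> (y 1)"
      by (rule T.simplex_determines_cross[OF Q.string_action_axioms _ xy])
        (use Q.act_sym in \<open>simp add: sym_group_def\<close>)
    then have "x r = y r" if "r < length ?Ps" for r
      using that T_eq[OF c xy(3)] Q_eq[OF c] by (auto simp: less_Suc_eq)
    then show "x = y" by (rule aut_product_eqI[OF c])
  qed auto
  then show ?thesis
    unfolding mix_eq_coset_poset by (rule T.intersection_property_imp_polytope)
qed

text \<open>
  The cube is added to the simplex by omitting \<open>\<alpha> 0\<close>, then the cross-polytope by omitting \<open>\<alpha> (n - 1)\<close>.
\<close>

theorem simplex_cube_cross_mix_polytopal: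
  assumes T: "simplex_model_of n P \<Phi> \<eta>" and B: "cross_model_of n Q \<Psi> True \<theta>"
    and C: "cross_model_of n R \<Omega> False \<zeta>" and n: "3 \<le> n"
  shows "polytopal n (mix n [(P, \<Phi>), (Q, \<Psi>), (R, \<Omega>)])"
proof -
  let ?Ps = "[(P, \<Phi>), (Q, \<Psi>), (R, \<Omega>)]"
  have len: "0 < length ?Ps" "1 < length ?Ps" "2 < length ?Ps" by simp_all
  have sg: "string_group (aut_product ?Ps) n (mix_reflection ?Ps)"
    by (rule string_group_aut_product)
      (use simplex_string_group(1)[OF T] cross_string_group(1)[OF B] cross_string_group(1)[OF C]
        in \<open>auto simp: less_Suc_eq\<close>)
  have B1: "cross_model_of n (fst (?Ps ! 1)) (snd (?Ps ! 1)) True \<theta>" using B by simp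
  have C2: "cross_model_of n (fst (?Ps ! 2)) (snd (?Ps ! 2)) False \<zeta>" using C by simp
  have T0: "simplex_model_of n (fst (?Ps ! 0)) (snd (?Ps ! 0)) \<eta>" using T by simp
  interpret T: simplex_action "aut_product ?Ps" n "mix_reflection ?Ps" "\<lambda>z. \<eta> (z 0)"
    by (rule mix_simplex_action[OF sg len(1) T0 n])
  interpret B: cross_action "aut_product ?Ps" n "mix_reflection ?Ps" "\<lambda>z. \<theta> (z 1)" True
    by (rule mix_cross_action[OF sg len(2) B1 n])
  interpret C: cross_action "aut_product ?Ps" n "mix_reflection ?Ps" "\<lambda>z. \<zeta> (z 2)" False
    by (rule mix_cross_action[OF sg len(3) C2 n])
  interpret mix_group_setup ?Ps n "\<lambda>z. sign (\<eta> (z 0))" ..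
  have T_eq: "x 0 = y 0" if "x \<in> carrier (aut_product ?Ps)" "y \<in> carrier (aut_product ?Ps)" "\<eta> (x 0) = \<eta> (y 0)" for x y
    by (rule mix_component_eqI[OF len(1) T0 that])
  have B_eq: "x 1 = y 1" if "x \<in> carrier (aut_product ?Ps)" "y \<in> carrier (aut_product ?Ps)" "\<theta> (x 1) = \<theta> (y 1)" for x y
    by (rule mix_component_eqI[OF len(2) B1 that])
  have C_eq: "x 2 = y 2" if "x \<in> carrier (aut_product ?Ps)" "y \<in> carrier (aut_product ?Ps)" "\<zeta> (x 2) = \<zeta> (y 2)" for x y
    by (rule mix_component_eqI[OF len(3) C2 that])
  have "T.intersection_property (\<lambda>z. (\<eta> (z 0), \<theta> (z 1)))"
  proof (rule T.intersection_property_refine[OF T.simplex_intersection_property, where e = 0])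
    fix a x y assume "a \<in> T.G UNIV" "x \<in> T.G UNIV" "y \<in> T.G UNIV"
      "(\<eta> (x 0), \<theta> (x 1)) = (\<eta> (y 0), \<theta> (y 1))"
    then show "(\<eta> ((a \<otimes>\<^bsub>M\<^esub> x) 0), \<theta> ((a \<otimes>\<^bsub>M\<^esub> x) 1)) = (\<eta> ((a \<otimes>\<^bsub>M\<^esub> y) 0), \<theta> ((a \<otimes>\<^bsub>M\<^esub> y) 1))"
      using T.act_mult B.act_mult T.G_carrier by simp
  next
    fix x y assume xy: "x \<in> T.G (- {0})" "y \<in> T.G (- {0})" "\<eta> (x 0) = \<eta> (y 0)"
    have "\<theta> (x 1) = \<theta> (y 1)"
      by (rule T.simplex_determines_cross[where dual = True and x = x and y = y, OF B.string_action_axioms])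
        (use B.act_sym xy in \<open>simp_all add: sym_group_def\<close>)
    then show "(\<eta> (x 0), \<theta> (x 1)) = (\<eta> (y 0), \<theta> (y 1))" using xy by simp
  qed auto
  then have "T.intersection_property (\<lambda>x. x)"
  proof (rule T.intersection_property_refine[where e = "n - 1"])
    fix x y assume xy: "x \<in> T.G (- {n - 1})" "y \<in> T.G (- {n - 1})" "(\<eta> (x 0), \<theta> (x 1)) = (\<eta> (y 0), \<theta> (y 1))"
    note c = T.G_carrier[OF xy(1)] T.G_carrier[OF xy(2)]
    have "\<zeta> (x 2) = \<zeta> (y 2)"
      by (rule T.simplex_determines_cross[where dual = False and x = x and y = y, OF C.string_action_axioms])
        (use C.act_sym xy in \<open>simp_all add: sym_group_def\<close>)
    then have "x r = y r" if "r < length ?Ps" for r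
      using that T_eq[OF c] B_eq[OF c] C_eq[OF c] xy(3) by (auto simp: less_Suc_eq numeral_2_eq_2)
    then show "x = y" by (rule aut_product_eqI[OF c])
  qed auto
  then show ?thesis
    unfolding mix_eq_coset_poset by (rule T.intersection_property_imp_polytope)
qed

theorem cube_cross_mix_not_polytopal:
  assumes B: "cross_model_of n P \<Phi> True \<theta>" and C: "cross_model_of n Q \<Psi> False \<zeta>" and n: "4 \<le> n"
  shows "\<not> polytopal n (mix n [(P, \<Phi>), (Q, \<Psi>)])"
proof -
  let ?Ps = "[(P, \<Phi>), (Q, \<Psi>)]"
  have len: "0 < length ?Ps" "1 < length ?Ps" and n3: "3 \<le> n" using n by simp_all
  have sg: "string_group (aut_product ?Ps) n (mix_reflection ?Ps)"
    by (rule string_group_aut_product)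
      (use cross_string_group(1)[OF B] cross_string_group(1)[OF C] in \<open>auto simp: less_Suc_eq\<close>)
  have B0: "cross_model_of n (fst (?Ps ! 0)) (snd (?Ps ! 0)) True \<theta>" using B by simp
  have C1: "cross_model_of n (fst (?Ps ! 1)) (snd (?Ps ! 1)) False \<zeta>" using C by simp
  interpret B: cross_action "aut_product ?Ps" n "mix_reflection ?Ps" "\<lambda>z. \<theta> (z 0)" True
    by (rule mix_cross_action[OF sg len(1) B0 n3])
  interpret C: cross_action "aut_product ?Ps" n "mix_reflection ?Ps" "\<lambda>z. \<zeta> (z 1)" False
    by (rule mix_cross_action[OF sg len(2) C1 n3])
  interpret BC: cube_cross_action "aut_product ?Ps" n "mix_reflection ?Ps" "\<lambda>z. \<theta> (z 0)" "\<lambda>z. \<zeta> (z 1)"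
  proof
    fix x y assume c: "x \<in> carrier (aut_product ?Ps)" "y \<in> carrier (aut_product ?Ps)"
      and eq: "\<theta> (x 0) = \<theta> (y 0)" "\<zeta> (x 1) = \<zeta> (y 1)"
    have "x 0 = y 0"
      by (rule mix_component_eqI[OF len(1) B0 c eq(1)])
    moreover have "x 1 = y 1"
      by (rule mix_component_eqI[OF len(2) C1 c eq(2)])
    ultimately show "x = y" by (intro aut_product_eqI[OF c]) (auto simp: less_Suc_eq)
  qed (rule n)
  interpret mix_group_setup ?Ps n "\<lambda>z. signed_sign (\<zeta> (z 1))" ..
  show ?thesis unfolding mix_eq_coset_poset by (rule BC.not_polytope)
qed

theorem theorem4p2:
  fixes n :: nat and \<Phi>\<^sub>T \<Phi>\<^sub>B \<Phi>\<^sub>C :: "(real ^ 'n) set set"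
  assumes "n = CARD('n)" and "n \<ge> 4"
    and "\<Phi>\<^sub>T \<in> flags (simplex_T :: (real ^ 'n) set ranked_poset)"
    and "\<Phi>\<^sub>B \<in> flags (cube_B :: (real ^ 'n) set ranked_poset)"
    and "\<Phi>\<^sub>C \<in> flags (cross_C :: (real ^ 'n) set ranked_poset)"
  shows "polytopal n (mix n [(simplex_T, \<Phi>\<^sub>T), (cube_B, \<Phi>\<^sub>B)])
       \<and> polytopal n (mix n [(simplex_T, \<Phi>\<^sub>T), (cross_C, \<Phi>\<^sub>C)])
       \<and> polytopal n (mix n [(simplex_T, \<Phi>\<^sub>T), (cube_B, \<Phi>\<^sub>B), (cross_C, \<Phi>\<^sub>C)])
       \<and> \<not> polytopal n (mix n [(cube_B, \<Phi>\<^sub>B), (cross_C, \<Phi>\<^sub>C)])"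
proof -
  obtain \<eta> where T: "simplex_model_of n simplex_T \<Phi>\<^sub>T \<eta>"
    using simplex_model[OF assms(1)] simplex_permutation_model assms(3) by blast
  obtain e :: "nat \<Rightarrow> 'n" where "signed_basis CARD('n) e" by (rule signed_basis_exists)
  then interpret signed_basis n e using assms(1) by simp
  obtain \<theta> where B: "cross_model_of n cube_B \<Phi>\<^sub>B True \<theta>"
    using cross_permutation_model[OF cube_model assms(4)] by blast
  obtain \<zeta> where C: "cross_model_of n cross_C \<Phi>\<^sub>C False \<zeta>"
    using cross_permutation_model[OF cross_model assms(5)] by blast
  have "3 \<le> n" using assms(2) by simp
  then show ?thesis
    using simplex_cross_mix_polytopal[OF T B] simplex_cross_mix_polytopal[OF T C]
      simplex_cube_cross_mix_polytopal[OF T B C] cube_cross_mix_not_polytopal[OF B C assms(2)]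
    by simp
qed

end
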